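(* Let $\sigma$ be a normalized irreducible incommensurable multiscale substitution scheme in $\mathbb{R}^d$ with prototiles $(T_1,\ldots,T_n)$, such that all tiles in the substitution rules $\varrho_\sigma$ are translated copies of the substitution tiles $\omega_\sigma$. Let $\mathcal{T}$ be a multiscale substitution tiling generated by $\sigma$, let $1\le r\le n$ and let $0\le a<b\le1$. Let $\mathbf{v}\in\mathbb{R}^n$ be a left Perron--Frobenius eigenvector of $V_\sigma$ and $\mathbf{1}=(1,\ldots,1)^T\in\mathbb{R}^n$. Then for every van Hove sequence $(A_q)_{q\ge1}$ in $\mathbb{R}^d$, as $q\to\infty$, $$\frac{\#\{\text{tiles of } \mathcal{T} \text{ of type } r \text{ and volume in }[a,b]\text{ contained in } A_q+h\}}{\mathrm{vol}(A_q)}=\int_a^b\frac{\left[\mathbf{v}^TC_\sigma(x)\right]_r}{\mathbf{v}^TH_\sigma\mathbf{1}}\,dx+o(1),$$ $$\frac{\mathrm{vol}\left(\bigcup\text{tiles of } \mathcal{T} \text{ of type } r \text{ and volume in }[a,b]\text{ contained in } A_q+h\right)}{\mathrm{vol}(A_q)}=\int_a^b\frac{\left[\mathbf{v}^TD_\sigma(x)\right]_r}{\mathbf{v}^TH_\sigma\mathbf{1}}\,dx+o(1),$$ uniformly in $h\in\mathbb{R}^d$.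
   Context: A tile in $\mathbb{R}^d$ is a labeled bounded measurable set of positive Lebesgue measure (denoted $\mathrm{vol}$) whose boundary has measure zero. A multiscale substitution scheme $\sigma$ in $\mathbb{R}^d$ consists of a finite list of prototiles $\tau_\sigma=(T_1,\ldots,T_n)$ and, for each $T_i$, a finite list $\omega(T_i)$ of substitution tiles, each of the form $\alpha T_j$ with $\alpha\in(0,1)$ and $1\le j\le n$, together with a substitution rule $\varrho(T_i)$, a partition of $T_i$ into copies of the elements of $\omega(T_i)$ (here assumed to be translated copies). Any rescaled copy of $T_j$ carries the label $j$ and is said to be of type $j$. $\omega_\sigma$ and $\varrho_\sigma$ denote the collections of all substitution tiles and all substitution rules. The scheme is normalized if all prototiles have volume $1$. Lists are counted with multiplicity. Associated graph $G_\sigma$: the directed multigraph with vertices $\{1,\ldots,n\}$ which, for every $i$ and every $T\in\omega(T_i)$ of type $j$, has an edge from $i$ to $j$ of length $\log\frac{1}{\mathrm{vol}\,T}$. $\sigma$ is irreducible if $G_\sigma$ is strongly connected, and incommensurable if $G_\sigma$ contains two closed paths of lengths $a,b$ (sums of edge lengths) with $a\notin b\mathbb{Q}$. Substitution semi-flow: for $t\ge0$, the patch $F_t^\sigma(T_i)$ is obtained from the inflated tile $e^tT_i$ by repeatedly substituting every tile whose volume is greater than $1$ (a tile $x+\beta T_j$ is replaced by the tiles of $x+\beta\varrho(T_j)$), until all tiles have volume at most $1$. Multiscale substitution tiling generated by $\sigma$: a tiling $\mathcal{T}$ of $\mathbb{R}^d$ by labeled tiles of the form $x+\beta T_j$ (up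 to sets of measure zero) that is a limit of patches of the semi-flow, in the sense that every finite sub-patch of $\mathcal{T}$ is a limit of translates of sub-patches of patches of the form $F_t^\sigma(T_i)$, $t\ge0$, $1\le i\le n$; here a sequence of patches converges to a finite patch if eventually they have the same number of tiles, which can be matched so that labels agree and the translation vectors $x$ and scales $\beta$ of matched tiles converge. A sequence $(A_q)_{q\ge1}$ of bounded measurable sets of positive measure in $\mathbb{R}^d$ is van Hove if for every $\rho>0$, $\lim_{q\to\infty}\mathrm{vol}\big((\partial A_q)^{+\rho}\big)/\mathrm{vol}(A_q)=0$, where $(\partial A_q)^{+\rho}$ is the $\rho$-neighborhood of the boundary of $A_q$. Matrices in $M_n(\mathbb{R})$ (sums over tiles $T\in\omega(T_i)$ of type $j$): $$(V_\sigma)_{ij}=\sum_T\mathrm{vol}\,T,\quad (H_\sigma)_{ij}=\sum_T-\mathrm{vol}\,T\cdot\log\mathrm{vol}\,T,\quad (C_\sigma(x))_{ij}=\sum_Tc_{\mathrm{vol}\,T}(x),\quad (D_\sigma(x))_{ij}=\sum_Td_{\mathrm{vol}\,T}(x),$$ where $c_{\mathrm{vol}\,T}(x)=\frac{\mathrm{vol}\,T}{x^2}$ and $d_{\mathrm{vol}\,T}(x)=\frac{\mathrm{vol}\,T}{x}$ if $\mathrm{vol}\,T<x\le1$, and both are $0$ otherwise. The Perron--Frobenius eigenvalue of $V_\sigma$ is $1$. $[\mathbf{w}]_r$ denotes the $r$-th entry of a vector $\mathbf{w}$. *)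

theory Defs
  imports
    "HOL-Analysis.Analysis"
    "HOL-Library.Multiset"
    "HOL-Library.While_Combinator"
    "Graph_Theory.Digraph_Component"
begin

section \<open>Schemes\<close>

text \<open>
  A labeled tile \<open>x + \<beta> T\<^sub>j\<close> is encoded by its data \<open>(x, \<beta>, j)\<close>. For a bounded prototile of
  positive volume and \<open>\<beta> > 0\<close> the labeled set determines these data. The (finite) label type \<open>'n\<close>
  plays the role of \<open>{1, \<dots>, n}\<close>.
\<close>

datatype ('a, 'n) tile = Tile (tile_pos: 'a) (tile_scale: real) (tile_label: 'n)

text \<open>
  An entry \<open>(\<alpha>, j)\<close> of \<open>subst_tiles \<sigma> i\<close> is the substitution tile \<open>\<alpha> T\<^sub>j \<in> \<omega>(T\<^sub>i)\<close>; \<open>subst_rule \<sigma> i\<close>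
  is \<open>\<rho>(T\<^sub>i)\<close>.
\<close>

record ('a, 'n) scheme =
  prototile :: "'n \<Rightarrow> 'a set"
  subst_tiles :: "'n \<Rightarrow> (real \<times> 'n) list"
  subst_rule :: "'n \<Rightarrow> ('a, 'n) tile list"

abbreviation vol :: "'a::euclidean_space set \<Rightarrow> real" where
  "vol S \<equiv> measure lebesgue S"

definition tile_set :: "('a::euclidean_space, 'n) scheme \<Rightarrow> ('a, 'n) tile \<Rightarrow> 'a set" where
  "tile_set \<sigma> T = (\<lambda>y. tile_pos T + tile_scale T *\<^sub>R y) ` prototile \<sigma> (tile_label T)"

definition tile_vol :: "('a::euclidean_space, 'n) scheme \<Rightarrow> ('a, 'n) tile \<Rightarrow> real" where
  "tile_vol \<sigma> T = vol (tile_set \<sigma> T)"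

definition subst_vol :: "('a::euclidean_space, 'n) scheme \<Rightarrow> real \<times> 'n \<Rightarrow> real" where
  "subst_vol \<sigma> = (\<lambda>(\<alpha>, j). vol ((*\<^sub>R) \<alpha> ` prototile \<sigma> j))"

definition is_tile_set :: "'a::euclidean_space set \<Rightarrow> bool" where
  "is_tile_set S \<longleftrightarrow> bounded S \<and> S \<in> sets lebesgue \<and> vol S > 0 \<and> negligible (frontier S)"

text \<open>Partitions are understood up to sets of measure zero.\<close>

definition partitions :: "'i set \<Rightarrow> ('i \<Rightarrow> 'a::euclidean_space set) \<Rightarrow> 'a set \<Rightarrow> bool" where
  "partitions I f S \<longleftrightarrow>
     pairwise (\<lambda>i j. negligible (f i \<inter> f j)) I \<and> negligible (sym_diff (\<Union>i\<in>I. f i) S)"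

text \<open>The multiset equation says that \<open>\<rho>(T\<^sub>i)\<close> consists of translated copies of the tiles of \<open>\<omega>(T\<^sub>i)\<close>.\<close>

definition multiscale_scheme :: "('a::euclidean_space, 'n::finite) scheme \<Rightarrow> bool" where
  "multiscale_scheme \<sigma> \<longleftrightarrow>
     (\<forall>i. is_tile_set (prototile \<sigma> i)) \<and>
     (\<forall>i. \<forall>(\<alpha>, j) \<in> set (subst_tiles \<sigma> i). 0 < \<alpha> \<and> \<alpha> < 1) \<and>
     (\<forall>i. mset (map (\<lambda>T. (tile_scale T, tile_label T)) (subst_rule \<sigma> i)) = mset (subst_tiles \<sigma> i)) \<and>
     (\<forall>i. partitions {..<length (subst_rule \<sigma> i)} (\<lambda>k. tile_set \<sigma> (subst_rule \<sigma> i ! k))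
            (prototile \<sigma> i))"

definition normalized :: "('a::euclidean_space, 'n) scheme \<Rightarrow> bool" where
  "normalized \<sigma> \<longleftrightarrow> (\<forall>i. vol (prototile \<sigma> i) = 1)"


section \<open>The associated graph\<close>

text \<open>The arc \<open>(i, k)\<close> stands for the \<open>k\<close>-th entry of the list \<open>\<omega>(T\<^sub>i)\<close>.\<close>

definition scheme_graph :: "('a, 'n) scheme \<Rightarrow> ('n, 'n \<times> nat) pre_digraph" where
  "scheme_graph \<sigma> =
     \<lparr>verts = UNIV,
      arcs = {(i, k). k < length (subst_tiles \<sigma> i)},
      tail = fst,
      head = (\<lambda>(i, k). snd (subst_tiles \<sigma> i ! k))\<rparr>"

definition arc_length :: "('a::euclidean_space, 'n) scheme \<Rightarrow> 'n \<times> nat \<Rightarrow> real" where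
  "arc_length \<sigma> = (\<lambda>(i, k). ln (1 / subst_vol \<sigma> (subst_tiles \<sigma> i ! k)))"

definition irreducible_scheme :: "('a, 'n) scheme \<Rightarrow> bool" where
  "irreducible_scheme \<sigma> \<longleftrightarrow> strongly_connected (scheme_graph \<sigma>)"

text \<open>Closed paths are non-empty closed walks.\<close>

definition incommensurable :: "('a::euclidean_space, 'n) scheme \<Rightarrow> bool" where
  "incommensurable \<sigma> \<longleftrightarrow>
     (\<exists>p q. wf_digraph.closed_w (scheme_graph \<sigma>) p \<and> wf_digraph.closed_w (scheme_graph \<sigma>) q \<and>
        sum_list (map (arc_length \<sigma>) p)
          \<notin> (\<lambda>s. sum_list (map (arc_length \<sigma>) q) * s) ` \<rat>)"


section \<open>The semi-flow and multiscale substitution tilings\<close>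

definition substitute :: "('a::euclidean_space, 'n) scheme \<Rightarrow> ('a, 'n) tile \<Rightarrow> ('a, 'n) tile set" where
  "substitute \<sigma> T =
     (\<lambda>S. Tile (tile_pos T + tile_scale T *\<^sub>R tile_pos S) (tile_scale T * tile_scale S) (tile_label S))
       ` set (subst_rule \<sigma> (tile_label T))"

definition subst_step ::
  "('a::euclidean_space, 'n) scheme \<Rightarrow> ('a, 'n) tile set \<Rightarrow> ('a, 'n) tile set" where
  "subst_step \<sigma> P = (\<Union>T\<in>P. if tile_vol \<sigma> T > 1 then substitute \<sigma> T else {T})"

text \<open>The loop terminates for multiscale schemes, since all scales in the rules lie in \<open>(0, 1)\<close>.\<close>

definition semi_flow :: "('a::euclidean_space, 'n) scheme \<Rightarrow> real \<Rightarrow> 'n \<Rightarrow> ('a, 'n) tile set" where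
  "semi_flow \<sigma> t i =
     while (\<lambda>P. \<exists>T\<in>P. tile_vol \<sigma> T > 1) (subst_step \<sigma>) {Tile 0 (exp t) i}"

definition translate :: "'a::euclidean_space \<Rightarrow> ('a, 'n) tile \<Rightarrow> ('a, 'n) tile" where
  "translate x T = Tile (x + tile_pos T) (tile_scale T) (tile_label T)"

text \<open>Convergence to a finite patch \<open>P\<close>, where \<open>g k\<close> matches the tiles of \<open>P\<close> with those of \<open>Q k\<close>.\<close>

definition patch_limit :: "(nat \<Rightarrow> ('a::euclidean_space, 'n) tile set) \<Rightarrow> ('a, 'n) tile set \<Rightarrow> bool" where
  "patch_limit Q P \<longleftrightarrow>
     (\<exists>g. (\<forall>\<^sub>F k in sequentially. bij_betw (g k) P (Q k) \<and>
             (\<forall>T\<in>P. tile_label (g k T) = tile_label T)) \<and>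
          (\<forall>T\<in>P. (\<lambda>k. tile_pos (g k T)) \<longlonglongrightarrow> tile_pos T \<and>
                 (\<lambda>k. tile_scale (g k T)) \<longlonglongrightarrow> tile_scale T))"

definition generated_tiling ::
  "('a::euclidean_space, 'n) scheme \<Rightarrow> ('a, 'n) tile set \<Rightarrow> bool" where
  "generated_tiling \<sigma> \<T> \<longleftrightarrow>
     (\<forall>T\<in>\<T>. tile_scale T > 0) \<and>
     partitions \<T> (tile_set \<sigma>) UNIV \<and>
     (\<forall>P. finite P \<and> P \<subseteq> \<T> \<longrightarrow>
        (\<exists>Q. (\<forall>k::nat. \<exists>t\<ge>0. \<exists>i x. \<exists>R \<subseteq> semi_flow \<sigma> t i. Q k = translate x ` R) \<and>
             patch_limit Q P))"

definition tiles_in ::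
  "('a::euclidean_space, 'n) scheme \<Rightarrow> ('a, 'n) tile set \<Rightarrow> 'n \<Rightarrow> real \<Rightarrow> real \<Rightarrow> 'a set \<Rightarrow> ('a, 'n) tile set"
where
  "tiles_in \<sigma> \<T> r a b A =
     {T \<in> \<T>. tile_label T = r \<and> tile_vol \<sigma> T \<in> {a..b} \<and> tile_set \<sigma> T \<subseteq> A}"

text \<open>Sequences are indexed by \<open>q \<ge> 1\<close>; the value at \<open>0\<close> is irrelevant.\<close>

definition van_Hove :: "(nat \<Rightarrow> 'a::euclidean_space set) \<Rightarrow> bool" where
  "van_Hove A \<longleftrightarrow>
     (\<forall>q\<ge>1. bounded (A q) \<and> A q \<in> sets lebesgue \<and> vol (A q) > 0) \<and>
     (\<forall>\<rho>>0. (\<lambda>q. vol (\<Union>x\<in>frontier (A q). ball x \<rho>) / vol (A q)) \<longlonglongrightarrow> 0)"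


section \<open>Matrices\<close>

text \<open>The matrix with entries \<open>\<Sum>f(vol T)\<close>, the sum ranging over the tiles \<open>T\<close> of type \<open>j\<close> in \<open>\<omega>(T\<^sub>i)\<close>.\<close>

definition type_matrix ::
  "(real \<Rightarrow> real) \<Rightarrow> ('a::euclidean_space, 'n::finite) scheme \<Rightarrow> real ^ 'n ^ 'n" where
  "type_matrix f \<sigma> =
     (\<chi> i j. \<Sum>T\<leftarrow>filter (\<lambda>T. snd T = j) (subst_tiles \<sigma> i). f (subst_vol \<sigma> T))"

definition V_matrix :: "('a::euclidean_space, 'n::finite) scheme \<Rightarrow> real ^ 'n ^ 'n" where
  "V_matrix = type_matrix (\<lambda>u. u)"

definition H_matrix :: "('a::euclidean_space, 'n::finite) scheme \<Rightarrow> real ^ 'n ^ 'n" where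
  "H_matrix = type_matrix (\<lambda>u. - u * ln u)"

definition C_matrix :: "('a::euclidean_space, 'n::finite) scheme \<Rightarrow> real \<Rightarrow> real ^ 'n ^ 'n" where
  "C_matrix \<sigma> x = type_matrix (\<lambda>u. if u < x \<and> x \<le> 1 then u / x\<^sup>2 else 0) \<sigma>"

definition D_matrix :: "('a::euclidean_space, 'n::finite) scheme \<Rightarrow> real \<Rightarrow> real ^ 'n ^ 'n" where
  "D_matrix \<sigma> x = type_matrix (\<lambda>u. if u < x \<and> x \<le> 1 then u / x else 0) \<sigma>"

text \<open>The Perron--Frobenius eigenvalue of a non-negative matrix is its spectral radius.\<close>

definition PF_eigenvalue :: "real ^ 'n ^ 'n \<Rightarrow> real" where
  "PF_eigenvalue M =
     Sup {cmod \<mu> |\<mu>. \<exists>w. w \<noteq> 0 \<and> (\<chi> i j. complex_of_real (M $ i $ j)) *v w = \<mu> *s w}"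

definition left_PF_eigenvector :: "real ^ 'n ^ 'n \<Rightarrow> real ^ 'n \<Rightarrow> bool" where
  "left_PF_eigenvector M v \<longleftrightarrow> v \<noteq> 0 \<and> v v* M = PF_eigenvalue M *s v"

end

theory Submission
  imports Defs
begin

text \<open>
  Start a Markov chain at a tile of type \<open>i\<close> and volume \<open>exp y\<close> and move to a substitution tile with
  probability equal to its relative volume until the volume is at most \<open>1\<close>. The expectation \<open>U i y\<close> of
  a test function of the final tile satisfies a renewal equation on the scheme graph. If the test
  function vanishes at \<open>1\<close> and at the volumes of the substitution tiles, then \<open>U\<close> is Lipschitz, and
  convergence as \<open>y \<rightarrow> \<infinity>\<close> follows from a maximum principle: by incommensurability \<open>U\<close> is close to its
  limit superior on long windows arbitrarily far out, and a conserved flux weighted by the left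
  eigenvector of \<open>V\<close> determines the value there; the same holds for the limit inferior.

  For the tiling, the tiles contained in \<open>A\<^sub>q + h\<close> are approximated by a patch of the semi-flow, which is
  grouped into subdivided supertiles of large but bounded volume. Supertiles inside \<open>A\<^sub>q + h\<close> have nearly
  the right statistics by the renewal theorem, and all other tiles lie near the boundary, which the
  van Hove condition makes negligible. Indicators of intervals are finally compared with test functions
  vanishing at finitely many points.
\<close>

section \<open>A renewal theorem on weighted graphs\<close>

text \<open>The tiling comes without a hierarchy: it is only a limit of patches, so supertiles exist
  only in an approximating patch and vary with it. Uniformity in \<open>h\<close> survives because
  the size of the supertiles is fixed by the test function and the precision alone, before
  \<open>q\<close>, \<open>h\<close> and the patch are chosen; the remaining estimates are
  translation invariant. Two discontinuities obstruct a direct argument. A tile of volume exactly 1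
  is kept while a slightly larger one is substituted, so in general the expectation jumps at
  logarithmic volume 0 and later values inherit the jumps; and the indicator of
  \<open>{a..b}\<close> jumps at its ends. Test functions that vanish at finitely many volumes
  remove both, at small cost since the limit law has a density. That law is the stationary overshoot
  law of renewal theory: an arc of probability \<open>p\<close> contributes the density
  \<open>p / x\<close> on volumes between \<open>p\<close> and 1, and the mean arc length
  \<open>v \<bullet> (H_matrix \<sigma> *v 1)\<close> normalizes it. Testing with 1 measures volume
  and gives \<open>D_matrix\<close>; testing with \<open>1 / x\<close> counts tiles and gives the
  further factor in \<open>C_matrix\<close>.\<close>

text \<open>Write \<open>x\<close> as \<open>l * b + r\<close> with \<open>0 \<le> r < b\<close> and
  correct the remainder in steps of size \<open>s\<close>: each step trades \<open>n\<close> copies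
  of \<open>b\<close> for \<open>m\<close> copies of \<open>a\<close>. At most \<open>b / s\<close>
  steps occur, and the threshold on \<open>x\<close> provides enough copies of \<open>b\<close> for
  all of them.\<close>

lemma dense_combinations_aux:
  fixes a b e s :: real and m n :: nat
  assumes "a > 0" "b > 0" "0 < s" "s = real m * a - real n * b" "s < e"
  shows "\<exists>X. \<forall>x\<ge>X. \<exists>k l::nat. \<bar>real k * a + real l * b - x\<bar> < e"
proof (rule exI[of _ "b * (real n * (b / s) + 1)"], intro allI impI)
  fix x assume x: "x \<ge> b * (real n * (b / s) + 1)"
  define l where "l = nat \<lfloor>x / b\<rfloor>"
  define r where "r = x - real l * b"
  define j where "j = nat \<lfloor>r / s\<rfloor>"
  have x0: "x / b \<ge> real n * (b / s) + 1"
    using x by (simp add: pos_le_divide_eq[OF assms(2)] mult.commute)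
  have nb: "real n * (b / s) \<ge> 0" using assms by simp
  have l: "real l \<le> x / b" "x / b < real l + 1"
    using x0 nb unfolding l_def by linarith+
  have r: "0 \<le> r" "r < b"
    using l assms unfolding r_def by (simp_all add: field_simps)
  have "r / s \<ge> 0" using r assms by simp
  then have j: "real j \<le> r / s" "r / s < real j + 1"
    unfolding j_def by linarith+
  have "real j \<le> b / s"
    using j(1) divide_strict_right_mono[OF r(2) assms(3)] by linarith
  then have "real n * real j \<le> real n * (b / s)" by (intro mult_left_mono) auto
  then have "real (n * j) < real l" using x0 l by simp
  then have nj: "n * j \<le> l" by linarith
  have "real (j * m) * a + real (l - n * j) * b - x = real j * s - r"
    using nj by (simp add: of_nat_diff assms(4) r_def algebra_simps)
  moreover have "real j * s \<le> r" "r < real j * s + s"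
    using j assms(3) by (simp_all add: pos_le_divide_eq pos_divide_less_eq algebra_simps)
  ultimately show "\<exists>k l::nat. \<bar>real k * a + real l * b - x\<bar> < e"
    using assms(3,5) by (intro exI[of _ "j * m"] exI[of _ "l - n * j"]) linarith
qed

text \<open>Dirichlet approximation of \<open>a / b\<close> yields an integer combination smaller
  than \<open>e\<close>; it is non-zero because \<open>a / b\<close> is irrational. Its sign decides
  which of the two lengths is traded for the other.\<close>

lemma dense_combinations:
  fixes a b e :: real
  assumes ab: "a > 0" "b > 0" and irr: "a \<notin> (\<lambda>s. b * s) ` \<rat>" and e: "e > 0"
  shows "\<exists>X. \<forall>x\<ge>X. \<exists>k l::nat. \<bar>real k * a + real l * b - x\<bar> < e"
proof -
  define N where "N = Suc (nat \<lceil>b / e\<rceil>)"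
  have "real N > b / e" unfolding N_def by linarith
  then have "b < real N * e" using e by (simp add: pos_divide_less_eq)
  then have N: "N > 0" "b / real N < e"
    by (simp_all add: N_def pos_divide_less_eq mult.commute)
  obtain h k where hk: "0 < k" "\<bar>of_int k * (a/b) - of_int h\<bar> < 1 / N"
    using Dirichlet_approx[OF N(1)] by metis
  define s where "s = of_int k * a - of_int h * b"
  have "s = b * (of_int k * (a/b) - of_int h)"
    using ab by (simp add: s_def field_simps)
  then have "\<bar>s\<bar> = b * \<bar>of_int k * (a/b) - of_int h\<bar>" using ab by (simp add: abs_mult)
  also have "\<dots> < b * (1 / N)" using hk ab by (intro mult_strict_left_mono) auto
  finally have s: "\<bar>s\<bar> < e" using N by simp
  have s0: "s \<noteq> 0"
  proof
    assume "s = 0"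
    then have "a = b * (of_int h / of_int k)" using hk ab by (simp add: s_def field_simps)
    moreover have "of_int h / of_int k \<in> (\<rat>::real set)" by simp
    ultimately show False using irr by blast
  qed
  \<comment> \<open>With \<open>k\<close> and \<open>a / b\<close> positive, a negative
    \<open>h\<close> would make the error exceed 1. Hence both coefficients are natural
    numbers.\<close>
  have h: "h \<ge> 0"
  proof (rule ccontr)
    assume "\<not> h \<ge> 0"
    then have "(of_int h::real) \<le> -1" by linarith
    moreover have "of_int k * (a/b) > 0" using hk ab by simp
    ultimately have "\<bar>of_int k * (a/b) - of_int h\<bar> > 1" by linarith
    moreover have "1 / real N \<le> 1" using N by simp
    ultimately show False using hk by linarith
  qed
  have kk: "real (nat k) = of_int k" "real (nat h) = of_int h" using hk h by auto
  show ?thesis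
  proof (cases "s > 0")
    case True
    then show ?thesis
      using dense_combinations_aux[of a b s "nat k" "nat h" e] ab s kk by (simp add: s_def)
  next
    case False
    then have "\<exists>X. \<forall>x\<ge>X. \<exists>k l::nat. \<bar>real k * b + real l * a - x\<bar> < e"
      using dense_combinations_aux[of b a "- s" "nat h" "nat k" e] ab s s0 kk by (simp add: s_def)
    then show ?thesis by (metis add.commute)
  qed
qed

section \<open>Weighted graphs and the lengths of walks\<close>

text \<open>\<open>p\<close> is the transition probability of a Markov chain on the vertices. The
  strict bound \<open>p e < 1\<close> makes all lengths positive, so that the renewal equation
  reaches back by at least a fixed amount.\<close>

locale renewal_graph = wf_digraph G
  for G :: "('n::finite, 'e) pre_digraph" +
  fixes p :: "'e \<Rightarrow> real"
  assumes verts_UNIV: "verts G = UNIV"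
    and finite_arcs: "finite (arcs G)"
    and connected: "strongly_connected G"
    and p_pos: "e \<in> arcs G \<Longrightarrow> 0 < p e"
    and p_less_1: "e \<in> arcs G \<Longrightarrow> p e < 1"
    and p_sum: "(\<Sum>e\<in>out_arcs G i. p e) = 1"
begin

definition len :: "'e \<Rightarrow> real" where "len e = - ln (p e)"

lemma len_pos: "e \<in> arcs G \<Longrightarrow> 0 < len e"
  using p_pos p_less_1 by (simp add: len_def)

lemma finite_out_arcs [simp]: "finite (out_arcs G i)"
  using finite_arcs by (simp add: out_arcs_def)

lemma sum_arcs_tail: "(\<Sum>e\<in>arcs G. f e) = (\<Sum>i\<in>UNIV. \<Sum>e\<in>out_arcs G i. f e)"
  unfolding out_arcs_def by (rule sum.group[symmetric]) (auto simp: finite_arcs)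

lemma sum_arcs_head: "(\<Sum>e\<in>arcs G. f e) = (\<Sum>i\<in>UNIV. \<Sum>e\<in>in_arcs G i. f e)"
  unfolding in_arcs_def by (rule sum.group[symmetric]) (auto simp: finite_arcs)

lemma min_len: obtains d where "d > 0" "\<And>e. e \<in> arcs G \<Longrightarrow> d \<le> len e"
proof
  let ?d = "Min (insert 1 (len ` arcs G))"
  show "?d > 0" using finite_arcs len_pos by (subst Min_gr_iff) auto
  show "\<And>e. e \<in> arcs G \<Longrightarrow> ?d \<le> len e" using finite_arcs by (intro Min_le) auto
qed

lemma max_len: obtains d where "d > 0" "\<And>e. e \<in> arcs G \<Longrightarrow> len e \<le> d"
proof
  let ?d = "Max (insert 1 (len ` arcs G))"
  show "?d > 0" using finite_arcs by (subst Max_gr_iff) auto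
  show "\<And>e. e \<in> arcs G \<Longrightarrow> len e \<le> ?d" using finite_arcs by (intro Max_ge) auto
qed

lemma walk_exists: "\<exists>w. awalk i w j"
  using connected verts_UNIV by (auto simp: strongly_connected_def reachable_awalk)

lemma awalk_power: "awalk u w u \<Longrightarrow> awalk u (concat (replicate k w)) u"
  by (induction k) (auto simp: awalk_Nil_iff verts_UNIV intro!: awalk_appendI simp del: awalk_append_iff)

lemma closed_walk_len_pos: "closed_w w \<Longrightarrow> sum_list (map len w) > 0"
proof -
  assume "closed_w w"
  then obtain u where "awalk u w u" "w \<noteq> []" by (auto simp: closed_w_def)
  then have "set w \<subseteq> arcs G" by auto
  then have "\<And>x. x \<in> set (map len w) \<Longrightarrow> 0 < x" using len_pos by auto
  moreover have "map len w \<noteq> []" using \<open>w \<noteq> []\<close> by simp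
  ultimately show ?thesis
  proof (induction w)
    case (Cons a w)
    then show ?case by (cases w) (auto intro: add_pos_pos)
  qed simp
qed

text \<open>Both closed walks may be traversed any number of times on the way from \<open>i\<close>
  to \<open>j\<close>; the three connecting walks contribute a length \<open>c\<close> that does not
  depend on \<open>k\<close> and \<open>l\<close>.\<close>

lemma walk_family:
  assumes w: "closed_w w" "closed_w w'"
  shows "\<exists>c::real. \<forall>k l::nat. \<exists>es. awalk i es j \<and>
    sum_list (map len es) = c + real k * sum_list (map len w) + real l * sum_list (map len w')"
proof -
  obtain x x' where x: "awalk x w x" "awalk x' w' x'"
    using w by (auto simp: closed_w_def)
  obtain w1 w2 w3 where wi: "awalk i w1 x" "awalk x w2 x'" "awalk x' w3 j"
    using walk_exists by metis
  have pow: "sum_list (map len (concat (replicate k u))) = real k * sum_list (map len u)" for k u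
    by (induction k) (auto simp: algebra_simps)
  show ?thesis
  proof (intro exI allI conjI)
    fix k l
    let ?es = "w1 @ concat (replicate k w) @ w2 @ concat (replicate l w') @ w3"
    show "awalk i ?es j"
      using wi awalk_power[OF x(1)] awalk_power[OF x(2)] by (meson awalk_appendI)
    show "sum_list (map len ?es) = (sum_list (map len w1) + sum_list (map len w2) + sum_list (map len w3))
        + real k * sum_list (map len w) + real l * sum_list (map len w')"
      by (simp only: map_append sum_list_append pow)
  qed
qed

end

section \<open>Bounded solutions of the renewal equation\<close>

text \<open>The equation is required at \<open>y = 0\<close> too: there it ties the initial function
  at the origin to its values at \<open>- len e\<close> and so excludes a jump.\<close>

locale renewal_solution = renewal_graph G p
  for G :: "('n::finite, 'e) pre_digraph" and p +
  fixes U :: "'n \<Rightarrow> real \<Rightarrow> real" and K B :: real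
  assumes renewal: "y \<ge> 0 \<Longrightarrow> U i y = (\<Sum>e\<in>out_arcs G i. p e * U (head G e) (y - len e))"
    and lipschitz_start: "K-lipschitz_on {..0} (U i)"
    and bounded_solution: "\<bar>U i y\<bar> \<le> B"
begin

text \<open>Averaging with weights of sum 1 preserves a Lipschitz constant, and on each further
  window of length \<open>d\<close>, a lower bound for the arc lengths, the equation refers only to
  earlier windows. A pair on both sides of 0 is compared through 0, where both descriptions of
  \<open>U\<close> are valid.\<close>

lemma lipschitz_solution: "K-lipschitz_on UNIV (U i)"
proof -
  have K: "K \<ge> 0" using lipschitz_start lipschitz_on_nonneg by blast
  have base: "\<bar>U i x - U i y\<bar> \<le> K * (y - x)" if "x \<le> y" "y \<le> 0" for x y i
    using lipschitz_onD[OF lipschitz_start, of x y i] that by (simp add: dist_real_def)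
  obtain d where d: "d > 0" "\<And>e. e \<in> arcs G \<Longrightarrow> d \<le> len e" using min_len by blast
  have *: "\<bar>U i x - U i y\<bar> \<le> K * (y - x)" if "x \<le> y" "y \<le> real n * d" for n i x y
    using that
  proof (induction n arbitrary: i x y)
    case 0
    then show ?case using base by simp
  next
    case (Suc n)
    have pos: "\<bar>U i x - U i y\<bar> \<le> K * (y - x)" if "0 \<le> x" "x \<le> y" "y \<le> real (Suc n) * d" for x y
    proof -
      have "\<bar>U i x - U i y\<bar>
          = \<bar>\<Sum>e\<in>out_arcs G i. p e * (U (head G e) (x - len e) - U (head G e) (y - len e))\<bar>"
        using renewal[of x i] renewal[of y i] that by (simp add: sum_subtractf algebra_simps)
      also have "\<dots> \<le> (\<Sum>e\<in>out_arcs G i. p e * (K * (y - x)))"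
      proof (intro sum_abs[THEN order_trans] sum_mono)
        fix e assume e: "e \<in> out_arcs G i"
        have "y - len e \<le> real n * d" using that d(2)[of e] e by (simp add: algebra_simps)
        then have "\<bar>U (head G e) (x - len e) - U (head G e) (y - len e)\<bar> \<le> K * (y - x)"
          using Suc.IH[of "x - len e" "y - len e" "head G e"] that by simp
        then show "\<bar>p e * (U (head G e) (x - len e) - U (head G e) (y - len e))\<bar> \<le> p e * (K * (y - x))"
          using p_pos[of e] e by (simp add: abs_mult)
      qed
      also have "\<dots> = K * (y - x)" by (simp add: sum_distrib_right[symmetric] p_sum)
      finally show ?thesis .
    qed
    consider "y \<le> 0" | "x \<ge> 0" | "x < 0" "0 < y" by linarith
    then show ?case
    proof cases
      case 3
      have "\<bar>U i x - U i 0\<bar> \<le> K * (0 - x)" using base[of x 0 i] 3 by simp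
      moreover have "\<bar>U i 0 - U i y\<bar> \<le> K * (y - 0)" using pos[of 0 y] 3 Suc.prems by simp
      ultimately show ?thesis by (simp add: algebra_simps)
    qed (use base pos Suc.prems in auto)
  qed
  have **: "\<bar>U i x - U i y\<bar> \<le> K * (y - x)" if "x \<le> y" for x y
  proof -
    obtain n :: nat where "y / d < real n" using reals_Archimedean2 by blast
    then show ?thesis using *[OF that, of n] d by (simp add: field_simps)
  qed
  show ?thesis
  proof (rule lipschitz_onI)
    fix x y
    show "dist (U i x) (U i y) \<le> K * dist x y"
      using **[of x y] **[of y x] by (cases "x \<le> y") (auto simp: dist_real_def abs_minus_commute)
  qed (rule K)
qed

lemma continuous_solution: "continuous_on S (U i)"
  using lipschitz_solution lipschitz_on_continuous_on continuous_on_subset by blast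

text \<open>When an average of terms bounded by \<open>M + \<eta>\<close> is nearly maximal, no
  single term can fall short by more than the total deficit divided by its weight
  \<open>p e\<close>.\<close>

lemma step_propagation:
  assumes e: "e \<in> arcs G" "tail G e = i" and C: "0 \<le> C" "0 \<le> \<eta>"
    and upper: "\<And>j z. z \<ge> y0 \<Longrightarrow> U j z \<le> M + \<eta>"
    and ly: "y \<ge> 0" "\<And>e'. e' \<in> arcs G \<Longrightarrow> y - len e' \<ge> y0"
    and lower: "U i y \<ge> M - C * \<eta>"
  shows "U (head G e) (y - len e) \<ge> M - (C + 1) / p e * \<eta>"
proof -
  let ?R = "out_arcs G i - {e}"
  have ei: "e \<in> out_arcs G i" using e by simp
  have "U i y = p e * U (head G e) (y - len e) + (\<Sum>e'\<in>?R. p e' * U (head G e') (y - len e'))"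
    unfolding renewal[OF ly(1)] using ei by (simp add: sum.remove)
  also have "(\<Sum>e'\<in>?R. p e' * U (head G e') (y - len e')) \<le> (\<Sum>e'\<in>?R. p e' * (M + \<eta>))"
    using ly upper p_pos by (intro sum_mono mult_left_mono) (auto intro: less_imp_le)
  also have "\<dots> = (1 - p e) * (M + \<eta>)"
    using ei p_sum[of i] by (simp add: sum_distrib_right[symmetric] sum_diff1)
  finally have "M - C * \<eta> \<le> p e * U (head G e) (y - len e) + (1 - p e) * (M + \<eta>)"
    using lower by simp
  then have "p e * U (head G e) (y - len e) \<ge> p e * M - (C + 1 - p e) * \<eta>"
    by (simp add: algebra_simps)
  moreover have "(C + 1 - p e) * \<eta> \<le> (C + 1) * \<eta>"
    using p_pos[OF e(1)] C by (intro mult_right_mono) auto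
  ultimately have "p e * U (head G e) (y - len e) \<ge> p e * M - (C + 1) * \<eta>" by linarith
  then show ?thesis using p_pos[OF e(1)] by (simp add: field_simps)
qed

text \<open>The constant \<open>C'\<close> depends on the walk and on \<open>C\<close> only.
  \<open>maximal_window\<close> relies on this order of quantifiers: it fixes finitely many walks,
  hence one constant, before it chooses \<open>\<eta>\<close>. The margin \<open>D\<close> keeps
  every arc that competes along the walk above \<open>y0\<close>.\<close>

lemma walk_propagation:
  assumes "awalk i w j" "\<And>e. e \<in> arcs G \<Longrightarrow> len e \<le> D" "0 \<le> D" "0 \<le> C"
  shows "\<exists>C'\<ge>0. \<forall>M \<eta> y y0. 0 \<le> \<eta> \<longrightarrow> (\<forall>j. \<forall>z\<ge>y0. U j z \<le> M + \<eta>) \<longrightarrow> y0 \<ge> 0 \<longrightarrow>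
      y - sum_list (map len w) \<ge> y0 + D \<longrightarrow> U i y \<ge> M - C * \<eta> \<longrightarrow>
      U j (y - sum_list (map len w)) \<ge> M - C' * \<eta>"
  using assms(1,4)
proof (induction w arbitrary: i C)
  case Nil
  then show ?case by (intro exI[of _ C]) (auto simp: awalk_Nil_iff)
next
  case (Cons e w)
  have e: "e \<in> arcs G" "tail G e = i" "awalk (head G e) w j"
    using Cons.prems(1) by (auto simp: awalk_Cons_iff)
  have "(C + 1) / p e \<ge> 0" using p_pos[OF e(1)] Cons.prems by simp
  then obtain C' where C': "C' \<ge> 0" and *: "\<And>M \<eta> y y0. 0 \<le> \<eta> \<Longrightarrow> (\<forall>j. \<forall>z\<ge>y0. U j z \<le> M + \<eta>) \<Longrightarrow>
      y0 \<ge> 0 \<Longrightarrow> y - sum_list (map len w) \<ge> y0 + D \<Longrightarrow> U (head G e) y \<ge> M - (C + 1) / p e * \<eta> \<Longrightarrow>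
      U j (y - sum_list (map len w)) \<ge> M - C' * \<eta>"
    using Cons.IH[OF e(3)] by blast
  have w: "set w \<subseteq> arcs G" using e(3) by auto
  have wn: "sum_list (map len w) \<ge> 0"
    using w len_pos by (intro sum_list_nonneg) (auto intro: less_imp_le)
  show ?case
  proof (intro exI[of _ C'] conjI allI impI C')
    fix M \<eta> y y0
    assume h: "0 \<le> \<eta>" "\<forall>j. \<forall>z\<ge>y0. U j z \<le> M + \<eta>" "y0 \<ge> 0"
      "y - sum_list (map len (e # w)) \<ge> y0 + D" "U i y \<ge> M - C * \<eta>"
    have y: "y \<ge> y0 + D" using h(4) wn len_pos[OF e(1)] by simp
    have "U (head G e) (y - len e) \<ge> M - (C + 1) / p e * \<eta>"
    proof (rule step_propagation[OF e(1,2) \<open>0 \<le> C\<close> h(1)])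
      show "\<And>j z. y0 \<le> z \<Longrightarrow> U j z \<le> M + \<eta>" using h by blast
      show "0 \<le> y" using y h assms by linarith
      fix e' assume "e' \<in> arcs G"
      then show "y0 \<le> y - len e'" using y assms(2)[of e'] by linarith
    qed (use h in auto)
    then show "U j (y - sum_list (map len (e # w))) \<ge> M - C' * \<eta>"
      using *[of \<eta> y0 M "y - len e"] h by (simp add: algebra_simps)
  qed
qed

text \<open>One limit superior serves all vertices, namely the infimum of the eventual upper bounds.
  It need only be approached at some vertex; connectedness carries near-maximality to the others
  later.\<close>

lemma limsup_exists:
  obtains M where "\<And>\<eta>. \<eta> > 0 \<Longrightarrow> \<exists>y0. \<forall>i. \<forall>y\<ge>y0. U i y \<le> M + \<eta>"
    "\<And>\<eta> y0. \<eta> > 0 \<Longrightarrow> \<exists>i. \<exists>y\<ge>y0. U i y \<ge> M - \<eta>"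
proof -
  let ?S = "{c. \<exists>y0. \<forall>i. \<forall>y\<ge>y0. U i y \<le> c}"
  have ne: "B \<in> ?S" using bounded_solution by (auto intro: abs_le_D1)
  have bdd: "bdd_below ?S"
  proof (rule bdd_belowI)
    fix c assume "c \<in> ?S"
    then obtain y0 where "U undefined y0 \<le> c" by auto
    then show "- B \<le> c" using bounded_solution[of undefined y0] by linarith
  qed
  show ?thesis
  proof (rule that[of "Inf ?S"])
    fix \<eta> :: real assume "\<eta> > 0"
    then obtain c where c: "c \<in> ?S" "c < Inf ?S + \<eta>"
      using cInf_lessD[of ?S "Inf ?S + \<eta>"] ne by auto
    then obtain y0 where "\<forall>i. \<forall>y\<ge>y0. U i y \<le> c" by auto
    then show "\<exists>y0. \<forall>i. \<forall>y\<ge>y0. U i y \<le> Inf ?S + \<eta>" using c(2) by (meson less_imp_le order_trans)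
  next
    fix \<eta> y0 :: real assume "\<eta> > 0"
    then have "Inf ?S - \<eta> \<notin> ?S" using cInf_lower[OF _ bdd] by force
    then obtain i y where "y \<ge> y0" "\<not> U i y \<le> Inf ?S - \<eta>" by blast
    then show "\<exists>i. \<exists>y\<ge>y0. U i y \<ge> Inf ?S - \<eta>" by (meson less_imp_le not_le)
  qed
qed

text \<open>Near a point where \<open>U\<close> almost attains its limit superior, the averaging property forces \<open>U\<close> to be
  almost maximal at the ends of all walks of bounded length. Incommensurability makes these ends
  dense in a window, which may be taken as long as desired.\<close>

lemma maximal_window:
  assumes w: "closed_w w" "closed_w w'"
      "sum_list (map len w) \<notin> (\<lambda>s. sum_list (map len w') * s) ` \<rat>"
    and M: "\<And>\<eta>. \<eta> > 0 \<Longrightarrow> \<exists>y0. \<forall>i. \<forall>y\<ge>y0. U i y \<le> M + \<eta>"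
      "\<And>\<eta> y0. \<eta> > 0 \<Longrightarrow> \<exists>i. \<exists>y\<ge>y0. U i y \<ge> M - \<eta>"
    and eps: "\<epsilon> > 0" and L: "L > 0"
  shows "\<exists>Y\<ge>Y0. \<forall>i. \<forall>z\<in>{Y..Y + L}. U i z \<ge> M - \<epsilon>"
proof -
  define a where "a = sum_list (map len w)"
  define b where "b = sum_list (map len w')"
  have ab: "a > 0" "b > 0" using w closed_walk_len_pos by (simp_all add: a_def b_def)
  have K: "K \<ge> 0" using lipschitz_start lipschitz_on_nonneg by blast
  \<comment> \<open>Missing a point of the window by \<open>\<epsilon>1\<close> costs at most
    \<open>\<epsilon> / 2\<close> by the Lipschitz bound; the other half is reserved for the deficit
    along walks.\<close>
  define \<epsilon>1 where "\<epsilon>1 = \<epsilon> / (2 * (K + 1))"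
  have e1: "\<epsilon>1 > 0" "K * \<epsilon>1 \<le> \<epsilon> / 2" using eps K by (simp_all add: \<epsilon>1_def field_simps)
  obtain X where X: "\<And>x. x \<ge> X \<Longrightarrow> \<exists>k l::nat. \<bar>real k * a + real l * b - x\<bar> < \<epsilon>1"
    using dense_combinations[OF ab _ e1(1)] w(3) unfolding a_def b_def by blast
  have "\<forall>i j. \<exists>c. \<forall>k l::nat. \<exists>es. awalk i es j \<and> sum_list (map len es) = c + real k * a + real l * b"
    using walk_family[OF w(1,2)] unfolding a_def b_def by blast
  then obtain c where "\<forall>i j. \<forall>k l::nat. \<exists>es. awalk i es j \<and> sum_list (map len es) = c i j + real k * a + real l * b"
    by metis
  then obtain W where W: "\<And>i j k l. awalk i (W i j k l) j"
      "\<And>i j k l. sum_list (map len (W i j k l)) = c i j + real k * a + real l * b"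
    by metis
  obtain D where D: "D > 0" "\<And>e. e \<in> arcs G \<Longrightarrow> len e \<le> D" using max_len by blast
  define Q where "Q i j k l C' \<longleftrightarrow> C' \<ge> 0 \<and> (\<forall>M \<eta> y y0. 0 \<le> \<eta> \<longrightarrow> (\<forall>j. \<forall>z\<ge>y0. U j z \<le> M + \<eta>) \<longrightarrow> y0 \<ge> 0 \<longrightarrow>
      y - sum_list (map len (W i j k l)) \<ge> y0 + D \<longrightarrow> U i y \<ge> M - 1 * \<eta> \<longrightarrow>
      U j (y - sum_list (map len (W i j k l))) \<ge> M - C' * \<eta>)" for i j k l C'
  have "\<exists>c. Q i j k l c" for i j k l
    unfolding Q_def using walk_propagation[OF W(1)[of i j k l] D(2) less_imp_le[OF D(1)], of 1] by simp
  then obtain C where Q: "\<And>i j k l. Q i j k l (C i j k l)" by metis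
  have C: "\<And>i j k l. C i j k l \<ge> 0" using Q unfolding Q_def by blast
  have propag: "U j (y - sum_list (map len (W i j k l))) \<ge> M - C i j k l * \<eta>"
    if "0 \<le> \<eta>" "\<forall>j. \<forall>z\<ge>y0. U j z \<le> M + \<eta>" "y0 \<ge> 0"
      "y - sum_list (map len (W i j k l)) \<ge> y0 + D" "U i y \<ge> M - \<eta>" for i j k l M \<eta> y y0
    using Q[of i j k l] that unfolding Q_def by simp
  define cm where "cm = (\<Sum>i\<in>UNIV. \<Sum>j\<in>UNIV. \<bar>c i j\<bar>)"
  have cm: "\<bar>c i j\<bar> \<le> cm" for i j
  proof -
    have "\<bar>c i j\<bar> \<le> (\<Sum>j\<in>UNIV. \<bar>c i j\<bar>)" by (rule member_le_sum) auto
    also have "\<dots> \<le> cm" unfolding cm_def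
      by (rule member_le_sum[of i UNIV "\<lambda>i. \<Sum>j\<in>UNIV. \<bar>c i j\<bar>"]) (auto intro: sum_nonneg)
    finally show ?thesis .
  qed
  \<comment> \<open>The window ends \<open>X1\<close> below the near-maximal point, so that after
    removal of any connecting length \<open>c i j\<close> the distance is still beyond the density
    threshold \<open>X\<close>.\<close>
  define X1 where "X1 = \<bar>X\<bar> + cm"
  have X1: "X1 \<ge> 0" "\<And>i j. X1 - c i j \<ge> X"
  proof -
    show "X1 \<ge> 0" unfolding X1_def using cm[of undefined undefined] by linarith
    show "X1 - c i j \<ge> X" for i j unfolding X1_def using cm[of i j] by linarith
  qed
  \<comment> \<open>\<open>R\<close> bounds the length spent on the two closed walks when aiming at
    a point of the window. Thus \<open>k\<close> and \<open>l\<close> stay below \<open>N\<close>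
    and only finitely many constants \<open>C i j k l\<close> occur.\<close>
  define R where "R = X1 + L + cm + \<epsilon>1"
  define N where "N = nat \<lceil>R / a\<rceil> + nat \<lceil>R / b\<rceil>"
  have N: "k \<le> N \<and> l \<le> N" if "real k * a + real l * b \<le> R" for k l :: nat
  proof -
    have "real k * a \<ge> 0" "real l * b \<ge> 0" using ab by simp_all
    then have "real k * a \<le> R" "real l * b \<le> R" using that by linarith+
    then have "real k \<le> R / a" "real l \<le> R / b" using ab by (simp_all add: field_simps)
    then show ?thesis unfolding N_def by linarith
  qed
  define Cm where "Cm = (\<Sum>i\<in>UNIV. \<Sum>j\<in>UNIV. \<Sum>k\<le>N. \<Sum>l\<le>N. C i j k l)"
  have Cm: "C i j k l \<le> Cm" if "k \<le> N" "l \<le> N" for i j k l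
  proof -
    have "C i j k l \<le> (\<Sum>l\<le>N. C i j k l)" using that C by (intro member_le_sum) auto
    also have "\<dots> \<le> (\<Sum>k\<le>N. \<Sum>l\<le>N. C i j k l)"
      using that C by (intro member_le_sum[of k _ "\<lambda>k. \<Sum>l\<le>N. C i j k l"]) (auto intro: sum_nonneg)
    also have "\<dots> \<le> (\<Sum>j\<in>UNIV. \<Sum>k\<le>N. \<Sum>l\<le>N. C i j k l)"
      using C by (intro member_le_sum[of j _ "\<lambda>j. \<Sum>k\<le>N. \<Sum>l\<le>N. C i j k l"]) (auto intro!: sum_nonneg)
    also have "\<dots> \<le> Cm" unfolding Cm_def
      using C by (intro member_le_sum[of i _ "\<lambda>i. \<Sum>j\<in>UNIV. \<Sum>k\<le>N. \<Sum>l\<le>N. C i j k l"]) (auto intro!: sum_nonneg)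
    finally show ?thesis .
  qed
  have Cm0: "Cm \<ge> 0" unfolding Cm_def using C by (intro sum_nonneg) auto
  \<comment> \<open>\<open>Cm\<close> was fixed independently of \<open>\<eta>\<close>, so the
    deficit at the end of every walk in use can be forced below
    \<open>\<epsilon> / 2\<close>.\<close>
  define \<eta> where "\<eta> = \<epsilon> / (2 * (Cm + 1))"
  have eta: "\<eta> > 0" "Cm * \<eta> \<le> \<epsilon> / 2" using eps Cm0 by (simp_all add: \<eta>_def field_simps)
  obtain y1 where y1: "\<forall>i. \<forall>y\<ge>y1. U i y \<le> M + \<eta>" using M(1)[OF eta(1)] by blast
  define y0 where "y0 = max (max y1 0) Y0"
  have y0: "\<forall>i. \<forall>y\<ge>y0. U i y \<le> M + \<eta>" "y0 \<ge> 0" "y0 \<ge> Y0"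
    using y1 by (simp_all add: y0_def)
  obtain i0 y where y: "y \<ge> y0 + D + X1 + L + \<epsilon>1" "U i0 y \<ge> M - \<eta>"
    using M(2)[OF eta(1)] by blast
  show ?thesis
  proof (intro exI[of _ "y - X1 - L"] conjI allI ballI)
    show "y - X1 - L \<ge> Y0" using y(1) y0 D e1 by linarith
    fix i z assume z: "z \<in> {y - X1 - L..y - X1 - L + L}"
    define x where "x = y - z - c i0 i"
    have z: "y - X1 - L \<le> z" "z \<le> y - X1" using z by auto
    have "y - z \<ge> X1" using z by simp
    then have "x \<ge> X" using X1(2)[of i0 i] by (simp add: x_def)
    then obtain k l :: nat where kl: "\<bar>real k * a + real l * b - x\<bar> < \<epsilon>1" using X by blast
    have "x \<le> X1 + L + cm" using z cm[of i0 i] unfolding x_def by linarith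
    then have "real k * a + real l * b \<le> R" using kl unfolding R_def by linarith
    then have kN: "k \<le> N" "l \<le> N" using N by blast+
    let ?s = "sum_list (map len (W i0 i k l))"
    have s: "\<bar>y - ?s - z\<bar> < \<epsilon>1" using kl unfolding W(2) x_def by linarith
    have "y - ?s \<ge> y0 + D" using s z y(1) by linarith
    then have "U i (y - ?s) \<ge> M - C i0 i k l * \<eta>"
      using propag[OF less_imp_le[OF eta(1)] y0(1,2) _ y(2)] by blast
    moreover have "C i0 i k l * \<eta> \<le> Cm * \<eta>" using Cm[OF kN] eta by (intro mult_right_mono) auto
    moreover have "\<bar>U i (y - ?s) - U i z\<bar> \<le> K * \<bar>y - ?s - z\<bar>"
      using lipschitz_onD[OF lipschitz_solution, of "y - ?s" z i] by (simp add: dist_real_def)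
    moreover have "K * \<bar>y - ?s - z\<bar> \<le> K * \<epsilon>1" using s K by (intro mult_left_mono) auto
    ultimately show "M - \<epsilon> \<le> U i z" using eta(2) e1(2) by linarith
  qed
qed

text \<open>The flux is conserved because \<open>v\<close> is invariant and \<open>U\<close> solves the renewal equation.\<close>

definition flux :: "('n \<Rightarrow> real) \<Rightarrow> real \<Rightarrow> real" where
  "flux v y = (\<Sum>e\<in>arcs G. v (tail G e) * p e * integral {y - len e..y} (U (head G e)))"

lemma flux_constant:
  assumes v: "\<And>j. (\<Sum>e\<in>in_arcs G j. v (tail G e) * p e) = v j" and Y: "Y \<ge> 0"
  shows "flux v Y = flux v 0"
proof -
  obtain D where D: "D > 0" "\<And>e. e \<in> arcs G \<Longrightarrow> len e \<le> D" using max_len by blast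
  \<comment> \<open>Antiderivatives on \<open>{-D..Y}\<close> cover every window
    \<open>{y - len e..y}\<close> with \<open>y\<close> in \<open>{0..Y}\<close> and make the flux
    differentiable in \<open>y\<close>.\<close>
  have "\<forall>j. \<exists>g. \<forall>x\<in>{-D..Y}. (g has_vector_derivative U j x) (at x within {-D..Y})"
    using antiderivative_continuous[OF continuous_solution] by metis
  then obtain \<Phi> where \<Phi>: "\<And>j x. x \<in> {-D..Y} \<Longrightarrow> (\<Phi> j has_vector_derivative U j x) (at x within {-D..Y})"
    by metis
  have \<Phi>': "(\<Phi> j has_vector_derivative U j x) (at x within S)" if "x \<in> S" "S \<subseteq> {-D..Y}" for j x S
    using that by (intro has_vector_derivative_within_subset[OF \<Phi>]) auto
  define g where "g y = (\<Sum>e\<in>arcs G. v (tail G e) * p e * (\<Phi> (head G e) y - \<Phi> (head G e) (y - len e)))" for y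
  have flux: "flux v y = g y" if "y \<in> {0..Y}" for y
    unfolding flux_def g_def
  proof (intro sum.cong refl)
    fix e assume e: "e \<in> arcs G"
    have "(U (head G e) has_integral \<Phi> (head G e) y - \<Phi> (head G e) (y - len e)) {y - len e..y}"
      using that len_pos[OF e] D(2)[OF e] by (intro fundamental_theorem_of_calculus \<Phi>') auto
    then show "v (tail G e) * p e * integral {y - len e..y} (U (head G e))
        = v (tail G e) * p e * (\<Phi> (head G e) y - \<Phi> (head G e) (y - len e))"
      by (simp add: integral_unique)
  qed
  have "\<exists>c. \<forall>x\<in>{0..Y}. g x = c"
  proof (rule has_field_derivative_zero_constant)
    fix y assume y: "y \<in> {0..Y}"
    have "(g has_field_derivative
        (\<Sum>e\<in>arcs G. v (tail G e) * p e * (U (head G e) y - U (head G e) (y - len e)))) (at y within {0..Y})"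
      unfolding g_def
    proof (intro DERIV_sum DERIV_cmult DERIV_diff)
      fix e assume e: "e \<in> arcs G"
      show "(\<Phi> (head G e) has_real_derivative U (head G e) y) (at y within {0..Y})"
        using \<Phi>'[OF y] D(1) by (simp add: has_real_derivative_iff_has_vector_derivative)
      have "(\<Phi> (head G e) has_real_derivative U (head G e) (y - len e)) (at (y - len e) within (\<lambda>y. y - len e) ` {0..Y})"
        unfolding has_real_derivative_iff_has_vector_derivative
        using y len_pos[OF e] D(2)[OF e] by (intro \<Phi>') auto
      then have "(\<Phi> (head G e) \<circ> (\<lambda>y. y - len e) has_real_derivative U (head G e) (y - len e) * 1) (at y within {0..Y})"
        by (rule DERIV_image_chain) (auto intro!: derivative_eq_intros)
      then show "((\<lambda>y. \<Phi> (head G e) (y - len e)) has_real_derivative U (head G e) (y - len e)) (at y within {0..Y})"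
        by (simp add: o_def)
    qed
    \<comment> \<open>Grouping the first terms by head uses the invariance of \<open>v\<close>,
      grouping the second by tail uses the renewal equation; both give
      \<open>\<Sum>j\<in>UNIV. v j * U j y\<close>.\<close>
    also have "(\<Sum>e\<in>arcs G. v (tail G e) * p e * (U (head G e) y - U (head G e) (y - len e))) = 0"
    proof -
      have "(\<Sum>e\<in>arcs G. v (tail G e) * p e * U (head G e) y)
          = (\<Sum>j\<in>UNIV. (\<Sum>e\<in>in_arcs G j. v (tail G e) * p e) * U j y)"
        unfolding sum_arcs_head by (simp add: sum_distrib_right)
      then have "(\<Sum>e\<in>arcs G. v (tail G e) * p e * U (head G e) y) = (\<Sum>j\<in>UNIV. v j * U j y)"
        by (simp only: v)
      moreover have "(\<Sum>e\<in>arcs G. v (tail G e) * p e * U (head G e) (y - len e)) = (\<Sum>j\<in>UNIV. v j * U j y)"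
        using y by (simp add: sum_arcs_tail renewal sum_distrib_left mult.assoc)
      ultimately show ?thesis by (simp add: right_diff_distrib sum_subtractf)
    qed
    finally show "(g has_field_derivative 0) (at y within {0..Y})" .
  qed auto
  then show ?thesis using flux[of Y] flux[of 0] Y by auto
qed

text \<open>On a window of length \<open>D\<close> where \<open>U\<close> is close to
  \<open>M\<close>, each integral in the flux is close to \<open>M * len e\<close>, so the flux is
  close to \<open>M * h\<close>. Being conserved, it equals its value at 0.\<close>

lemma limsup_value:
  assumes w: "closed_w w" "closed_w w'"
      "sum_list (map len w) \<notin> (\<lambda>s. sum_list (map len w') * s) ` \<rat>"
    and v: "\<And>j. (\<Sum>e\<in>in_arcs G j. v (tail G e) * p e) = v j"
    and h: "h = (\<Sum>e\<in>arcs G. v (tail G e) * p e * len e)" "h \<noteq> 0"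
    and M: "\<And>\<eta>. \<eta> > 0 \<Longrightarrow> \<exists>y0. \<forall>i. \<forall>y\<ge>y0. U i y \<le> M + \<eta>"
      "\<And>\<eta> y0. \<eta> > 0 \<Longrightarrow> \<exists>i. \<exists>y\<ge>y0. U i y \<ge> M - \<eta>"
  shows "M = flux v 0 / h"
proof -
  obtain D where D: "D > 0" "\<And>e. e \<in> arcs G \<Longrightarrow> len e \<le> D" using max_len by blast
  define S where "S = (\<Sum>e\<in>arcs G. \<bar>v (tail G e) * p e\<bar> * len e)"
  have S: "S \<ge> 0" unfolding S_def using len_pos by (intro sum_nonneg mult_nonneg_nonneg) (auto intro: less_imp_le)
  have "\<bar>flux v 0 - M * h\<bar> \<le> \<epsilon>" if "\<epsilon> > 0" for \<epsilon>
  proof -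
    define \<epsilon>1 where "\<epsilon>1 = \<epsilon> / (S + 1)"
    have e1: "\<epsilon>1 > 0" "\<epsilon>1 * S \<le> \<epsilon>" using that S by (simp_all add: \<epsilon>1_def field_simps)
    obtain y0 where y0: "\<forall>i. \<forall>y\<ge>y0. U i y \<le> M + \<epsilon>1" using M(1) e1 by blast
    obtain Y where Y: "Y \<ge> max y0 0" "\<forall>i. \<forall>z\<in>{Y..Y + D}. U i z \<ge> M - \<epsilon>1"
      using maximal_window[OF w M e1(1) D(1)] by blast
    have U: "\<bar>U i z - M\<bar> \<le> \<epsilon>1" if "z \<in> {Y..Y + D}" for i z
    proof -
      have "U i z \<le> M + \<epsilon>1" using y0 Y(1) that by simp
      moreover have "U i z \<ge> M - \<epsilon>1" using Y(2) that by blast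
      ultimately show ?thesis by linarith
    qed
    have "flux v 0 - M * h = (\<Sum>e\<in>arcs G. v (tail G e) * p e * (integral {Y + D - len e..Y + D} (U (head G e)) - M * len e))"
      using flux_constant[OF v, of "Y + D"] Y(1) D(1)
      by (simp add: flux_def h(1) right_diff_distrib sum_subtractf sum_distrib_left mult_ac)
    also have "\<bar>\<dots>\<bar> \<le> (\<Sum>e\<in>arcs G. \<bar>v (tail G e) * p e\<bar> * (\<epsilon>1 * len e))"
    proof (intro sum_abs[THEN order_trans] sum_mono)
      fix e assume e: "e \<in> arcs G"
      let ?I = "{Y + D - len e..Y + D}"
      have sub: "?I \<subseteq> {Y..Y + D}" using D(2)[OF e] by auto
      have int: "U (head G e) integrable_on ?I"
        by (intro integrable_continuous_real continuous_solution)
      have "integral ?I (U (head G e)) - M * len e = integral ?I (\<lambda>z. U (head G e) z - M)"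
        using len_pos[OF e] by (subst Henstock_Kurzweil_Integration.integral_diff[OF int]) auto
      also have "norm \<dots> \<le> integral ?I (\<lambda>z. \<epsilon>1)"
        using U sub int by (intro integral_norm_bound_integral integrable_diff) auto
      finally have "\<bar>integral ?I (U (head G e)) - M * len e\<bar> \<le> \<epsilon>1 * len e"
        using len_pos[OF e] by (simp add: mult.commute)
      then show "\<bar>v (tail G e) * p e * (integral ?I (U (head G e)) - M * len e)\<bar>
          \<le> \<bar>v (tail G e) * p e\<bar> * (\<epsilon>1 * len e)"
        by (subst abs_mult) (intro mult_left_mono, auto)
    qed
    also have "\<dots> = \<epsilon>1 * S" unfolding S_def by (subst sum_distrib_left) (intro sum.cong refl mult.left_commute)
    finally show ?thesis using e1 by linarith
  qed
  then have "\<bar>flux v 0 - M * h\<bar> \<le> 0" by (rule field_le_epsilon) simp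
  then show ?thesis using h(2) by (simp add: field_simps)
qed

text \<open>\<open>- U\<close> solves the same equation with the opposite flux. The value of its
  limit superior is therefore minus that of \<open>U\<close>, so the limits superior and inferior of
  \<open>U\<close> coincide.\<close>

theorem renewal_limit:
  assumes w: "closed_w w" "closed_w w'"
      "sum_list (map len w) \<notin> (\<lambda>s. sum_list (map len w') * s) ` \<rat>"
    and v: "\<And>j. (\<Sum>e\<in>in_arcs G j. v (tail G e) * p e) = v j"
    and h: "h = (\<Sum>e\<in>arcs G. v (tail G e) * p e * len e)" "h \<noteq> 0"
  shows "(U i \<longlongrightarrow> flux v 0 / h) at_top"
proof -
  interpret neg: renewal_solution G p "\<lambda>i y. - U i y" K B
    using lipschitz_start bounded_solution renewal
    by unfold_locales (auto simp: sum_negf)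
  have flux: "neg.flux v 0 = - flux v 0"
    unfolding neg.flux_def flux_def by (simp add: sum_negf)
  obtain M where M: "\<And>\<eta>. \<eta> > 0 \<Longrightarrow> \<exists>y0. \<forall>i. \<forall>y\<ge>y0. U i y \<le> M + \<eta>"
    "\<And>\<eta> y0. \<eta> > 0 \<Longrightarrow> \<exists>i. \<exists>y\<ge>y0. U i y \<ge> M - \<eta>" using limsup_exists by blast
  obtain M' where M': "\<And>\<eta>. \<eta> > 0 \<Longrightarrow> \<exists>y0. \<forall>i. \<forall>y\<ge>y0. - U i y \<le> M' + \<eta>"
    "\<And>\<eta> y0. \<eta> > 0 \<Longrightarrow> \<exists>i. \<exists>y\<ge>y0. - U i y \<ge> M' - \<eta>" using neg.limsup_exists by blast
  have "M = flux v 0 / h" by (rule limsup_value[OF w v h M])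
  moreover have "M' = - (flux v 0 / h)" using neg.limsup_value[OF w v h M'] flux by simp
  ultimately have MM: "M' = - M" by simp
  have "(U i \<longlongrightarrow> M) at_top"
  proof (rule tendstoI)
    fix \<eta> :: real assume "\<eta> > 0"
    then have "\<eta> / 2 > 0" by simp
    then obtain y0 y1 where "\<forall>i. \<forall>y\<ge>y0. U i y \<le> M + \<eta> / 2" "\<forall>i. \<forall>y\<ge>y1. - U i y \<le> M' + \<eta> / 2"
      using M(1) M'(1) by meson
    then have b: "U i y \<le> M + \<eta> / 2" "- U i y \<le> - M + \<eta> / 2" if "y \<ge> max y0 y1" for y
      using that MM by auto
    have "\<forall>y\<ge>max y0 y1. dist (U i y) M < \<eta>"
    proof (intro allI impI)
      fix y assume "y \<ge> max y0 y1"
      from b[OF this] show "dist (U i y) M < \<eta>"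
        using \<open>\<eta> > 0\<close> unfolding dist_real_def by linarith
    qed
    then show "\<forall>\<^sub>F y in at_top. dist (U i y) M < \<eta>" using eventually_at_top_linorder by blast
  qed
  then show ?thesis using \<open>M = flux v 0 / h\<close> by simp
qed

end

section \<open>Subdivision of tiles\<close>

lemma affine_image_sets_lebesgue:
  fixes S :: "'a::euclidean_space set"
  assumes "S \<in> sets lebesgue"
  shows "(\<lambda>y. x + c *\<^sub>R y) ` S \<in> sets lebesgue"
proof (cases "c = 0")
  case True
  then show ?thesis by (simp add: image_constant_conv)
next
  case False
  have "(*\<^sub>R) c ` S = (*\<^sub>R) (1 / c) -` S \<inter> space lebesgue"
  proof -
    have "x = c *\<^sub>R ((1 / c) *\<^sub>R x)" for x :: 'a using False by simp
    then show ?thesis using False by (fastforce intro: rev_image_eqI)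
  qed
  also have "\<dots> \<in> sets lebesgue"
    using lebesgue_measurable_scaling assms by (rule measurable_sets)
  finally have "(+) x ` (*\<^sub>R) c ` S \<in> sets lebesgue" by (rule lebesgue_sets_translation)
  then show ?thesis by (simp add: image_image)
qed

lemma measure_affine_image:
  "vol ((\<lambda>y. x + c *\<^sub>R y) ` S) = \<bar>c\<bar> ^ DIM('a) * vol (S :: 'a::euclidean_space set)"
  using measure_lebesgue_affine[of c x S] by (simp add: add.commute)

lemma negligible_affine_image:
  assumes "negligible (S :: 'a::euclidean_space set)" "c \<noteq> 0"
  shows "negligible ((\<lambda>y. x + c *\<^sub>R y) ` S)"
proof -
  have S: "S \<in> sets lebesgue" "emeasure lebesgue S = 0"
    using assms(1) negligible_iff_null_sets by auto
  have "emeasure lebesgue ((\<lambda>y. c *\<^sub>R y + x) ` S) = 0"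
    using emeasure_lebesgue_affine[of c x S] S by simp
  then have "(\<lambda>y. x + c *\<^sub>R y) ` S \<in> null_sets lebesgue"
    using affine_image_sets_lebesgue[OF S(1)] by (simp add: add.commute null_sets_def)
  then show ?thesis by (simp add: negligible_iff_null_sets)
qed

lemma bounded_affine_image:
  assumes "bounded (S :: 'a::euclidean_space set)"
  shows "bounded ((\<lambda>y. x + c *\<^sub>R y) ` S)"
proof -
  have "bounded ((+) x ` (*\<^sub>R) c ` S)" using assms by (intro bounded_translation bounded_scaling)
  then show ?thesis by (simp add: image_image)
qed

lemma inj_affine: "c \<noteq> (0::real) \<Longrightarrow> inj (\<lambda>y. x + c *\<^sub>R (y::'a::real_vector))"
  by (auto simp: inj_def)

lemma partitions_sum_measure:
  assumes "partitions I f S" "finite I" "\<And>i. i \<in> I \<Longrightarrow> f i \<in> lmeasurable"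
  shows "(\<Sum>i\<in>I. vol (f i)) = vol S"
proof -
  have "(\<Sum>i\<in>I. vol (f i)) = vol (\<Union>i\<in>I. f i)"
    using assms by (intro measure_negligible_finite_Union_image[symmetric]) (auto simp: partitions_def)
  also have "\<dots> = vol S"
  proof (rule measure_negligible_symdiff[symmetric])
    show "(\<Union>i\<in>I. f i) \<in> lmeasurable" using assms by (intro fmeasurable.finite_UN) auto
    show "negligible (sym_diff (\<Union>i\<in>I. f i) S)" using assms by (simp only: partitions_def)
  qed
  finally show ?thesis .
qed

lemma partitions_negligible_diff:
  assumes "partitions I f S" "i \<in> I"
  shows "negligible (f i - S)"
  using assms by (auto simp: partitions_def intro: negligible_subset[of "sym_diff (\<Union>i\<in>I. f i) S"])

lemma partitions_affine_image:
  fixes f :: "'i \<Rightarrow> 'a::euclidean_space set"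
  assumes "partitions I f S" "c \<noteq> 0"
  shows "partitions I (\<lambda>i. (\<lambda>y. x + c *\<^sub>R y) ` f i) ((\<lambda>y. x + c *\<^sub>R y) ` S)"
proof -
  let ?g = "\<lambda>y. x + c *\<^sub>R y"
  have inj: "inj ?g" using assms(2) by (rule inj_affine)
  have "sym_diff (\<Union>i\<in>I. ?g ` f i) (?g ` S) = ?g ` sym_diff (\<Union>i\<in>I. f i) S"
    by (simp add: image_Un image_set_diff[OF inj] image_UN)
  moreover have "negligible (?g ` sym_diff (\<Union>i\<in>I. f i) S)"
    using assms unfolding partitions_def by (intro negligible_affine_image) blast+
  moreover have "negligible (?g ` f i \<inter> ?g ` f j)" if "i \<in> I" "j \<in> I" "i \<noteq> j" for i j
    using assms that unfolding partitions_def pairwise_def image_Int[OF inj, symmetric]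
    by (intro negligible_affine_image) blast+
  ultimately show ?thesis unfolding partitions_def pairwise_def
    by (metis (no_types, lifting))
qed

lemma partitions_reindex:
  assumes "partitions I f S" "inj_on h I" "\<And>i. i \<in> I \<Longrightarrow> g (h i) = f i"
  shows "partitions (h ` I) g S"
  using assms by (simp add: partitions_def pairwise_def inj_on_eq_iff)

text \<open>Pieces from different blocks can meet only inside the null overlap of the blocks or in
  the null parts that stick out of them.\<close>

lemma partitions_UN:
  assumes I: "finite I" "partitions I f S" and J: "\<And>i. i \<in> I \<Longrightarrow> partitions (J i) g (f i)"
  shows "partitions (\<Union>i\<in>I. J i) g S"
proof -
  have null: "negligible (g x \<inter> g y)"
    if "i \<in> I" "i' \<in> I" "x \<in> J i" "y \<in> J i'" "x \<noteq> y" for i i' x y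
  proof (cases "i = i'")
    case True
    then show ?thesis using J[OF that(1)] that by (auto simp: partitions_def pairwise_def)
  next
    case False
    then have "negligible (f i \<inter> f i')" using I that by (auto simp: partitions_def pairwise_def)
    moreover have "negligible (g x - f i)" "negligible (g y - f i')"
      using partitions_negligible_diff[OF J] that by simp_all
    ultimately have "negligible ((g x - f i) \<union> (g y - f i') \<union> (f i \<inter> f i'))"
      by (intro negligible_Un)
    then show ?thesis by (rule negligible_subset) auto
  qed
  have "negligible ((\<Union>i\<in>I. sym_diff (\<Union>j\<in>J i. g j) (f i)) \<union> sym_diff (\<Union>i\<in>I. f i) S)"
    using I J by (intro negligible_Un negligible_Union) (auto simp: partitions_def)
  then have "negligible (sym_diff (\<Union>j\<in>(\<Union>i\<in>I. J i). g j) S)"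
    by (rule negligible_subset) blast
  then show ?thesis using null by (auto simp: partitions_def pairwise_def)
qed

lemma partitions_singleton: "partitions {i} f (f i)"
  by (simp add: partitions_def)

section \<open>Composition, translation and subdivision of tiles\<close>

text \<open>A tile acts as the affine map that places its prototile; this is the composition of two
  such maps, and substituting \<open>T\<close> is composing \<open>T\<close> with every tile of its
  rule.\<close>

definition compose_tile :: "('a::euclidean_space, 'n) tile \<Rightarrow> ('a, 'n) tile \<Rightarrow> ('a, 'n) tile" where
  "compose_tile T S = Tile (tile_pos T + tile_scale T *\<^sub>R tile_pos S) (tile_scale T * tile_scale S) (tile_label S)"

lemma compose_tile_sel [simp]:
  "tile_pos (compose_tile T S) = tile_pos T + tile_scale T *\<^sub>R tile_pos S"
  "tile_scale (compose_tile T S) = tile_scale T * tile_scale S"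
  "tile_label (compose_tile T S) = tile_label S"
  by (simp_all add: compose_tile_def)

lemma substitute_conv: "substitute \<sigma> T = compose_tile T ` set (subst_rule \<sigma> (tile_label T))"
  by (simp add: substitute_def compose_tile_def)

lemma tile_set_compose:
  "tile_set \<sigma> (compose_tile T S) = (\<lambda>y. tile_pos T + tile_scale T *\<^sub>R y) ` tile_set \<sigma> S"
  by (simp add: tile_set_def image_image algebra_simps)

lemma translate_sel [simp]:
  "tile_pos (translate x T) = x + tile_pos T" "tile_scale (translate x T) = tile_scale T"
  "tile_label (translate x T) = tile_label T"
  by (simp_all add: translate_def)

lemma tile_set_translate: "tile_set \<sigma> (translate x T) = (+) x ` tile_set \<sigma> T"
  by (simp add: tile_set_def image_image algebra_simps)

lemma translate_translate: "translate x (translate y T) = translate (x + y) T"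
  by (simp add: translate_def algebra_simps)

lemma translate_0 [simp]: "translate 0 T = T"
  by (simp add: translate_def)

lemma inj_translate: "inj (translate x)"
  by (rule inj_on_inverseI[of _ "translate (- x)"]) (simp add: translate_translate)

lemma tile_vol_translate [simp]: "tile_vol \<sigma> (translate x T) = tile_vol \<sigma> T"
  by (simp add: tile_vol_def tile_set_translate measure_translation)

lemma substitute_translate: "substitute \<sigma> (translate x T) = translate x ` substitute \<sigma> T"
  by (simp add: substitute_conv image_image compose_tile_def translate_def add.assoc)

text \<open>A relation rather than a recursive function, since the descent terminates only under
  hypotheses on \<open>\<sigma>\<close>, \<open>\<Lambda>\<close> and the tile. Threshold 1 is the
  semi-flow; larger thresholds produce the supertiles.\<close>

inductive descends :: "('a::euclidean_space, 'n) scheme \<Rightarrow> real \<Rightarrow> ('a, 'n) tile \<Rightarrow> ('a, 'n) tile \<Rightarrow> bool"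
  for \<sigma> \<Lambda> where
  stop: "tile_vol \<sigma> T \<le> \<Lambda> \<Longrightarrow> descends \<sigma> \<Lambda> T T"
| step: "tile_vol \<sigma> T > \<Lambda> \<Longrightarrow> S \<in> substitute \<sigma> T \<Longrightarrow> descends \<sigma> \<Lambda> S U \<Longrightarrow> descends \<sigma> \<Lambda> T U"

definition subdivision :: "('a::euclidean_space, 'n) scheme \<Rightarrow> real \<Rightarrow> ('a, 'n) tile \<Rightarrow> ('a, 'n) tile set" where
  "subdivision \<sigma> \<Lambda> T = {U. descends \<sigma> \<Lambda> T U}"

lemma subdivision_stop: "tile_vol \<sigma> T \<le> \<Lambda> \<Longrightarrow> subdivision \<sigma> \<Lambda> T = {T}"
  unfolding subdivision_def by (auto intro: stop elim: descends.cases)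

lemma subdivision_step:
  "tile_vol \<sigma> T > \<Lambda> \<Longrightarrow> subdivision \<sigma> \<Lambda> T = (\<Union>S\<in>substitute \<sigma> T. subdivision \<sigma> \<Lambda> S)"
  unfolding subdivision_def by (auto intro: step elim: descends.cases)

lemma descends_translate:
  "descends \<sigma> \<Lambda> T U \<Longrightarrow> descends \<sigma> \<Lambda> (translate x T) (translate x U)"
proof (induction rule: descends.induct)
  case (step T S U)
  from step.hyps show ?case
    by (intro descends.step[OF _ _ step.IH]) (simp_all add: substitute_translate)
qed (simp add: stop)

lemma subdivision_translate: "subdivision \<sigma> \<Lambda> (translate x T) = translate x ` subdivision \<sigma> \<Lambda> T"
proof
  show "translate x ` subdivision \<sigma> \<Lambda> T \<subseteq> subdivision \<sigma> \<Lambda> (translate x T)"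
    by (auto simp: subdivision_def descends_translate)
  show "subdivision \<sigma> \<Lambda> (translate x T) \<subseteq> translate x ` subdivision \<sigma> \<Lambda> T"
  proof
    fix U assume "U \<in> subdivision \<sigma> \<Lambda> (translate x T)"
    then have "translate (- x) U \<in> subdivision \<sigma> \<Lambda> T"
      using descends_translate[of \<sigma> \<Lambda> "translate x T" U "- x"]
      by (simp add: subdivision_def translate_translate)
    then show "U \<in> translate x ` subdivision \<sigma> \<Lambda> T"
      by (intro image_eqI[of _ _ "translate (- x) U"]) (simp_all add: translate_translate)
  qed
qed

text \<open>\<open>f\<close> is a density per unit of volume: \<open>1\<close> yields the total
  volume and \<open>1 / x\<close> the number of tiles. Dividing by the volume of a subdivided tile
  then gives an expectation.\<close>

definition tile_weight :: "('a::euclidean_space, 'n) scheme \<Rightarrow> ('n \<Rightarrow> real \<Rightarrow> real) \<Rightarrow> ('a, 'n) tile set \<Rightarrow> real" where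
  "tile_weight \<sigma> f P = (\<Sum>T\<in>P. tile_vol \<sigma> T * f (tile_label T) (tile_vol \<sigma> T))"

lemma tile_weight_translate: "tile_weight \<sigma> f (translate x ` P) = tile_weight \<sigma> f P"
  unfolding tile_weight_def by (subst sum.reindex) (auto intro: inj_on_subset[OF inj_translate])

locale normalized_scheme =
  fixes \<sigma> :: "('a::euclidean_space, 'n::finite) scheme"
  assumes scheme: "multiscale_scheme \<sigma>" and normal: "normalized \<sigma>"
begin

lemma prototile:
  "bounded (prototile \<sigma> i)" "prototile \<sigma> i \<in> sets lebesgue" "vol (prototile \<sigma> i) = 1"
  "negligible (frontier (prototile \<sigma> i))"
  using scheme normal by (auto simp: multiscale_scheme_def is_tile_set_def normalized_def)

lemma tile_vol_abs: "tile_vol \<sigma> T = \<bar>tile_scale T\<bar> ^ DIM('a)"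
  by (simp add: tile_vol_def tile_set_def measure_affine_image prototile)

lemma tile_vol_eq: "tile_scale T \<ge> 0 \<Longrightarrow> tile_vol \<sigma> T = tile_scale T ^ DIM('a)"
  by (simp add: tile_vol_abs)

lemma tile_vol_pos: "tile_scale T > 0 \<Longrightarrow> tile_vol \<sigma> T > 0"
  by (simp add: tile_vol_eq)

lemma bounded_tile_set: "bounded (tile_set \<sigma> T)"
  by (simp add: tile_set_def bounded_affine_image prototile)

lemma lmeasurable_tile_set: "tile_scale T > 0 \<Longrightarrow> tile_set \<sigma> T \<in> lmeasurable"
  using bounded_tile_set
  by (intro bounded_set_imp_lmeasurable) (auto simp: tile_set_def intro!: affine_image_sets_lebesgue prototile)

lemma tile_set_nonempty: "tile_set \<sigma> T \<noteq> {}"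
  using prototile(3)[of "tile_label T"] by (auto simp: tile_set_def)

lemma not_negligible_tile_set: "tile_scale T > 0 \<Longrightarrow> \<not> negligible (tile_set \<sigma> T)"
  using tile_vol_pos[of T] negligible_imp_measure0[of "tile_set \<sigma> T"] by (auto simp: tile_vol_def)

lemma mset_subst_rule:
  "mset (map (\<lambda>T. (tile_scale T, tile_label T)) (subst_rule \<sigma> i)) = mset (subst_tiles \<sigma> i)"
  using scheme by (simp add: multiscale_scheme_def)

lemma subst_tiles_scale: "(\<alpha>, j) \<in> set (subst_tiles \<sigma> i) \<Longrightarrow> 0 < \<alpha> \<and> \<alpha> < 1"
  using scheme by (auto simp: multiscale_scheme_def)

lemma subst_rule_scale:
  assumes "S \<in> set (subst_rule \<sigma> i)"
  shows "(tile_scale S, tile_label S) \<in> set (subst_tiles \<sigma> i)" "0 < tile_scale S" "tile_scale S < 1"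
proof -
  have "set (map (\<lambda>T. (tile_scale T, tile_label T)) (subst_rule \<sigma> i)) = set (subst_tiles \<sigma> i)"
    using mset_subst_rule mset_eq_setD by blast
  then show "(tile_scale S, tile_label S) \<in> set (subst_tiles \<sigma> i)" using assms by auto
  then show "0 < tile_scale S" "tile_scale S < 1" using subst_tiles_scale by blast+
qed

lemma substitute_scale_pos: "tile_scale T > 0 \<Longrightarrow> S \<in> substitute \<sigma> T \<Longrightarrow> tile_scale S > 0"
  using subst_rule_scale by (auto simp: substitute_conv)

lemma partitions_subst_rule_nth:
  "partitions {..<length (subst_rule \<sigma> i)} (\<lambda>k. tile_set \<sigma> (subst_rule \<sigma> i ! k)) (prototile \<sigma> i)"
  using scheme by (simp add: multiscale_scheme_def)

text \<open>A repeated tile would meet its copy in a set of positive volume. This is why patches can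
  be sets although the rules are lists.\<close>

lemma distinct_subst_rule: "distinct (subst_rule \<sigma> i)"
  unfolding distinct_conv_nth
proof (intro allI impI notI)
  fix k l assume kl: "k < length (subst_rule \<sigma> i)" "l < length (subst_rule \<sigma> i)" "k \<noteq> l"
    "subst_rule \<sigma> i ! k = subst_rule \<sigma> i ! l"
  have "pairwise (\<lambda>k l. negligible (tile_set \<sigma> (subst_rule \<sigma> i ! k) \<inter> tile_set \<sigma> (subst_rule \<sigma> i ! l)))
      {..<length (subst_rule \<sigma> i)}"
    using partitions_subst_rule_nth[of i] by (simp only: partitions_def)
  from pairwiseD[OF this, of k l]
  have "negligible (tile_set \<sigma> (subst_rule \<sigma> i ! k) \<inter> tile_set \<sigma> (subst_rule \<sigma> i ! l))"
    using kl by simp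
  then have "negligible (tile_set \<sigma> (subst_rule \<sigma> i ! k))" using kl by simp
  then show False
    using not_negligible_tile_set subst_rule_scale(2)[OF nth_mem[OF kl(1)]] by blast
qed

lemma partitions_subst_rule: "partitions (set (subst_rule \<sigma> i)) (tile_set \<sigma>) (prototile \<sigma> i)"
proof -
  have "partitions ((\<lambda>k. subst_rule \<sigma> i ! k) ` {..<length (subst_rule \<sigma> i)}) (tile_set \<sigma>) (prototile \<sigma> i)"
    using distinct_subst_rule[of i]
    by (intro partitions_reindex[OF partitions_subst_rule_nth]) (auto simp: inj_on_def nth_eq_iff_index_eq)
  also have "(\<lambda>k. subst_rule \<sigma> i ! k) ` {..<length (subst_rule \<sigma> i)} = set (subst_rule \<sigma> i)"
    by (auto simp: set_conv_nth)
  finally show ?thesis .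
qed

lemma inj_compose_tile: "tile_scale T > 0 \<Longrightarrow> inj (compose_tile T)"
  by (auto simp: inj_def compose_tile_def tile.expand)

lemma partitions_substitute:
  assumes "tile_scale T > 0"
  shows "partitions (substitute \<sigma> T) (tile_set \<sigma>) (tile_set \<sigma> T)"
proof -
  have "partitions (set (subst_rule \<sigma> (tile_label T)))
      (\<lambda>S. (\<lambda>y. tile_pos T + tile_scale T *\<^sub>R y) ` tile_set \<sigma> S) (tile_set \<sigma> T)"
    unfolding tile_set_def[of \<sigma> T] using assms by (intro partitions_affine_image partitions_subst_rule) auto
  then show ?thesis
    unfolding substitute_conv using inj_compose_tile[OF assms]
    by (intro partitions_reindex) (auto simp: tile_set_compose intro: inj_on_subset)
qed

lemma finite_substitute: "finite (substitute \<sigma> T)"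
  by (simp add: substitute_conv)

text \<open>Passes from placed tiles, which form a set, to the list of substitution tiles with
  multiplicity; distinctness of the rule and injectivity of \<open>compose_tile\<close> ensure that
  nothing is lost.\<close>

lemma sum_substitute:
  assumes "tile_scale T > 0"
  shows "(\<Sum>S\<in>substitute \<sigma> T. F (tile_scale S) (tile_label S))
    = (\<Sum>(\<alpha>, j)\<leftarrow>subst_tiles \<sigma> (tile_label T). F (tile_scale T * \<alpha>) j)"
proof -
  let ?g = "\<lambda>(\<alpha>, j). F (tile_scale T * \<alpha>) j"
  have "(\<Sum>S\<in>substitute \<sigma> T. F (tile_scale S) (tile_label S))
      = (\<Sum>S\<in>set (subst_rule \<sigma> (tile_label T)). ?g (tile_scale S, tile_label S))"
    unfolding substitute_conv
    by (subst sum.reindex) (auto intro: inj_on_subset[OF inj_compose_tile[OF assms]])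
  also have "\<dots> = sum_list (map ?g (map (\<lambda>T. (tile_scale T, tile_label T)) (subst_rule \<sigma> (tile_label T))))"
    by (simp add: sum_list_distinct_conv_sum_set[OF distinct_subst_rule] o_def)
  also have "\<dots> = sum_list (map ?g (subst_tiles \<sigma> (tile_label T)))"
    using arg_cong[OF mset_subst_rule[of "tile_label T"], of "\<lambda>M. sum_mset (image_mset ?g M)"]
    by (simp only: mset_map[symmetric] sum_mset_sum_list)
  finally show ?thesis .
qed

section \<open>Volume ratios and induction along substitution\<close>

definition ratios :: "real set" where
  "ratios = (\<Union>i. (\<lambda>(\<alpha>, j). \<alpha> ^ DIM('a)) ` set (subst_tiles \<sigma> i))"

text \<open>The extra element \<open>1/2\<close> keeps this minimum, and the maximum below, strictly
  between 0 and 1 without a case distinction on \<open>ratios\<close>.\<close>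

definition min_ratio :: real where "min_ratio = Min (insert (1/2) ratios)"

definition max_ratio :: real where "max_ratio = Max (insert (1/2) ratios)"

lemma finite_ratios: "finite ratios"
  by (simp add: ratios_def)

lemma ratios_bounds: "x \<in> ratios \<Longrightarrow> 0 < x \<and> x < 1"
  using subst_tiles_scale by (fastforce simp: ratios_def power_less_one_iff)

lemma min_ratio: "0 < min_ratio" "min_ratio < 1" "x \<in> ratios \<Longrightarrow> min_ratio \<le> x"
  using finite_ratios ratios_bounds unfolding min_ratio_def
  by (simp_all add: Min_gr_iff Min_less_iff)

lemma max_ratio: "0 < max_ratio" "max_ratio < 1" "x \<in> ratios \<Longrightarrow> x \<le> max_ratio"
  using finite_ratios ratios_bounds unfolding max_ratio_def
  by (simp_all add: Max_gr_iff Max_less_iff)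

lemma substitute_ratio:
  assumes "tile_scale T > 0" "S \<in> substitute \<sigma> T"
  shows "\<exists>x\<in>ratios. tile_vol \<sigma> S = tile_vol \<sigma> T * x"
proof -
  obtain R where R: "R \<in> set (subst_rule \<sigma> (tile_label T))" "S = compose_tile T R"
    using assms(2) by (auto simp: substitute_conv)
  have "tile_scale R ^ DIM('a) \<in> ratios"
    using subst_rule_scale(1)[OF R(1)] by (force simp: ratios_def)
  moreover have "tile_vol \<sigma> S = tile_vol \<sigma> T * tile_scale R ^ DIM('a)"
    using R(2) assms(1) subst_rule_scale(2)[OF R(1)] by (simp add: tile_vol_eq power_mult_distrib)
  ultimately show ?thesis by blast
qed

lemma substitute_vol_bounds:
  assumes "tile_scale T > 0" "S \<in> substitute \<sigma> T"
  shows "tile_vol \<sigma> T * min_ratio \<le> tile_vol \<sigma> S" "tile_vol \<sigma> S \<le> tile_vol \<sigma> T * max_ratio"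
  using substitute_ratio[OF assms] tile_vol_pos[OF assms(1)] min_ratio(3) max_ratio(3) by auto

lemma power_max_ratio: "\<Lambda> > 0 \<Longrightarrow> \<exists>n. x * max_ratio ^ n \<le> \<Lambda>"
proof -
  assume "\<Lambda> > 0"
  have "(\<lambda>n. x * max_ratio ^ n) \<longlonglongrightarrow> x * 0"
    using max_ratio by (intro tendsto_mult LIMSEQ_realpow_zero) auto
  then have "\<forall>\<^sub>F n in sequentially. x * max_ratio ^ n < \<Lambda>"
    using \<open>\<Lambda> > 0\<close> by (simp add: order_tendsto_iff)
  then show ?thesis by (auto simp: eventually_sequentially intro: less_imp_le)
qed

text \<open>Each substitution shrinks volumes at least by the factor \<open>max_ratio\<close>, so
  volume \<open>\<Lambda>\<close> is reached within a bounded number of generations. The induction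
  hypothesis covers exactly the substitutions that the descent to \<open>\<Lambda>\<close>
  performs.\<close>

lemma tile_induct [consumes 2, case_names substitute]:
  assumes "\<Lambda> > 0" "tile_scale T > 0"
    and step: "\<And>T. tile_scale T > 0 \<Longrightarrow> (\<And>S. tile_vol \<sigma> T > \<Lambda> \<Longrightarrow> S \<in> substitute \<sigma> T \<Longrightarrow> P S) \<Longrightarrow> P T"
  shows "P T"
proof -
  obtain n where "tile_vol \<sigma> T * max_ratio ^ n \<le> \<Lambda>" using power_max_ratio[OF assms(1)] by blast
  then show ?thesis
    using assms(2)
  proof (induction n arbitrary: T)
    case 0
    show ?case
    proof (rule step[OF 0(2)])
      fix S assume "tile_vol \<sigma> T > \<Lambda>"
      then show "P S" using 0(1) by simp
    qed
  next
    case (Suc n)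
    show ?case
    proof (rule step[OF Suc.prems(2)])
      fix S assume S: "S \<in> substitute \<sigma> T"
      have "tile_vol \<sigma> S * max_ratio ^ n \<le> tile_vol \<sigma> T * max_ratio * max_ratio ^ n"
        using substitute_vol_bounds(2)[OF Suc.prems(2) S] max_ratio by (intro mult_right_mono) auto
      then show "P S"
        using Suc.prems substitute_scale_pos[OF _ S] by (intro Suc.IH) (auto simp: mult.assoc)
    qed
  qed
qed

lemma subdivision_scale_pos:
  assumes "\<Lambda> > 0" "tile_scale T > 0" "U \<in> subdivision \<sigma> \<Lambda> T"
  shows "tile_scale U > 0"
  using assms
proof (induction T rule: tile_induct)
  case (substitute T)
  then show ?case
    by (cases "tile_vol \<sigma> T \<le> \<Lambda>") (auto simp: subdivision_stop subdivision_step)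
qed

lemma partitions_subdivision:
  assumes "\<Lambda> > 0" "tile_scale T > 0"
  shows "finite (subdivision \<sigma> \<Lambda> T) \<and> partitions (subdivision \<sigma> \<Lambda> T) (tile_set \<sigma>) (tile_set \<sigma> T)"
  using assms
proof (induction T rule: tile_induct)
  case (substitute T)
  show ?case
  proof (cases "tile_vol \<sigma> T \<le> \<Lambda>")
    case True
    then show ?thesis by (simp add: subdivision_stop partitions_singleton)
  next
    case False
    then have F: "tile_vol \<sigma> T > \<Lambda>" by simp
    show ?thesis
      unfolding subdivision_step[OF F]
      using substitute F finite_substitute partitions_substitute
      by (auto intro!: partitions_UN)
  qed
qed

text \<open>Only tiles above \<open>\<Lambda>\<close> are substituted, and every child keeps at
  least the fraction \<open>min_ratio\<close> of the volume.\<close>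

lemma subdivision_vol:
  assumes "\<Lambda> > 0" "tile_scale T > 0" "tile_vol \<sigma> T \<ge> \<Lambda> * min_ratio" "U \<in> subdivision \<sigma> \<Lambda> T"
  shows "\<Lambda> * min_ratio \<le> tile_vol \<sigma> U \<and> tile_vol \<sigma> U \<le> \<Lambda>"
  using assms
proof (induction T rule: tile_induct)
  case (substitute T)
  show ?case
  proof (cases "tile_vol \<sigma> T \<le> \<Lambda>")
    case True
    then show ?thesis using substitute by (simp add: subdivision_stop)
  next
    case False
    then obtain S where S: "S \<in> substitute \<sigma> T" "U \<in> subdivision \<sigma> \<Lambda> S"
      using substitute.prems by (auto simp: subdivision_step)
    have "\<Lambda> * min_ratio \<le> tile_vol \<sigma> T * min_ratio" using False min_ratio by (intro mult_right_mono) auto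
    then have "\<Lambda> * min_ratio \<le> tile_vol \<sigma> S"
      using substitute_vol_bounds(1)[OF substitute.hyps S(1)] by linarith
    then show ?thesis using substitute.IH[of S] S False by simp
  qed
qed

text \<open>A descent to \<open>\<Lambda>\<close> passes the larger threshold
  \<open>\<Lambda>'\<close> on its way. This groups a patch of the semi-flow into subdivided
  supertiles.\<close>

lemma subdivision_subdivision:
  assumes "\<Lambda> > 0" "tile_scale T > 0" "\<Lambda> \<le> \<Lambda>'"
  shows "subdivision \<sigma> \<Lambda> T = (\<Union>S\<in>subdivision \<sigma> \<Lambda>' T. subdivision \<sigma> \<Lambda> S)"
  using assms
proof (induction T rule: tile_induct)
  case (substitute T)
  show ?case
  proof (cases "tile_vol \<sigma> T \<le> \<Lambda>'")
    case True
    then show ?thesis by (simp add: subdivision_stop)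
  next
    case False
    then show ?thesis using substitute by (simp add: subdivision_step)
  qed
qed

lemma disjoint_subdivision:
  assumes "\<Lambda> > 0" "tile_scale S > 0" "tile_scale S' > 0" "negligible (tile_set \<sigma> S \<inter> tile_set \<sigma> S')"
  shows "subdivision \<sigma> \<Lambda> S \<inter> subdivision \<sigma> \<Lambda> S' = {}"
proof (rule ccontr)
  assume "\<not> ?thesis"
  then obtain U where U: "U \<in> subdivision \<sigma> \<Lambda> S" "U \<in> subdivision \<sigma> \<Lambda> S'" by blast
  have "negligible (tile_set \<sigma> U - tile_set \<sigma> S)" "negligible (tile_set \<sigma> U - tile_set \<sigma> S')"
    using partitions_negligible_diff[OF conjunct2[OF partitions_subdivision]] assms U by simp_all
  then have "negligible ((tile_set \<sigma> U - tile_set \<sigma> S) \<union> (tile_set \<sigma> U - tile_set \<sigma> S')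
      \<union> (tile_set \<sigma> S \<inter> tile_set \<sigma> S'))" using assms(4) by (intro negligible_Un)
  then have "negligible (tile_set \<sigma> U)" by (rule negligible_subset) auto
  then show False using not_negligible_tile_set subdivision_scale_pos assms U by blast
qed

lemma tile_weight_UN_subdivision:
  assumes "\<Lambda> > 0" "finite \<S>" "\<And>S. S \<in> \<S> \<Longrightarrow> tile_scale S > 0"
    "pairwise (\<lambda>S S'. negligible (tile_set \<sigma> S \<inter> tile_set \<sigma> S')) \<S>"
  shows "tile_weight \<sigma> f (\<Union>S\<in>\<S>. subdivision \<sigma> \<Lambda> S) = (\<Sum>S\<in>\<S>. tile_weight \<sigma> f (subdivision \<sigma> \<Lambda> S))"
  unfolding tile_weight_def
proof (rule sum.UNION_disjoint[OF assms(2)])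
  show "\<forall>S\<in>\<S>. finite (subdivision \<sigma> \<Lambda> S)" using assms partitions_subdivision by blast
  show "\<forall>S\<in>\<S>. \<forall>S'\<in>\<S>. S \<noteq> S' \<longrightarrow> subdivision \<sigma> \<Lambda> S \<inter> subdivision \<sigma> \<Lambda> S' = {}"
    by (intro ballI impI disjoint_subdivision assms(1,3) pairwiseD[OF assms(4)])
qed

text \<open>The loop substitutes all large tiles of a patch in one sweep, the descent treats them
  one by one. The union of the subdivisions is invariant under a sweep, and the bound with
  \<open>max_ratio ^ n\<close> limits the number of remaining sweeps by \<open>n\<close>.\<close>

lemma semi_flow_eq: "semi_flow \<sigma> t i = subdivision \<sigma> 1 (Tile 0 (exp t) i)"
proof -
  let ?b = "\<lambda>P. \<exists>T\<in>P. tile_vol \<sigma> T > 1"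
  have *: "while ?b (subst_step \<sigma>) P = (\<Union>T\<in>P. subdivision \<sigma> 1 T)"
    if "\<forall>T\<in>P. tile_scale T > 0 \<and> tile_vol \<sigma> T * max_ratio ^ n \<le> 1" for n P
    using that
  proof (induction n arbitrary: P)
    case 0
    then have "\<not> ?b P" by auto
    moreover have "(\<Union>T\<in>P. subdivision \<sigma> 1 T) = P" using 0 by (simp add: subdivision_stop)
    ultimately show ?case by (simp add: while_unfold)
  next
    case (Suc n)
    show ?case
    proof (cases "?b P")
      case False
      then have "(\<Union>T\<in>P. subdivision \<sigma> 1 T) = P" by (simp add: subdivision_stop not_less)
      then show ?thesis using False by (simp add: while_unfold)
    next
      case True
      have "while ?b (subst_step \<sigma>) P = while ?b (subst_step \<sigma>) (subst_step \<sigma> P)"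
        using True by (subst while_unfold) simp
      also have "\<dots> = (\<Union>T\<in>subst_step \<sigma> P. subdivision \<sigma> 1 T)"
      proof (rule Suc.IH, rule ballI)
        fix S assume "S \<in> subst_step \<sigma> P"
        then obtain T where T: "T \<in> P" "S \<in> (if tile_vol \<sigma> T > 1 then substitute \<sigma> T else {T})"
          by (auto simp: subst_step_def)
        have Tp: "tile_scale T > 0" "tile_vol \<sigma> T * max_ratio ^ Suc n \<le> 1" using Suc.prems T(1) by auto
        show "tile_scale S > 0 \<and> tile_vol \<sigma> S * max_ratio ^ n \<le> 1"
        proof (cases "tile_vol \<sigma> T > 1")
          case True
          then have S: "S \<in> substitute \<sigma> T" using T by simp
          have "tile_vol \<sigma> S * max_ratio ^ n \<le> tile_vol \<sigma> T * max_ratio * max_ratio ^ n"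
            using substitute_vol_bounds(2)[OF Tp(1) S] max_ratio by (intro mult_right_mono) auto
          then show ?thesis using substitute_scale_pos[OF Tp(1) S] Tp(2) by (simp add: mult.assoc)
        next
          case False
          then have "S = T" using T by simp
          moreover have "tile_vol \<sigma> T * max_ratio ^ n \<le> 1"
            using False tile_vol_pos[OF Tp(1)] max_ratio by (intro mult_le_one power_le_one) auto
          ultimately show ?thesis using Tp by simp
        qed
      qed
      also have "\<dots> = (\<Union>T\<in>P. subdivision \<sigma> 1 T)"
      proof -
        have "(\<Union>S\<in>(if tile_vol \<sigma> T > 1 then substitute \<sigma> T else {T}). subdivision \<sigma> 1 S) = subdivision \<sigma> 1 T" for T
          by (simp add: subdivision_step)
        then show ?thesis unfolding subst_step_def by (simp only: UN_UN_flatten)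
      qed
      finally show ?thesis .
    qed
  qed
  obtain n where "tile_vol \<sigma> (Tile 0 (exp t) i) * max_ratio ^ n \<le> 1" using power_max_ratio[of 1] by auto
  then show ?thesis unfolding semi_flow_def by (subst *[of _ n]) auto
qed

section \<open>Expectations over subdivided tiles\<close>

text \<open>The expectation \<open>U i y\<close> of the overview: \<open>y\<close> is the logarithm
  of the volume, hence the scale \<open>exp (y / DIM('a))\<close>, and division by
  \<open>exp y\<close> turns volumes into probabilities.\<close>

definition profile :: "('n \<Rightarrow> real \<Rightarrow> real) \<Rightarrow> 'n \<Rightarrow> real \<Rightarrow> real" where
  "profile f i y = tile_weight \<sigma> f (subdivision \<sigma> 1 (Tile 0 (exp (y / DIM('a))) i)) / exp y"

lemma tile_vol_exp: "tile_vol \<sigma> (Tile x (exp (y / DIM('a))) i) = exp y"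
  by (simp add: tile_vol_eq exp_of_nat_mult[symmetric])

lemma tile_weight_subdivision:
  assumes "tile_scale T > 0"
  shows "tile_weight \<sigma> f (subdivision \<sigma> 1 T) = tile_vol \<sigma> T * profile f (tile_label T) (ln (tile_vol \<sigma> T))"
proof -
  have "ln (tile_vol \<sigma> T) / DIM('a) = ln (tile_scale T)"
    using assms by (simp add: tile_vol_eq ln_realpow)
  then have "Tile 0 (exp (ln (tile_vol \<sigma> T) / DIM('a))) (tile_label T) = translate (- tile_pos T) T"
    using assms by (simp add: translate_def)
  then show ?thesis
    using tile_vol_pos[OF assms]
    by (simp add: profile_def subdivision_translate tile_weight_translate)
qed

lemma profile_le_0: "y \<le> 0 \<Longrightarrow> profile f i y = f i (exp y)"
  by (simp add: profile_def subdivision_stop tile_vol_exp tile_weight_def)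

text \<open>Conditioning on the first substitution. The restriction \<open>y > 0\<close> reflects
  that a tile of volume exactly 1 is kept.\<close>

lemma profile_gt_0:
  assumes "y > 0"
  shows "profile f i y = (\<Sum>(\<alpha>, j)\<leftarrow>subst_tiles \<sigma> i. \<alpha> ^ DIM('a) * profile f j (y + ln (\<alpha> ^ DIM('a))))"
proof -
  define T :: "('a, 'n) tile" where "T = Tile 0 (exp (y / DIM('a))) i"
  have T: "tile_scale T > 0" "tile_vol \<sigma> T = exp y" "tile_label T = i"
    unfolding T_def using tile_vol_exp by auto
  define F where "F c j = c ^ DIM('a) * profile f j (ln (c ^ DIM('a)))" for c j
  have "tile_weight \<sigma> f (subdivision \<sigma> 1 T) = tile_weight \<sigma> f (\<Union>S\<in>substitute \<sigma> T. subdivision \<sigma> 1 S)"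
    using T assms by (simp add: subdivision_step)
  also have "\<dots> = (\<Sum>S\<in>substitute \<sigma> T. tile_weight \<sigma> f (subdivision \<sigma> 1 S))"
    using partitions_substitute[OF T(1)] substitute_scale_pos[OF T(1)] finite_substitute
    by (intro tile_weight_UN_subdivision) (auto simp: partitions_def)
  also have "\<dots> = (\<Sum>S\<in>substitute \<sigma> T. F (tile_scale S) (tile_label S))"
    using substitute_scale_pos[OF T(1)]
    by (intro sum.cong) (auto simp: F_def tile_weight_subdivision tile_vol_eq less_imp_le)
  also have "\<dots> = (\<Sum>(\<alpha>, j)\<leftarrow>subst_tiles \<sigma> i. F (tile_scale T * \<alpha>) j)"
    using sum_substitute[OF T(1), of F] T(3) by simp
  also have "\<dots> = (\<Sum>(\<alpha>, j)\<leftarrow>subst_tiles \<sigma> i. exp y * (\<alpha> ^ DIM('a) * profile f j (y + ln (\<alpha> ^ DIM('a)))))"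
  proof (intro arg_cong[of _ _ sum_list] map_cong refl)
    fix x assume "x \<in> set (subst_tiles \<sigma> i)"
    then obtain \<alpha> j where x: "x = (\<alpha>, j)" "\<alpha> > 0" using subst_tiles_scale by (metis surj_pair)
    have "(tile_scale T * \<alpha>) ^ DIM('a) = exp y * \<alpha> ^ DIM('a)"
      using T tile_vol_eq[of T] by (simp add: power_mult_distrib)
    then show "(case x of (\<alpha>, j) \<Rightarrow> F (tile_scale T * \<alpha>) j)
        = (case x of (\<alpha>, j) \<Rightarrow> exp y * (\<alpha> ^ DIM('a) * profile f j (y + ln (\<alpha> ^ DIM('a)))))"
      using x by (simp add: F_def ln_mult)
  qed
  also have "\<dots> = exp y * (\<Sum>(\<alpha>, j)\<leftarrow>subst_tiles \<sigma> i. \<alpha> ^ DIM('a) * profile f j (y + ln (\<alpha> ^ DIM('a))))"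
    by (simp add: sum_list_const_mult case_prod_unfold)
  finally show ?thesis unfolding profile_def T_def by simp
qed

text \<open>The volumes in a rule are probabilities: they add up to the volume of a tile of scale 1,
  which the rule partitions.\<close>

lemma sum_ratios: "(\<Sum>(\<alpha>, j)\<leftarrow>subst_tiles \<sigma> i. \<alpha> ^ DIM('a)) = 1"
proof -
  let ?T = "Tile (0::'a) 1 i"
  have "(\<Sum>(\<alpha>, j)\<leftarrow>subst_tiles \<sigma> i. \<alpha> ^ DIM('a)) = (\<Sum>S\<in>substitute \<sigma> ?T. tile_scale S ^ DIM('a))"
    using sum_substitute[of ?T "\<lambda>c j. c ^ DIM('a)"] by simp
  also have "\<dots> = (\<Sum>S\<in>substitute \<sigma> ?T. vol (tile_set \<sigma> S))"
    using substitute_scale_pos[of ?T]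
    by (intro sum.cong refl) (simp add: tile_vol_eq[symmetric] tile_vol_def[symmetric] less_imp_le)
  also have "\<dots> = vol (tile_set \<sigma> ?T)"
    using partitions_substitute[of ?T] finite_substitute substitute_scale_pos[of ?T] lmeasurable_tile_set
    by (intro partitions_sum_measure) auto
  also have "\<dots> = 1" using tile_vol_eq[of ?T] by (simp add: tile_vol_def)
  finally show ?thesis .
qed

lemma sum_tile_vol_subdivision:
  assumes "\<Lambda> > 0" "tile_scale T > 0"
  shows "(\<Sum>U\<in>subdivision \<sigma> \<Lambda> T. tile_vol \<sigma> U) = tile_vol \<sigma> T"
  unfolding tile_vol_def
  using partitions_subdivision[OF assms] subdivision_scale_pos[OF assms] lmeasurable_tile_set
  by (intro partitions_sum_measure) auto

lemma profile_bound:
  assumes "\<And>i x. \<bar>f i x\<bar> \<le> B"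
  shows "\<bar>profile f i y\<bar> \<le> B"
proof -
  let ?T = "Tile (0::'a) (exp (y / DIM('a))) i"
  have "\<bar>tile_weight \<sigma> f (subdivision \<sigma> 1 ?T)\<bar> \<le> (\<Sum>U\<in>subdivision \<sigma> 1 ?T. tile_vol \<sigma> U * B)"
    unfolding tile_weight_def
    using subdivision_scale_pos[of 1 ?T] tile_vol_pos assms
    by (intro sum_abs[THEN order_trans] sum_mono)
      (auto simp: abs_mult abs_of_pos intro!: mult_left_mono less_imp_le)
  also have "\<dots> = exp y * B"
    using sum_tile_vol_subdivision[of 1 ?T] tile_vol_exp by (simp add: sum_distrib_right[symmetric])
  finally show ?thesis by (simp add: profile_def field_simps)
qed

end

section \<open>Patches of a generated tiling\<close>

text \<open>A point whose preimage is interior to \<open>S\<close> belongs to all sufficiently late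
  images, and the frontier is null; dominated convergence then applies. Here the null boundary of
  tiles enters.\<close>

lemma measure_affine_image_diff_tendsto:
  fixes S :: "'a::euclidean_space set"
  assumes S: "bounded S" "S \<in> sets lebesgue" "negligible (frontier S)"
    and lim: "X \<longlonglongrightarrow> x" "C \<longlonglongrightarrow> c" and c: "c > 0"
  shows "(\<lambda>k. vol ((\<lambda>y. x + c *\<^sub>R y) ` S - (\<lambda>y. X k + C k *\<^sub>R y) ` S)) \<longlonglongrightarrow> 0"
proof -
  let ?g = "\<lambda>y. x + c *\<^sub>R y" and ?h = "\<lambda>k y. X k + C k *\<^sub>R y"
  have sets: "?g ` S \<in> sets lebesgue" "?h k ` S \<in> sets lebesgue" for k
    using affine_image_sets_lebesgue[OF S(2)] by blast+
  have gS: "?g ` S \<in> lmeasurable"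
    using sets bounded_affine_image[OF S(1)] by (intro bounded_set_imp_lmeasurable)
  have N: "?g ` frontier S \<in> null_sets lebesgue"
    using negligible_affine_image[OF S(3), of c x] c by (simp add: negligible_iff_null_sets)
  have ptwise: "(\<lambda>k. indicat_real (?g ` S - ?h k ` S) y) \<longlonglongrightarrow> 0" if y: "y \<notin> ?g ` frontier S" for y
  proof (cases "y \<in> ?g ` S")
    case False
    then show ?thesis by simp
  next
    case True
    then obtain s where s: "s \<in> S" "y = ?g s" by blast
    then have "s \<in> interior S" using y closure_subset by (auto simp: frontier_def)
    have "(\<lambda>k. (1 / C k) *\<^sub>R (y - X k)) \<longlonglongrightarrow> (1 / c) *\<^sub>R (y - x)"
      using lim c by (intro tendsto_intros) auto
    also have "(1 / c) *\<^sub>R (y - x) = s" using s c by simp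
    finally have "\<forall>\<^sub>F k in sequentially. (1 / C k) *\<^sub>R (y - X k) \<in> interior S"
      using \<open>s \<in> interior S\<close> by (intro topological_tendstoD) auto
    moreover have "\<forall>\<^sub>F k in sequentially. C k > 0" using lim(2) c by (simp add: order_tendsto_iff)
    ultimately have "\<forall>\<^sub>F k in sequentially. indicat_real (?g ` S - ?h k ` S) y = 0"
    proof eventually_elim
      case (elim k)
      then have "y = ?h k ((1 / C k) *\<^sub>R (y - X k))" "(1 / C k) *\<^sub>R (y - X k) \<in> S"
        using interior_subset by auto
      then have "y \<in> ?h k ` S" by blast
      then show ?case by simp
    qed
    then show ?thesis by (rule tendsto_eventually)
  qed
  have "(\<lambda>k. integral\<^sup>L lebesgue (indicat_real (?g ` S - ?h k ` S))) \<longlonglongrightarrow> integral\<^sup>L lebesgue (\<lambda>_::'a. 0::real)"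
  proof (rule integral_dominated_convergence[where w = "indicat_real (?g ` S)"])
    show "integrable lebesgue (indicat_real (?g ` S))"
      using gS by (intro integrable_real_indicator) (auto simp: fmeasurable_def)
    show "AE y in lebesgue. (\<lambda>k. indicat_real (?g ` S - ?h k ` S) y) \<longlonglongrightarrow> 0"
      using N ptwise by (intro AE_I'[OF N]) auto
    show "indicat_real (?g ` S - ?h k ` S) \<in> borel_measurable lebesgue" for k
      using sets by (intro borel_measurable_indicator) auto
    show "AE y in lebesgue. norm (indicat_real (?g ` S - ?h k ` S) y) \<le> indicat_real (?g ` S) y" for k
      by (auto simp: indicator_def)
  qed auto
  then show ?thesis by simp
qed

lemma frontier_crossing:
  fixes y z :: "'a::euclidean_space"
  assumes "y \<in> A" "z \<notin> A"
  obtains x where "x \<in> frontier A" "dist y x \<le> dist y z"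
proof -
  have "closed_segment y z \<inter> frontier A \<noteq> {}"
    using assms by (intro connected_Int_frontier) auto
  then obtain x where x: "x \<in> closed_segment y z" "x \<in> frontier A" by blast
  then show ?thesis using that segment_bound(1)[OF x(1)] by (auto simp: dist_norm norm_minus_commute)
qed

lemma sum_diff_symdiff:
  fixes g :: "'b \<Rightarrow> real"
  assumes "finite X" "finite Y"
  shows "\<bar>sum g X - sum g Y\<bar> \<le> (\<Sum>x\<in>sym_diff X Y. \<bar>g x\<bar>)"
proof -
  have "sum g X = sum g (X - Y) + sum g (X \<inter> Y)" "sum g Y = sum g (Y - X) + sum g (X \<inter> Y)"
    using assms sum.Int_Diff[of X g Y] sum.Int_Diff[of Y g X] by (simp_all add: Int_commute)
  then have "\<bar>sum g X - sum g Y\<bar> \<le> \<bar>sum g (X - Y)\<bar> + \<bar>sum g (Y - X)\<bar>" by linarith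
  also have "\<dots> \<le> (\<Sum>x\<in>X - Y. \<bar>g x\<bar>) + (\<Sum>x\<in>Y - X. \<bar>g x\<bar>)" by (intro add_mono sum_abs)
  also have "\<dots> = (\<Sum>x\<in>sym_diff X Y. \<bar>g x\<bar>)" using assms by (subst sum.union_disjoint) auto
  finally show ?thesis .
qed

definition frontier_nbhd :: "real \<Rightarrow> 'a::euclidean_space set \<Rightarrow> 'a set" where
  "frontier_nbhd \<rho> A = (\<Union>x\<in>frontier A. ball x \<rho>)"

lemma lmeasurable_frontier_nbhd:
  assumes "bounded A"
  shows "frontier_nbhd \<rho> A \<in> lmeasurable"
proof (rule lmeasurable_open)
  have "bounded (frontier A)" using assms by (auto simp: frontier_def intro: bounded_subset[OF bounded_closure])
  then obtain B where B: "\<And>x. x \<in> frontier A \<Longrightarrow> norm x \<le> B" by (auto simp: bounded_iff)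
  show "bounded (frontier_nbhd \<rho> A)"
    unfolding bounded_iff frontier_nbhd_def
  proof (intro exI[of _ "B + \<bar>\<rho>\<bar>"] ballI)
    fix y assume "y \<in> (\<Union>x\<in>frontier A. ball x \<rho>)"
    then obtain x where "x \<in> frontier A" "norm (y - x) < \<rho>" by (auto simp: dist_norm norm_minus_commute)
    then show "norm y \<le> B + \<bar>\<rho>\<bar>" using B[of x] norm_triangle_sub[of y x] by simp
  qed
qed (auto simp: frontier_nbhd_def)

section \<open>Approximating patches, packing and boundary effects\<close>

context normalized_scheme
begin

lemma tile_weight_one: "tile_weight \<sigma> (\<lambda>_ _. 1) P = (\<Sum>T\<in>P. tile_vol \<sigma> T)"
  by (simp add: tile_weight_def)

lemma tile_diameter:
  obtains D where "D > 0"
    "\<And>T x y. tile_scale T > 0 \<Longrightarrow> tile_vol \<sigma> T \<le> \<Lambda> \<Longrightarrow> x \<in> tile_set \<sigma> T \<Longrightarrow> y \<in> tile_set \<sigma> T \<Longrightarrow> dist x y \<le> D"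
proof -
  have "bounded (\<Union>i. prototile \<sigma> i)" using prototile(1) by (intro bounded_UN) auto
  then obtain B where B: "B > 0" "\<And>i x. x \<in> prototile \<sigma> i \<Longrightarrow> norm x \<le> B" by (auto simp: bounded_pos)
  show ?thesis
  proof (rule that[of "max 1 \<Lambda> * (2 * B)"])
    show "max 1 \<Lambda> * (2 * B) > 0" using B by (intro mult_pos_pos) auto
    fix T x y assume T: "tile_scale T > 0" "tile_vol \<sigma> T \<le> \<Lambda>" "x \<in> tile_set \<sigma> T" "y \<in> tile_set \<sigma> T"
    obtain x' y' where xy: "x' \<in> prototile \<sigma> (tile_label T)" "y' \<in> prototile \<sigma> (tile_label T)"
      "x = tile_pos T + tile_scale T *\<^sub>R x'" "y = tile_pos T + tile_scale T *\<^sub>R y'"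
      using T(3,4) by (auto simp: tile_set_def)
    \<comment> \<open>For scales above 1 the volume dominates the scale, which gives a bound without
      taking roots.\<close>
    have sc: "tile_scale T \<le> max 1 \<Lambda>"
    proof (cases "tile_scale T \<le> 1")
      case False
      then have "tile_scale T ^ 1 \<le> tile_scale T ^ DIM('a)" by (intro power_increasing) auto
      then show ?thesis using T(1,2) tile_vol_eq[of T] by simp
    qed simp
    moreover have "dist x y = tile_scale T * norm (x' - y')"
    proof -
      have "x - y = tile_scale T *\<^sub>R (x' - y')" using xy by (simp add: algebra_simps)
      then show ?thesis using T(1) by (simp add: dist_norm)
    qed
    moreover have "norm (x' - y') \<le> 2 * B"
      using B(2)[OF xy(1)] B(2)[OF xy(2)] norm_triangle_ineq4[of x' y'] by linarith
    ultimately show "dist x y \<le> max 1 \<Lambda> * (2 * B)"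
      using mult_mono[OF sc, of "norm (x' - y')" "2 * B"] by simp
  qed
qed

lemma semi_flow_translate:
  "translate x ` semi_flow \<sigma> t i = subdivision \<sigma> 1 (Tile x (exp t) i)"
  using subdivision_translate[of \<sigma> 1 x "Tile 0 (exp t) i"] by (simp add: semi_flow_eq translate_def)

text \<open>The translation of each approximating patch is absorbed into one large tile
  \<open>T0 k\<close>. Its volume is at least 1 because \<open>t \<ge> 0\<close>, which yields the
  lower volume bound for the tiles of its subdivision.\<close>

lemma generated_tiling_approx:
  assumes tiling: "generated_tiling \<sigma> \<T>" and P: "finite P" "P \<subseteq> \<T>"
  obtains g T0 where
    "\<forall>\<^sub>F k in sequentially. inj_on (g k) P \<and> g k ` P \<subseteq> subdivision \<sigma> 1 (T0 k) \<and>
      (\<forall>T\<in>P. tile_label (g k T) = tile_label T)"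
    "\<And>k. tile_scale (T0 k) > 0" "\<And>k. tile_vol \<sigma> (T0 k) \<ge> 1"
    "\<And>T. T \<in> P \<Longrightarrow> (\<lambda>k. tile_pos (g k T)) \<longlonglongrightarrow> tile_pos T"
    "\<And>T. T \<in> P \<Longrightarrow> (\<lambda>k. tile_scale (g k T)) \<longlonglongrightarrow> tile_scale T"
proof -
  obtain Q where Q: "\<forall>k::nat. \<exists>t\<ge>0. \<exists>i x. \<exists>R\<subseteq>semi_flow \<sigma> t i. Q k = translate x ` R" "patch_limit Q P"
    using tiling P by (auto simp: generated_tiling_def)
  have "\<exists>T0. tile_scale T0 > 0 \<and> tile_vol \<sigma> T0 \<ge> 1 \<and> Q k \<subseteq> subdivision \<sigma> 1 T0" for k
  proof -
    obtain t i x R where t: "t \<ge> 0" "R \<subseteq> semi_flow \<sigma> t i" "Q k = translate x ` R" using Q(1) by metis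
    then have "Q k \<subseteq> subdivision \<sigma> 1 (Tile x (exp t) i)" by (auto simp: semi_flow_translate[symmetric])
    moreover have "tile_vol \<sigma> (Tile x (exp t) i) \<ge> 1" using t(1) by (simp add: tile_vol_eq)
    ultimately show ?thesis by (intro exI[of _ "Tile x (exp t) i"]) simp
  qed
  then obtain T0 where T0: "\<And>k. tile_scale (T0 k) > 0" "\<And>k. tile_vol \<sigma> (T0 k) \<ge> 1"
    "\<And>k. Q k \<subseteq> subdivision \<sigma> 1 (T0 k)" by metis
  obtain g where g: "\<forall>\<^sub>F k in sequentially. bij_betw (g k) P (Q k) \<and> (\<forall>T\<in>P. tile_label (g k T) = tile_label T)"
    "\<And>T. T \<in> P \<Longrightarrow> (\<lambda>k. tile_pos (g k T)) \<longlonglongrightarrow> tile_pos T"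
    "\<And>T. T \<in> P \<Longrightarrow> (\<lambda>k. tile_scale (g k T)) \<longlonglongrightarrow> tile_scale T"
    using Q(2) unfolding patch_limit_def by blast
  show ?thesis
  proof (rule that[of g T0])
    show "\<forall>\<^sub>F k in sequentially. inj_on (g k) P \<and> g k ` P \<subseteq> subdivision \<sigma> 1 (T0 k) \<and>
      (\<forall>T\<in>P. tile_label (g k T) = tile_label T)"
      using g(1)
    proof eventually_elim
      case (elim k)
      then show ?case using T0(3)[of k] by (simp add: bij_betw_def)
    qed
  qed (use T0 g in auto)
qed

lemma subdivision_1_vol:
  assumes "tile_scale T > 0" "tile_vol \<sigma> T \<ge> 1" "U \<in> subdivision \<sigma> 1 T"
  shows "tile_scale U > 0" "min_ratio \<le> tile_vol \<sigma> U" "tile_vol \<sigma> U \<le> 1"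
proof -
  show "tile_scale U > 0" using subdivision_scale_pos[OF _ assms(1,3)] by simp
  show "min_ratio \<le> tile_vol \<sigma> U" "tile_vol \<sigma> U \<le> 1"
    using subdivision_vol[of 1 T U] assms min_ratio by auto
qed

lemma tendsto_tile_vol:
  "(\<lambda>k. tile_scale (S k)) \<longlonglongrightarrow> tile_scale T \<Longrightarrow> (\<lambda>k. tile_vol \<sigma> (S k)) \<longlonglongrightarrow> tile_vol \<sigma> T"
  unfolding tile_vol_abs by (intro tendsto_intros)

text \<open>One-tile patches suffice: the volumes of the approximating tiles lie in the closed
  interval \<open>{min_ratio..1}\<close>, so their limit does as well.\<close>

lemma generated_tiling_vol:
  assumes tiling: "generated_tiling \<sigma> \<T>" and T: "T \<in> \<T>"
  shows "tile_scale T > 0" "min_ratio \<le> tile_vol \<sigma> T" "tile_vol \<sigma> T \<le> 1"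
proof -
  show "tile_scale T > 0" using assms by (simp add: generated_tiling_def)
  have fin: "finite {T}" "{T} \<subseteq> \<T>" using T by auto
  obtain g T0 where g: "\<forall>\<^sub>F k in sequentially. inj_on (g k) {T} \<and> g k ` {T} \<subseteq> subdivision \<sigma> 1 (T0 k) \<and>
      (\<forall>T\<in>{T}. tile_label (g k T) = tile_label T)"
    and T0: "\<And>k. tile_scale (T0 k) > 0" "\<And>k. tile_vol \<sigma> (T0 k) \<ge> 1"
    and "\<And>S. S \<in> {T} \<Longrightarrow> (\<lambda>k. tile_pos (g k S)) \<longlonglongrightarrow> tile_pos S"
    and lim: "\<And>S. S \<in> {T} \<Longrightarrow> (\<lambda>k. tile_scale (g k S)) \<longlonglongrightarrow> tile_scale S"
    by (rule generated_tiling_approx[OF tiling fin]) (erule that; assumption)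
  have ev: "\<forall>\<^sub>F k in sequentially. min_ratio \<le> tile_vol \<sigma> (g k T) \<and> tile_vol \<sigma> (g k T) \<le> 1"
    using g
  proof eventually_elim
    case (elim k)
    then have "g k T \<in> subdivision \<sigma> 1 (T0 k)" by simp
    then show ?case using subdivision_1_vol(2,3)[OF T0] by blast
  qed
  have L: "(\<lambda>k. tile_vol \<sigma> (g k T)) \<longlonglongrightarrow> tile_vol \<sigma> T" using lim by (intro tendsto_tile_vol) auto
  show "min_ratio \<le> tile_vol \<sigma> T"
    using ev by (intro tendsto_lowerbound[OF L]) (auto elim: eventually_mono)
  show "tile_vol \<sigma> T \<le> 1"
    using ev by (intro tendsto_upperbound[OF L]) (auto elim: eventually_mono)
qed

lemma sum_tile_vol_le:
  assumes "finite X" "\<And>T. T \<in> X \<Longrightarrow> tile_scale T > 0" "\<And>T. T \<in> X \<Longrightarrow> negligible (tile_set \<sigma> T - N)"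
    "pairwise (\<lambda>T T'. negligible (tile_set \<sigma> T \<inter> tile_set \<sigma> T')) X" "N \<in> lmeasurable"
  shows "(\<Sum>T\<in>X. tile_vol \<sigma> T) \<le> vol N"
proof -
  let ?U = "\<Union>T\<in>X. tile_set \<sigma> T"
  have U: "?U \<in> lmeasurable" using assms lmeasurable_tile_set by (intro fmeasurable.finite_UN) auto
  have "(\<Sum>T\<in>X. tile_vol \<sigma> T) = vol ?U"
    unfolding tile_vol_def using assms lmeasurable_tile_set
    by (intro measure_negligible_finite_Union_image[symmetric]) auto
  also have "\<dots> = vol (?U \<inter> N)"
  proof (rule measure_negligible_symdiff)
    show "?U \<inter> N \<in> lmeasurable" using U assms by blast
    have "negligible (\<Union>T\<in>X. tile_set \<sigma> T - N)" using assms by (intro negligible_Union) auto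
    then show "negligible (sym_diff (?U \<inter> N) ?U)" by (rule negligible_subset) auto
  qed
  also have "\<dots> \<le> vol N" using U assms by (intro measure_mono_fmeasurable) auto
  finally show ?thesis .
qed

text \<open>Packing: the tiles that meet the ball lie in a larger ball, overlap in null sets and
  have volume at least \<open>min_ratio\<close>, so their number is bounded.\<close>

lemma locally_finite_tiling:
  assumes tiling: "generated_tiling \<sigma> \<T>"
  shows "finite {T \<in> \<T>. tile_set \<sigma> T \<inter> ball 0 R \<noteq> {}}"
proof -
  obtain D where D: "D > 0"
    "\<And>T x y. tile_scale T > 0 \<Longrightarrow> tile_vol \<sigma> T \<le> 1 \<Longrightarrow> x \<in> tile_set \<sigma> T \<Longrightarrow> y \<in> tile_set \<sigma> T \<Longrightarrow> dist x y \<le> D"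
    using tile_diameter[of 1] by blast
  let ?N = "cball (0::'a) (R + D)"
  show ?thesis
  proof (rule conjunct1[OF finite_if_finite_subsets_card_bdd[of _ "nat \<lfloor>vol ?N / min_ratio\<rfloor>"]])
    fix X assume X: "X \<subseteq> {T \<in> \<T>. tile_set \<sigma> T \<inter> ball 0 R \<noteq> {}}" "finite X"
    have sub: "tile_set \<sigma> T \<subseteq> ?N" if "T \<in> X" for T
    proof
      fix y assume y: "y \<in> tile_set \<sigma> T"
      have "T \<in> {T \<in> \<T>. tile_set \<sigma> T \<inter> ball 0 R \<noteq> {}}" using X(1) that by blast
      then obtain x where x: "x \<in> tile_set \<sigma> T" "norm x < R" by auto
      have "dist x y \<le> D" using D(2)[of T x y] generated_tiling_vol[OF tiling, of T] X that x y by blast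
      then show "y \<in> ?N" using x norm_triangle_sub[of y x] by (simp add: dist_norm norm_minus_commute)
    qed
    have "real (card X) * min_ratio = (\<Sum>T\<in>X. min_ratio)" by simp
    also have "\<dots> \<le> (\<Sum>T\<in>X. tile_vol \<sigma> T)"
      using X generated_tiling_vol(2)[OF tiling] by (intro sum_mono) auto
    also have "\<dots> \<le> vol ?N"
    proof (rule sum_tile_vol_le)
      show "pairwise (\<lambda>T T'. negligible (tile_set \<sigma> T \<inter> tile_set \<sigma> T')) X"
        using tiling X(1) by (auto simp: generated_tiling_def partitions_def intro: pairwise_subset)
      show "negligible (tile_set \<sigma> T - ?N)" if "T \<in> X" for T
        using sub[OF that] by (metis Diff_eq_empty_iff negligible_empty)
    qed (use X generated_tiling_vol(1)[OF tiling] in auto)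
    finally have "real (card X) \<le> vol ?N / min_ratio" using min_ratio by (simp add: field_simps)
    then show "card X \<le> nat \<lfloor>vol ?N / min_ratio\<rfloor>" by linarith
  qed
qed

lemma tiling_pairwise:
  assumes "generated_tiling \<sigma> \<T>" "X \<subseteq> \<T>"
  shows "pairwise (\<lambda>T T'. negligible (tile_set \<sigma> T \<inter> tile_set \<sigma> T')) X"
  using assms by (auto simp: generated_tiling_def partitions_def intro: pairwise_subset)

lemma tiling_cover:
  assumes "generated_tiling \<sigma> \<T>"
  shows "negligible (- (\<Union>T\<in>\<T>. tile_set \<sigma> T))"
  using assms by (simp add: generated_tiling_def partitions_def Compl_eq_Diff_UNIV)

lemma finite_tiles_within:
  assumes tiling: "generated_tiling \<sigma> \<T>" and A: "bounded A"
  shows "finite {T \<in> \<T>. tile_set \<sigma> T \<subseteq> A}"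
proof -
  obtain R where R: "\<And>x. x \<in> A \<Longrightarrow> norm x < R" using A unfolding bounded_pos_less by blast
  have "{T \<in> \<T>. tile_set \<sigma> T \<subseteq> A} \<subseteq> {T \<in> \<T>. tile_set \<sigma> T \<inter> ball 0 R \<noteq> {}}"
    using R tile_set_nonempty by fastforce
  then show ?thesis using locally_finite_tiling[OF tiling] finite_subset by blast
qed

text \<open>Almost every point of \<open>A\<close> lies in a tile; if that tile is not inside
  \<open>A\<close>, it joins the point to the complement, and the frontier is within distance
  \<open>D\<close>. The strict \<open>D < \<rho>\<close> suits the open balls of
  \<open>frontier_nbhd\<close>.\<close>

lemma tile_weight_within_one:
  assumes tiling: "generated_tiling \<sigma> \<T>" and A: "bounded A" "A \<in> sets lebesgue"
    and D: "\<And>T x y. tile_scale T > 0 \<Longrightarrow> tile_vol \<sigma> T \<le> 1 \<Longrightarrow> x \<in> tile_set \<sigma> T \<Longrightarrow> y \<in> tile_set \<sigma> T \<Longrightarrow> dist x y \<le> D"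
    and \<rho>: "D < \<rho>"
  shows "tile_weight \<sigma> (\<lambda>_ _. 1) {T \<in> \<T>. tile_set \<sigma> T \<subseteq> A} \<le> vol A"
    "vol A \<le> tile_weight \<sigma> (\<lambda>_ _. 1) {T \<in> \<T>. tile_set \<sigma> T \<subseteq> A} + vol (frontier_nbhd \<rho> A)"
proof -
  let ?P = "{T \<in> \<T>. tile_set \<sigma> T \<subseteq> A}"
  have Am: "A \<in> lmeasurable" using A by (rule bounded_set_imp_lmeasurable)
  have fin: "finite ?P" using finite_tiles_within[OF tiling A(1)] .
  have pw: "pairwise (\<lambda>T T'. negligible (tile_set \<sigma> T \<inter> tile_set \<sigma> T')) ?P"
    using tiling by (rule tiling_pairwise) auto
  have pos: "\<And>T. T \<in> ?P \<Longrightarrow> tile_scale T > 0" using generated_tiling_vol(1)[OF tiling] by auto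
  show "tile_weight \<sigma> (\<lambda>_ _. 1) ?P \<le> vol A"
    unfolding tile_weight_one using fin pos pw Am
    by (intro sum_tile_vol_le) (auto simp: Diff_eq_empty_iff[THEN iffD2])
  let ?U = "\<Union>T\<in>?P. tile_set \<sigma> T" and ?Z = "- (\<Union>T\<in>\<T>. tile_set \<sigma> T)"
  have U: "?U \<in> lmeasurable" using fin pos lmeasurable_tile_set by (intro fmeasurable.finite_UN) auto
  have N: "frontier_nbhd \<rho> A \<in> lmeasurable" using lmeasurable_frontier_nbhd[OF A(1)] .
  have Z: "?Z \<in> lmeasurable" "vol ?Z = 0"
    using tiling_cover[OF tiling] negligible_imp_measurable negligible_imp_measure0 by blast+
  have sub: "A \<subseteq> (?U \<union> frontier_nbhd \<rho> A) \<union> ?Z"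
  proof
    fix y assume y: "y \<in> A"
    show "y \<in> (?U \<union> frontier_nbhd \<rho> A) \<union> ?Z"
    proof (cases "\<exists>T\<in>\<T>. y \<in> tile_set \<sigma> T \<and> \<not> tile_set \<sigma> T \<subseteq> A")
      case False
      then show ?thesis using y by blast
    next
      case True
      then obtain T z where T: "T \<in> \<T>" "y \<in> tile_set \<sigma> T" "z \<in> tile_set \<sigma> T" "z \<notin> A" by blast
      obtain x where "x \<in> frontier A" "dist y x \<le> dist y z" using frontier_crossing[OF y T(4)] .
      moreover have "dist y z \<le> D" using D generated_tiling_vol[OF tiling T(1)] T by blast
      ultimately show ?thesis using \<rho> by (auto simp: frontier_nbhd_def dist_commute intro!: bexI[of _ x])
    qed
  qed
  have "vol A \<le> vol ((?U \<union> frontier_nbhd \<rho> A) \<union> ?Z)"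
    using sub Am U N Z by (intro measure_mono_fmeasurable) auto
  also have "\<dots> \<le> vol (?U \<union> frontier_nbhd \<rho> A) + vol ?Z"
    using U N Z by (intro measure_Un_le) auto
  also have "\<dots> \<le> vol ?U + vol (frontier_nbhd \<rho> A)"
    using Z(2) U N by (simp add: measure_Un_le)
  also have "vol ?U = tile_weight \<sigma> (\<lambda>_ _. 1) ?P"
    unfolding tile_weight_one tile_vol_def using fin pos pw lmeasurable_tile_set
    by (intro measure_negligible_finite_Union_image) auto
  finally show "vol A \<le> tile_weight \<sigma> (\<lambda>_ _. 1) ?P + vol (frontier_nbhd \<rho> A)" .
qed

text \<open>Sources of error: \<open>\<epsilon>\<close> from the supertiles inside \<open>A\<close>,
  \<open>B\<close> from the tiles on which patch and supertiles disagree, and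
  \<open>2 * \<bar>L\<bar>\<close> because the volume of these supertiles differs from
  \<open>vol A\<close> by up to two neighborhoods. The lower bound on \<open>vol A\<close> makes
  \<open>T0 k\<close> so large that its supertiles have volume at least
  \<open>\<Lambda> * min_ratio\<close>.\<close>

lemma patch_estimate:
  assumes tiling: "generated_tiling \<sigma> \<T>" and \<Lambda>: "\<Lambda> \<ge> 1"
    and f: "\<And>j x. isCont (f j) x" "\<And>j x. \<bar>f j x\<bar> \<le> B"
    and conv: "\<And>j y. y \<ge> ln (\<Lambda> * min_ratio) \<Longrightarrow> \<bar>profile f j y - L\<bar> \<le> \<epsilon>"
    and D: "D > 0" "\<And>T x y. tile_scale T > 0 \<Longrightarrow> tile_vol \<sigma> T \<le> \<Lambda> \<Longrightarrow> x \<in> tile_set \<sigma> T \<Longrightarrow> y \<in> tile_set \<sigma> T \<Longrightarrow> dist x y \<le> D"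
    and \<rho>: "3 * D < \<rho>"
    and A: "bounded A" "A \<in> sets lebesgue" "\<Lambda> + vol (frontier_nbhd \<rho> A) \<le> vol A"
  shows "\<bar>tile_weight \<sigma> f {T \<in> \<T>. tile_set \<sigma> T \<subseteq> A} - L * vol A\<bar>
    \<le> \<epsilon> * vol A + (B + 2 * \<bar>L\<bar>) * vol (frontier_nbhd \<rho> A)"
proof -
  define N where "N = frontier_nbhd \<rho> A"
  define P where "P = {T \<in> \<T>. tile_set \<sigma> T \<subseteq> A}"
  have N: "N \<in> lmeasurable" unfolding N_def using lmeasurable_frontier_nbhd[OF A(1)] .
  have Am: "A \<in> lmeasurable" using A(1,2) by (rule bounded_set_imp_lmeasurable)
  have B: "B \<ge> 0" using f(2)[of undefined 0] by linarith
  have \<epsilon>: "\<epsilon> \<ge> 0" using conv[of _ undefined] by force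
  have D1: "dist x y \<le> D" if "tile_scale T > 0" "tile_vol \<sigma> T \<le> 1" "x \<in> tile_set \<sigma> T" "y \<in> tile_set \<sigma> T" for T x y
    using D(2)[of T x y] that \<Lambda> by simp
  have \<rho>': "D < \<rho>" using \<rho> D(1) by linarith
  have "tile_weight \<sigma> (\<lambda>_ _. 1) P \<le> vol A"
    unfolding P_def by (rule tile_weight_within_one(1)[OF tiling A(1,2) _ \<rho>']) (rule D1)
  moreover have "vol A \<le> tile_weight \<sigma> (\<lambda>_ _. 1) P + vol N"
    unfolding P_def N_def by (rule tile_weight_within_one(2)[OF tiling A(1,2) _ \<rho>']) (rule D1)
  ultimately have W1: "\<bar>tile_weight \<sigma> (\<lambda>_ _. 1) P - vol A\<bar> \<le> vol N" "vol A - vol N \<le> tile_weight \<sigma> (\<lambda>_ _. 1) P"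
    by linarith+
  obtain R0 where R0: "\<And>x. x \<in> A \<Longrightarrow> norm x < R0" using A(1) unfolding bounded_pos_less by blast
  \<comment> \<open>\<open>P\<close> alone is too small: supertiles inside \<open>A\<close> may
    contain tiles whose counterparts in the tiling are not inside \<open>A\<close>. The enlarged
    ball captures these as well.\<close>
  define P' where "P' = {T \<in> \<T>. tile_set \<sigma> T \<inter> ball 0 (R0 + D) \<noteq> {}}"
  have P': "finite P'" "P' \<subseteq> \<T>" using locally_finite_tiling[OF tiling] by (auto simp: P'_def)
  have PP': "P \<subseteq> P'"
  proof
    fix T assume T: "T \<in> P"
    then obtain x where x: "x \<in> tile_set \<sigma> T" "x \<in> A" using tile_set_nonempty by (fastforce simp: P_def)
    then have "norm x < R0 + D" using R0[of x] D(1) by linarith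
    then show "T \<in> P'" using T x by (auto simp: P_def P'_def)
  qed
  have finP: "finite P" using PP' P'(1) finite_subset by blast
  have volP': "tile_scale T > 0" "min_ratio \<le> tile_vol \<sigma> T" "tile_vol \<sigma> T \<le> 1" if "T \<in> P'" for T
    using generated_tiling_vol[OF tiling] P'(2) that by blast+
  obtain g T0 where g: "\<forall>\<^sub>F k in sequentially. inj_on (g k) P' \<and> g k ` P' \<subseteq> subdivision \<sigma> 1 (T0 k) \<and>
      (\<forall>T\<in>P'. tile_label (g k T) = tile_label T)"
    and T0: "\<And>k. tile_scale (T0 k) > 0" "\<And>k. tile_vol \<sigma> (T0 k) \<ge> 1"
    and lim: "\<And>T. T \<in> P' \<Longrightarrow> (\<lambda>k. tile_pos (g k T)) \<longlonglongrightarrow> tile_pos T"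
      "\<And>T. T \<in> P' \<Longrightarrow> (\<lambda>k. tile_scale (g k T)) \<longlonglongrightarrow> tile_scale T"
    by (rule generated_tiling_approx[OF tiling P']) (erule that; assumption)
  have "\<bar>tile_weight \<sigma> f P - L * vol A\<bar> \<le> \<epsilon> * vol A + (B + 2 * \<bar>L\<bar>) * vol N + \<eta>" if \<eta>: "\<eta> > 0" for \<eta>
  proof -
    \<comment> \<open>The first bound absorbs the factor \<open>1 + \<bar>L\<bar>\<close> collected
      at the end; the second keeps the volume of the approximating patch at least
      \<open>\<Lambda> * min_ratio\<close>.\<close>
    define \<eta>1 where "\<eta>1 = min (\<eta> / (1 + \<bar>L\<bar>)) (\<Lambda> * (1 - min_ratio))"
    have "1 + \<bar>L\<bar> > 0" by linarith
    moreover have "\<Lambda> * (1 - min_ratio) > 0" using \<Lambda> min_ratio by simp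
    moreover have "\<eta>1 \<le> \<eta> / (1 + \<bar>L\<bar>)" "\<eta>1 \<le> \<Lambda> * (1 - min_ratio)" by (simp_all add: \<eta>1_def)
    ultimately have \<eta>1: "\<eta>1 * (1 + \<bar>L\<bar>) \<le> \<eta>" "\<eta>1 \<le> \<Lambda> - \<Lambda> * min_ratio"
      by (simp_all add: pos_le_divide_eq right_diff_distrib)
    have \<eta>1_pos: "\<eta>1 > 0"
      using \<eta> \<open>1 + \<bar>L\<bar> > 0\<close> \<open>\<Lambda> * (1 - min_ratio) > 0\<close> unfolding \<eta>1_def min_less_iff_conj by simp
    have wlim: "\<forall>\<^sub>F k in sequentially. \<bar>tile_weight \<sigma> F P - (\<Sum>T\<in>P. tile_vol \<sigma> (g k T) * F (tile_label T) (tile_vol \<sigma> (g k T)))\<bar> < \<eta>1"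
      if F: "\<And>j x. isCont (F j) x" for F :: "'n \<Rightarrow> real \<Rightarrow> real"
    proof -
      have "(\<lambda>k. \<Sum>T\<in>P. tile_vol \<sigma> (g k T) * F (tile_label T) (tile_vol \<sigma> (g k T)))
          \<longlonglongrightarrow> tile_weight \<sigma> F P"
        unfolding tile_weight_def
        using lim(2) PP' by (intro tendsto_sum tendsto_mult isCont_tendsto_compose[OF F] tendsto_tile_vol) auto
      then show ?thesis using \<eta>1_pos by (simp add: tendsto_iff dist_real_def abs_minus_commute)
    qed
    have "(\<lambda>k. vol (tile_set \<sigma> T - tile_set \<sigma> (g k T))) \<longlonglongrightarrow> 0" if T: "T \<in> P'" for T
    proof -
      have "(\<lambda>k. vol (tile_set \<sigma> T - (\<lambda>y. tile_pos (g k T) + tile_scale (g k T) *\<^sub>R y) ` prototile \<sigma> (tile_label T))) \<longlonglongrightarrow> 0"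
        unfolding tile_set_def[of \<sigma> T] using lim[OF T] volP'(1)[OF T] prototile
        by (intro measure_affine_image_diff_tendsto) auto
      then show ?thesis
      proof (rule Lim_transform_eventually)
        show "\<forall>\<^sub>F k in sequentially. vol (tile_set \<sigma> T - (\<lambda>y. tile_pos (g k T) + tile_scale (g k T) *\<^sub>R y) ` prototile \<sigma> (tile_label T))
            = vol (tile_set \<sigma> T - tile_set \<sigma> (g k T))"
          using g by eventually_elim (use T in \<open>simp add: tile_set_def[of \<sigma> "g _ T"]\<close>)
      qed
    qed
    then have "(\<lambda>k. \<Sum>T\<in>P'. vol (tile_set \<sigma> T - tile_set \<sigma> (g k T))) \<longlonglongrightarrow> (\<Sum>T\<in>P'. 0)"
      by (intro tendsto_sum)
    \<comment> \<open>\<open>min_ratio\<close> bounds all tile volumes from below, so a smaller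
      total discrepancy can neither separate a tile from its counterpart nor leave room for an
      additional tile.\<close>
    then have "\<forall>\<^sub>F k in sequentially. (\<Sum>T\<in>P'. vol (tile_set \<sigma> T - tile_set \<sigma> (g k T))) < min_ratio"
      using min_ratio(1) by (simp add: order_tendsto_iff)
    with g wlim[OF f(1)] wlim[of "\<lambda>_ _. 1"]
    have "\<forall>\<^sub>F k in sequentially. (inj_on (g k) P' \<and> g k ` P' \<subseteq> subdivision \<sigma> 1 (T0 k) \<and>
        (\<forall>T\<in>P'. tile_label (g k T) = tile_label T)) \<and>
      \<bar>tile_weight \<sigma> f P - (\<Sum>T\<in>P. tile_vol \<sigma> (g k T) * f (tile_label T) (tile_vol \<sigma> (g k T)))\<bar> < \<eta>1 \<and>
      \<bar>tile_weight \<sigma> (\<lambda>_ _. 1) P - (\<Sum>T\<in>P. tile_vol \<sigma> (g k T) * 1)\<bar> < \<eta>1 \<and>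
      (\<Sum>T\<in>P'. vol (tile_set \<sigma> T - tile_set \<sigma> (g k T))) < min_ratio"
      by (simp add: eventually_conj_iff)
    then obtain k where "(inj_on (g k) P' \<and> g k ` P' \<subseteq> subdivision \<sigma> 1 (T0 k) \<and>
        (\<forall>T\<in>P'. tile_label (g k T) = tile_label T)) \<and>
      \<bar>tile_weight \<sigma> f P - (\<Sum>T\<in>P. tile_vol \<sigma> (g k T) * f (tile_label T) (tile_vol \<sigma> (g k T)))\<bar> < \<eta>1 \<and>
      \<bar>tile_weight \<sigma> (\<lambda>_ _. 1) P - (\<Sum>T\<in>P. tile_vol \<sigma> (g k T) * 1)\<bar> < \<eta>1 \<and>
      (\<Sum>T\<in>P'. vol (tile_set \<sigma> T - tile_set \<sigma> (g k T))) < min_ratio"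
      by (auto dest!: eventually_happens)
    then have inj: "inj_on (g k) P'" and img: "g k ` P' \<subseteq> subdivision \<sigma> 1 (T0 k)"
      and lab: "\<And>T. T \<in> P' \<Longrightarrow> tile_label (g k T) = tile_label T"
      and wf: "\<bar>tile_weight \<sigma> f P - (\<Sum>T\<in>P. tile_vol \<sigma> (g k T) * f (tile_label T) (tile_vol \<sigma> (g k T)))\<bar> < \<eta>1"
      and w1: "\<bar>tile_weight \<sigma> (\<lambda>_ _. 1) P - (\<Sum>T\<in>P. tile_vol \<sigma> (g k T) * 1)\<bar> < \<eta>1"
      and small: "(\<Sum>T\<in>P'. vol (tile_set \<sigma> T - tile_set \<sigma> (g k T))) < min_ratio"
      by blast+
    define G where "G = g k ` P"
    have GI: "G \<subseteq> subdivision \<sigma> 1 (T0 k)" using img PP' by (auto simp: G_def)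
    have fin1: "finite (subdivision \<sigma> 1 (T0 k))"
      and pw1: "pairwise (\<lambda>T T'. negligible (tile_set \<sigma> T \<inter> tile_set \<sigma> T')) (subdivision \<sigma> 1 (T0 k))"
      using partitions_subdivision[of 1 "T0 k"] T0 by (auto simp: partitions_def)
    note vol1 = subdivision_1_vol[OF T0(1)[of k] T0(2)[of k]]
    have wG: "(\<Sum>T\<in>P. tile_vol \<sigma> (g k T) * F (tile_label T) (tile_vol \<sigma> (g k T))) = tile_weight \<sigma> F G"
      for F :: "'n \<Rightarrow> real \<Rightarrow> real"
      unfolding G_def tile_weight_def using lab PP' inj
      by (subst sum.reindex) (auto intro: inj_on_subset intro!: sum.cong)
    have wf': "\<bar>tile_weight \<sigma> f P - tile_weight \<sigma> f G\<bar> < \<eta>1" using wf unfolding wG .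
    have w1': "\<bar>tile_weight \<sigma> (\<lambda>_ _. 1) P - tile_weight \<sigma> (\<lambda>_ _. 1) G\<bar> < \<eta>1"
      using w1 unfolding wG[of "\<lambda>_ _. 1"] .

    have "tile_weight \<sigma> (\<lambda>_ _. 1) G \<le> (\<Sum>T\<in>subdivision \<sigma> 1 (T0 k). tile_vol \<sigma> T)"
      unfolding tile_weight_one using GI fin1 vol1 min_ratio by (intro sum_mono2) (force intro: order_trans)+
    also have "\<dots> = tile_vol \<sigma> (T0 k)" using sum_tile_vol_subdivision[of 1 "T0 k"] T0 by simp
    finally have "\<Lambda> * min_ratio \<le> tile_vol \<sigma> (T0 k)"
      using w1' W1(2) \<eta>1(2) A(3) unfolding N_def by linarith
    note volL = subdivision_vol[OF _ T0(1)[of k] this]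
    define \<S> where "\<S> = subdivision \<sigma> \<Lambda> (T0 k)"
    have \<S>: "finite \<S>" "pairwise (\<lambda>T T'. negligible (tile_set \<sigma> T \<inter> tile_set \<sigma> T')) \<S>"
      using partitions_subdivision[of \<Lambda> "T0 k"] T0 \<Lambda> by (auto simp: partitions_def \<S>_def)
    have vol\<S>: "tile_scale S > 0" "\<Lambda> * min_ratio \<le> tile_vol \<sigma> S" "tile_vol \<sigma> S \<le> \<Lambda>" if "S \<in> \<S>" for S
      using subdivision_scale_pos[of \<Lambda> "T0 k" S] volL[of S] that \<Lambda> T0(1)[of k] by (auto simp: \<S>_def)
    have sub\<S>: "subdivision \<sigma> 1 (T0 k) = (\<Union>S\<in>\<S>. subdivision \<sigma> 1 S)"
      unfolding \<S>_def using \<Lambda> T0(1)[of k] by (intro subdivision_subdivision) auto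
    \<comment> \<open>The patch \<open>G\<close> approximating \<open>P\<close> is compared with the subdivided supertiles \<open>H\<close> inside \<open>A\<close>;
      they differ only in tiles near the frontier of \<open>A\<close>.\<close>
    define \<S>' where "\<S>' = {S \<in> \<S>. tile_set \<sigma> S \<subseteq> A}"
    have \<S>': "finite \<S>'" "\<S>' \<subseteq> \<S>" using \<S>(1) by (auto simp: \<S>'_def)
    have pw\<S>': "pairwise (\<lambda>T T'. negligible (tile_set \<sigma> T \<inter> tile_set \<sigma> T')) \<S>'"
      using \<S>(2) \<S>'(2) by (rule pairwise_subset)
    define H where "H = (\<Union>S\<in>\<S>'. subdivision \<sigma> 1 S)"
    have HI: "H \<subseteq> subdivision \<sigma> 1 (T0 k)" using \<S>'(2) by (auto simp: H_def sub\<S>)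
    have meet: "\<exists>w. w \<in> tile_set \<sigma> V \<and> w \<in> tile_set \<sigma> S" if S: "S \<in> \<S>" "V \<in> subdivision \<sigma> 1 S" for S V
    proof (rule ccontr)
      assume "\<not> ?thesis"
      then have "tile_set \<sigma> V - tile_set \<sigma> S = tile_set \<sigma> V" by blast
      moreover have "negligible (tile_set \<sigma> V - tile_set \<sigma> S)"
        using partitions_negligible_diff[OF conjunct2[OF partitions_subdivision[of 1 S]] S(2)] vol\<S>(1)[OF S(1)] by simp
      moreover have "V \<in> subdivision \<sigma> 1 (T0 k)" using S sub\<S> by blast
      ultimately show False using not_negligible_tile_set vol1(1) by metis
    qed
    have meet': "\<exists>z. z \<in> tile_set \<sigma> T \<and> z \<in> tile_set \<sigma> (g k T)" if T: "T \<in> P'" for T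
    proof (rule ccontr)
      assume "\<not> ?thesis"
      then have "tile_set \<sigma> T - tile_set \<sigma> (g k T) = tile_set \<sigma> T" by blast
      then have "tile_vol \<sigma> T = vol (tile_set \<sigma> T - tile_set \<sigma> (g k T))" by (simp add: tile_vol_def)
      also have "\<dots> \<le> (\<Sum>T\<in>P'. vol (tile_set \<sigma> T - tile_set \<sigma> (g k T)))"
        using P'(1) T by (intro member_le_sum) auto
      finally show False using small volP'(2)[OF T] by linarith
    qed
    have HQ: "H \<subseteq> g k ` P'"
    proof
      fix V assume "V \<in> H"
      then obtain S where S: "S \<in> \<S>" "tile_set \<sigma> S \<subseteq> A" "V \<in> subdivision \<sigma> 1 S"
        by (auto simp: H_def \<S>'_def)
      have V: "V \<in> subdivision \<sigma> 1 (T0 k)" using S sub\<S> by blast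
      obtain w where w: "w \<in> tile_set \<sigma> V" "w \<in> tile_set \<sigma> S" using meet S by blast
      have ball: "tile_set \<sigma> V \<subseteq> ball 0 (R0 + D)"
      proof
        fix y assume y: "y \<in> tile_set \<sigma> V"
        have "norm w < R0" using R0 S w by blast
        moreover have "dist w y \<le> D" using D1[OF vol1(1,3)] V w y by blast
        ultimately show "y \<in> ball 0 (R0 + D)"
          using norm_triangle_sub[of y w] by (simp add: dist_norm norm_minus_commute)
      qed
      \<comment> \<open>A tile without counterpart would be essentially disjoint from all
        \<open>g k T\<close>, hence lie up to a null set in the union of the sets
        \<open>T - g k T\<close>, whose total volume is below \<open>min_ratio\<close>.\<close>
      show "V \<in> g k ` P'"
      proof (rule ccontr)
        assume "V \<notin> g k ` P'"
        have null: "negligible (tile_set \<sigma> V \<inter> tile_set \<sigma> (g k T))" if "T \<in> P'" for T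
          using pairwiseD[OF pw1 V, of "g k T"] img that \<open>V \<notin> g k ` P'\<close> by blast
        let ?Z = "(\<Union>T\<in>P'. tile_set \<sigma> V \<inter> tile_set \<sigma> (g k T)) \<union> - (\<Union>T\<in>\<T>. tile_set \<sigma> T)"
        let ?U = "\<Union>T\<in>P'. tile_set \<sigma> T - tile_set \<sigma> (g k T)"
        have meas: "tile_set \<sigma> T - tile_set \<sigma> (g k T) \<in> lmeasurable" if "T \<in> P'" for T
          using lmeasurable_tile_set volP'(1)[OF that] vol1(1) img that by (intro fmeasurable.Diff) blast+
        have Z: "negligible ?Z"
          using null P'(1) tiling_cover[OF tiling] by (intro negligible_Un negligible_Union) auto
        have "tile_set \<sigma> V \<subseteq> ?U \<union> ?Z"
        proof
          fix y assume y: "y \<in> tile_set \<sigma> V"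
          then have "y \<in> ball 0 (R0 + D)" using ball by blast
          then show "y \<in> ?U \<union> ?Z" using y unfolding P'_def by blast
        qed
        moreover have U: "?U \<in> lmeasurable" using meas P'(1) by (intro fmeasurable.finite_UN) auto
        moreover have Zm: "?Z \<in> lmeasurable" using Z by (rule negligible_imp_measurable)
        ultimately have "tile_vol \<sigma> V \<le> vol (?U \<union> ?Z)"
          unfolding tile_vol_def using fmeasurableD[OF lmeasurable_tile_set[OF vol1(1)[OF V]]] fmeasurable.Un[OF U Zm]
          by (intro measure_mono_fmeasurable)
        also have "\<dots> \<le> vol ?U + vol ?Z" using U Zm by (intro measure_Un_le fmeasurableD)
        also have "vol ?Z = 0" using Z by (rule negligible_imp_measure0)
        also have "vol ?U + 0 \<le> (\<Sum>T\<in>P'. vol (tile_set \<sigma> T - tile_set \<sigma> (g k T)))"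
          using meas P'(1) by (auto intro!: measure_UNION_le)
        finally show False using small vol1(2)[OF V] by linarith
      qed
    qed
    \<comment> \<open>The origin of \<open>3 * D\<close>: a chain of two tiles or supertiles leads
      from \<open>A\<close> to its complement within distance \<open>2 * D\<close>, and the tile
      \<open>V\<close> itself adds a third diameter.\<close>
    have near: "tile_set \<sigma> V \<subseteq> N" if V: "V \<in> subdivision \<sigma> 1 (T0 k)" and yz: "y \<in> tile_set \<sigma> V"
      "y \<in> A" "z \<notin> A" "dist y z \<le> 2 * D" for V y z
    proof
      fix u assume u: "u \<in> tile_set \<sigma> V"
      obtain x where x: "x \<in> frontier A" "dist y x \<le> dist y z" using frontier_crossing[OF yz(2,3)] .
      have "dist u y \<le> D" using D1[OF vol1(1,3)] V u yz(1) by blast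
      then have "dist u x < \<rho>" using x(2) yz(4) \<rho> dist_triangle[of u x y] by linarith
      then show "u \<in> N" using x(1) by (auto simp: N_def frontier_nbhd_def dist_commute)
    qed
    \<comment> \<open>In \<open>G - H\<close> the supertile around \<open>V\<close> leaves
      \<open>A\<close>; in \<open>H - G\<close> the tile of the tiling approximated by
      \<open>V\<close> does. Either one supplies the chain that ends outside
      \<open>A\<close>.\<close>
    have sd: "tile_set \<sigma> V \<subseteq> N" if "V \<in> sym_diff G H" for V
      using that
    proof
      assume V: "V \<in> G - H"
      then obtain T where T: "T \<in> P" "V = g k T" by (auto simp: G_def)
      obtain z where z: "z \<in> tile_set \<sigma> T" "z \<in> tile_set \<sigma> V" using meet' T PP' by blast
      have VI: "V \<in> subdivision \<sigma> 1 (T0 k)" using V GI by blast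
      then obtain S where S: "S \<in> \<S>" "V \<in> subdivision \<sigma> 1 S" unfolding sub\<S> by blast
      then have "\<not> tile_set \<sigma> S \<subseteq> A" using V by (auto simp: H_def \<S>'_def)
      then obtain z' where z': "z' \<in> tile_set \<sigma> S" "z' \<notin> A" by blast
      obtain w where w: "w \<in> tile_set \<sigma> V" "w \<in> tile_set \<sigma> S" using meet S by blast
      have "dist z w \<le> D" using D1[OF vol1(1,3)] VI z w by blast
      moreover have "dist w z' \<le> D" using D(2) vol\<S>[OF S(1)] w z' by blast
      ultimately have "dist z z' \<le> 2 * D" using dist_triangle[of z z' w] by linarith
      moreover have "z \<in> A" using T z by (auto simp: P_def)
      ultimately show ?thesis using near VI z z' by blast
    next
      assume V: "V \<in> H - G"
      then obtain T where T: "T \<in> P'" "V = g k T" using HQ by blast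
      then have "T \<notin> P" using V by (auto simp: G_def)
      then obtain z' where z': "z' \<in> tile_set \<sigma> T" "z' \<notin> A" using T by (auto simp: P_def P'_def)
      obtain z where z: "z \<in> tile_set \<sigma> T" "z \<in> tile_set \<sigma> V" using meet' T by blast
      have VI: "V \<in> subdivision \<sigma> 1 (T0 k)" using V HI by blast
      obtain S where S: "S \<in> \<S>" "tile_set \<sigma> S \<subseteq> A" "V \<in> subdivision \<sigma> 1 S"
        using V by (auto simp: H_def \<S>'_def)
      obtain w where w: "w \<in> tile_set \<sigma> V" "w \<in> tile_set \<sigma> S" using meet S by blast
      have "dist w z \<le> D" using D1[OF vol1(1,3)] VI z w by blast
      moreover have "dist z z' \<le> D" using D1 volP'[OF T(1)] z z' by blast
      ultimately have "dist w z' \<le> 2 * D" using dist_triangle[of w z' z] by linarith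
      then show ?thesis using near VI w z' S by blast
    qed
    have fGH: "finite G" "finite H" using GI HI fin1 finite_subset by blast+
    have sdI: "sym_diff G H \<subseteq> subdivision \<sigma> 1 (T0 k)" using GI HI by blast
    have bd: "(\<Sum>V\<in>sym_diff G H. tile_vol \<sigma> V) \<le> vol N"
    proof (rule sum_tile_vol_le)
      show "negligible (tile_set \<sigma> V - N)" if "V \<in> sym_diff G H" for V
        using sd[OF that] by (metis Diff_eq_empty_iff negligible_empty)
      show "pairwise (\<lambda>T T'. negligible (tile_set \<sigma> T \<inter> tile_set \<sigma> T')) (sym_diff G H)"
        using pw1 sdI by (rule pairwise_subset)
    qed (use fGH N vol1 sdI in auto)
    have wGH: "\<bar>tile_weight \<sigma> F G - tile_weight \<sigma> F H\<bar> \<le> B' * vol N"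
      if F: "\<And>j x. \<bar>F j x\<bar> \<le> B'" "B' \<ge> 0" for F B'
    proof -
      have "\<bar>tile_weight \<sigma> F G - tile_weight \<sigma> F H\<bar>
          \<le> (\<Sum>V\<in>sym_diff G H. \<bar>tile_vol \<sigma> V * F (tile_label V) (tile_vol \<sigma> V)\<bar>)"
        unfolding tile_weight_def by (rule sum_diff_symdiff[OF fGH])
      also have "\<dots> \<le> (\<Sum>V\<in>sym_diff G H. B' * tile_vol \<sigma> V)"
      proof (rule sum_mono)
        fix V assume "V \<in> sym_diff G H"
        then have "tile_vol \<sigma> V \<ge> 0" using sdI vol1(2) min_ratio(1) by (meson less_imp_le order_trans subsetD)
        then show "\<bar>tile_vol \<sigma> V * F (tile_label V) (tile_vol \<sigma> V)\<bar> \<le> B' * tile_vol \<sigma> V"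
          using mult_left_mono[OF F(1)[of "tile_label V" "tile_vol \<sigma> V"], of "tile_vol \<sigma> V"] by (simp add: abs_mult mult.commute)
      qed
      also have "\<dots> = B' * (\<Sum>V\<in>sym_diff G H. tile_vol \<sigma> V)" by (rule sum_distrib_left[symmetric])
      also have "\<dots> \<le> B' * vol N" using bd F(2) by (rule mult_left_mono)
      finally show ?thesis .
    qed
    have wH: "tile_weight \<sigma> F H = (\<Sum>S\<in>\<S>'. tile_vol \<sigma> S * profile F (tile_label S) (ln (tile_vol \<sigma> S)))"
      for F :: "'n \<Rightarrow> real \<Rightarrow> real"
    proof -
      have "tile_weight \<sigma> F H = (\<Sum>S\<in>\<S>'. tile_weight \<sigma> F (subdivision \<sigma> 1 S))"
        unfolding H_def using \<S>' vol\<S>(1) pw\<S>' by (intro tile_weight_UN_subdivision) auto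
      also have "\<dots> = (\<Sum>S\<in>\<S>'. tile_vol \<sigma> S * profile F (tile_label S) (ln (tile_vol \<sigma> S)))"
        using \<S>'(2) vol\<S>(1) by (intro sum.cong refl tile_weight_subdivision) auto
      finally show ?thesis .
    qed
    define s where "s = (\<Sum>S\<in>\<S>'. tile_vol \<sigma> S)"
    have s: "tile_weight \<sigma> (\<lambda>_ _. 1) H = s"
    proof -
      have "tile_weight \<sigma> (\<lambda>_ _. 1) H = (\<Sum>S\<in>\<S>'. tile_weight \<sigma> (\<lambda>_ _. 1) (subdivision \<sigma> 1 S))"
        unfolding H_def using \<S>' vol\<S>(1) pw\<S>' by (intro tile_weight_UN_subdivision) auto
      also have "\<dots> = s"
        unfolding s_def tile_weight_one using \<S>'(2) vol\<S>(1) by (intro sum.cong sum_tile_vol_subdivision) auto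
      finally show ?thesis .
    qed
    have sA: "s \<le> vol A"
      unfolding s_def
    proof (rule sum_tile_vol_le[OF \<S>'(1) _ _ pw\<S>' Am])
      show "negligible (tile_set \<sigma> S - A)" if "S \<in> \<S>'" for S
        using that by (simp add: \<S>'_def Diff_eq_empty_iff[THEN iffD2])
    qed (use \<S>'(2) vol\<S>(1) in auto)
    have "\<bar>tile_weight \<sigma> f H - L * s\<bar>
        = \<bar>\<Sum>S\<in>\<S>'. tile_vol \<sigma> S * (profile f (tile_label S) (ln (tile_vol \<sigma> S)) - L)\<bar>"
      unfolding wH s_def by (simp add: right_diff_distrib sum_subtractf sum_distrib_left mult.commute)
    also have "\<dots> \<le> (\<Sum>S\<in>\<S>'. tile_vol \<sigma> S * \<epsilon>)"
    proof (intro sum_abs[THEN order_trans] sum_mono)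
      fix S assume "S \<in> \<S>'"
      then have S: "0 < tile_vol \<sigma> S" "\<Lambda> * min_ratio \<le> tile_vol \<sigma> S"
        using \<S>'(2) vol\<S> tile_vol_pos by blast+
      have "0 < \<Lambda> * min_ratio" using \<Lambda> min_ratio by simp
      then have "ln (\<Lambda> * min_ratio) \<le> ln (tile_vol \<sigma> S)" using S by simp
      from mult_left_mono[OF conv[OF this], of "tile_vol \<sigma> S"]
      show "\<bar>tile_vol \<sigma> S * (profile f (tile_label S) (ln (tile_vol \<sigma> S)) - L)\<bar> \<le> tile_vol \<sigma> S * \<epsilon>"
        using S by (simp add: abs_mult)
    qed
    also have "\<dots> = \<epsilon> * s" unfolding s_def by (simp add: sum_distrib_left mult.commute)
    also have "\<dots> \<le> \<epsilon> * vol A" using sA \<epsilon> by (rule mult_left_mono)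
    finally have e1: "\<bar>tile_weight \<sigma> f H - L * s\<bar> \<le> \<epsilon> * vol A" .
    \<comment> \<open>One neighborhood separates \<open>P\<close> from \<open>A\<close>, another
      separates \<open>G\<close> from \<open>H\<close>, and \<open>\<eta>1\<close> accounts for
      replacing \<open>P\<close> by \<open>G\<close>.\<close>
    have "\<bar>s - vol A\<bar> \<le> 2 * vol N + \<eta>1"
      using wGH[of "\<lambda>_ _. 1" 1] w1' W1(1) unfolding s by linarith
    then have "\<bar>L\<bar> * \<bar>s - vol A\<bar> \<le> \<bar>L\<bar> * (2 * vol N + \<eta>1)" by (intro mult_left_mono) auto
    then have e2: "\<bar>L * s - L * vol A\<bar> \<le> \<bar>L\<bar> * (2 * vol N + \<eta>1)"
      by (simp add: abs_mult[symmetric] right_diff_distrib)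
    have "\<bar>tile_weight \<sigma> f P - L * vol A\<bar> \<le> \<eta>1 + B * vol N + \<epsilon> * vol A + \<bar>L\<bar> * (2 * vol N + \<eta>1)"
      using wf' wGH[where F = f, OF f(2) B] e1 e2 by linarith
    also have "\<dots> = \<epsilon> * vol A + (B + 2 * \<bar>L\<bar>) * vol N + \<eta>1 * (1 + \<bar>L\<bar>)" by (simp add: algebra_simps)
    finally show ?thesis using \<eta>1(1) by linarith
  qed
  then show ?thesis unfolding P_def N_def by (rule field_le_epsilon)
qed

end

section \<open>The renewal equation of a scheme\<close>

context renewal_graph
begin

text \<open>By invariance and non-negativity, positivity passes from the tail of an arc to its head,
  hence along walks to every vertex.\<close>

lemma invariant_positive:
  assumes w: "\<And>j. (\<Sum>e\<in>in_arcs G j. w (tail G e) * p e) = w j" "\<And>j. 0 \<le> w j" and i: "w i > 0"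
  shows "w j > 0"
proof -
  obtain es where "awalk i es j" using walk_exists by blast
  then show ?thesis using i
  proof (induction es arbitrary: i)
    case Nil
    then show ?case by (simp add: awalk_Nil_iff)
  next
    case (Cons e es)
    have e: "e \<in> arcs G" "tail G e = i" "awalk (head G e) es j" using Cons.prems(1) by (auto simp: awalk_Cons_iff)
    have "0 < w (tail G e) * p e" using e Cons.prems(2) p_pos by simp
    also have "\<dots> \<le> (\<Sum>e\<in>in_arcs G (head G e). w (tail G e) * p e)"
      using e w(2) p_pos finite_arcs
      by (intro member_le_sum mult_nonneg_nonneg) (auto simp: in_arcs_def less_imp_le)
    also have "\<dots> = w (head G e)" by (rule w(1))
    finally show ?case using Cons.IH e(3) by blast
  qed
qed

text \<open>The triangle inequality gives \<open>\<ge>\<close> at every vertex. Summed over all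
  vertices both sides agree, because the probabilities leaving a vertex add up to 1, so equality
  holds throughout.\<close>

lemma invariant_abs:
  assumes v: "\<And>j. (\<Sum>e\<in>in_arcs G j. v (tail G e) * p e) = v j"
  shows "(\<Sum>e\<in>in_arcs G j. \<bar>v (tail G e)\<bar> * p e) = \<bar>v j\<bar>"
proof -
  let ?d = "\<lambda>j. (\<Sum>e\<in>in_arcs G j. \<bar>v (tail G e)\<bar> * p e) - \<bar>v j\<bar>"
  have nonneg: "?d j \<ge> 0" for j
  proof -
    have "\<bar>v j\<bar> \<le> (\<Sum>e\<in>in_arcs G j. \<bar>v (tail G e) * p e\<bar>)"
      using sum_abs[of "\<lambda>e. v (tail G e) * p e" "in_arcs G j"] by (simp only: v)
    also have "\<dots> = (\<Sum>e\<in>in_arcs G j. \<bar>v (tail G e)\<bar> * p e)"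
      using p_pos by (intro sum.cong refl) (auto simp: abs_mult abs_of_pos)
    finally show ?thesis by simp
  qed
  have "(\<Sum>j\<in>UNIV. ?d j) = (\<Sum>e\<in>arcs G. \<bar>v (tail G e)\<bar> * p e) - (\<Sum>j\<in>UNIV. \<bar>v j\<bar>)"
    by (simp add: sum_subtractf sum_arcs_head)
  also have "(\<Sum>e\<in>arcs G. \<bar>v (tail G e)\<bar> * p e) = (\<Sum>i\<in>UNIV. \<bar>v i\<bar>)"
    by (simp add: sum_arcs_tail sum_distrib_left[symmetric] p_sum)
  finally have "(\<Sum>j\<in>UNIV. ?d j) = 0" by simp
  then have "\<forall>j\<in>UNIV. ?d j = 0" using nonneg by (subst (asm) sum_nonneg_eq_0_iff) auto
  then show ?thesis by (metis UNIV_I eq_iff_diff_eq_0)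
qed

text \<open>\<open>\<bar>v j\<bar> + v j\<close> is invariant, non-negative and positive at
  \<open>i\<close>, hence positive everywhere, which forces \<open>v\<close> to be positive.\<close>

lemma invariant_mean_len_pos:
  assumes v: "\<And>j. (\<Sum>e\<in>in_arcs G j. v (tail G e) * p e) = v j" and i: "v i > 0"
  shows "(\<Sum>e\<in>arcs G. v (tail G e) * p e * len e) > 0"
proof -
  have w: "\<bar>v j\<bar> + v j > 0" for j
  proof (rule invariant_positive[where w = "\<lambda>j. \<bar>v j\<bar> + v j"])
    show "(\<Sum>e\<in>in_arcs G j. (\<bar>v (tail G e)\<bar> + v (tail G e)) * p e) = \<bar>v j\<bar> + v j" for j
      by (simp add: distrib_right sum.distrib v invariant_abs[OF v])
    show "0 < \<bar>v i\<bar> + v i" using i by simp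
  qed linarith
  then have vpos: "v j > 0" for j using w[of j] by linarith
  have "out_arcs G i \<noteq> {}" using p_sum[of i] by force
  then have "arcs G \<noteq> {}" by auto
  then show ?thesis
    using finite_arcs vpos p_pos len_pos by (intro sum_pos) auto
qed

text \<open>An eigenvector carries no sign convention; the negative case is reduced to
  \<open>- v\<close>.\<close>

lemma invariant_mean_len_nonzero:
  assumes v: "\<And>j. (\<Sum>e\<in>in_arcs G j. v (tail G e) * p e) = v j" and i: "v i \<noteq> 0"
  shows "(\<Sum>e\<in>arcs G. v (tail G e) * p e * len e) \<noteq> 0"
proof (cases "v i > 0")
  case True
  then show ?thesis using invariant_mean_len_pos[OF v True] by simp
next
  case False
  have "(\<Sum>e\<in>arcs G. - v (tail G e) * p e * len e) > 0"
    by (rule invariant_mean_len_pos[where i = i]) (use v i False in \<open>auto simp: sum_negf\<close>)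
  then show ?thesis by (simp add: sum_negf)
qed

end

section \<open>The scheme as a weighted graph, and its matrices\<close>

context normalized_scheme
begin

definition arc_vol :: "'n \<times> nat \<Rightarrow> real" where
  "arc_vol e = subst_vol \<sigma> (subst_tiles \<sigma> (fst e) ! snd e)"

lemma subst_vol_eq: "subst_vol \<sigma> x = \<bar>fst x\<bar> ^ DIM('a)"
  using measure_affine_image[of 0 "fst x" "prototile \<sigma> (snd x)"]
  by (simp add: subst_vol_def case_prod_unfold prototile)

lemma subst_vol_ratios: "x \<in> set (subst_tiles \<sigma> i) \<Longrightarrow> subst_vol \<sigma> x \<in> ratios"
proof -
  assume x: "x \<in> set (subst_tiles \<sigma> i)"
  then have "fst x > 0" using subst_tiles_scale[of "fst x" "snd x" i] by simp
  then have "subst_vol \<sigma> x = (\<lambda>(\<alpha>, j). \<alpha> ^ DIM('a)) x" by (simp add: subst_vol_eq case_prod_unfold)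
  then show ?thesis unfolding ratios_def using x by (intro UN_I[of i] image_eqI[of _ _ x]) auto
qed

lemma arcs_scheme_graph: "e \<in> arcs (scheme_graph \<sigma>) \<longleftrightarrow> snd e < length (subst_tiles \<sigma> (fst e))"
  by (auto simp: scheme_graph_def)

lemma head_scheme_graph: "head (scheme_graph \<sigma>) e = snd (subst_tiles \<sigma> (fst e) ! snd e)"
  by (simp add: scheme_graph_def case_prod_unfold)

lemma tail_scheme_graph: "tail (scheme_graph \<sigma>) e = fst e"
  by (simp add: scheme_graph_def)

lemma arc_vol_ratios: "e \<in> arcs (scheme_graph \<sigma>) \<Longrightarrow> arc_vol e \<in> ratios"
  unfolding arc_vol_def arcs_scheme_graph by (rule subst_vol_ratios[of _ "fst e"]) (rule nth_mem)

lemma arc_vol_bounds: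
  "e \<in> arcs (scheme_graph \<sigma>) \<Longrightarrow> 0 < arc_vol e \<and> arc_vol e < 1 \<and> min_ratio \<le> arc_vol e"
  using arc_vol_ratios ratios_bounds min_ratio(3) by blast

lemma sum_out_arcs_scheme_graph:
  "(\<Sum>e\<in>out_arcs (scheme_graph \<sigma>) i. F (subst_tiles \<sigma> i ! snd e)) = (\<Sum>x\<leftarrow>subst_tiles \<sigma> i. F x)"
proof -
  have "out_arcs (scheme_graph \<sigma>) i = (\<lambda>k. (i, k)) ` {0..<length (subst_tiles \<sigma> i)}"
    by (auto simp: arcs_scheme_graph tail_scheme_graph)
  then have "(\<Sum>e\<in>out_arcs (scheme_graph \<sigma>) i. F (subst_tiles \<sigma> i ! snd e))
      = (\<Sum>k = 0..<length (subst_tiles \<sigma> i). F (subst_tiles \<sigma> i ! k))"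
    by (simp add: sum.reindex inj_on_def)
  then show ?thesis by (simp add: sum_list_sum_nth)
qed

lemma sum_arcs_from:
  "(\<Sum>e\<in>out_arcs (scheme_graph \<sigma>) i. F (arc_vol e) (head (scheme_graph \<sigma>) e))
    = (\<Sum>(\<alpha>, j)\<leftarrow>subst_tiles \<sigma> i. F (\<alpha> ^ DIM('a)) j)"
proof -
  have "(\<Sum>e\<in>out_arcs (scheme_graph \<sigma>) i. F (arc_vol e) (head (scheme_graph \<sigma>) e))
      = (\<Sum>e\<in>out_arcs (scheme_graph \<sigma>) i. (\<lambda>x. F (subst_vol \<sigma> x) (snd x)) (subst_tiles \<sigma> i ! snd e))"
    by (intro sum.cong refl) (simp add: arc_vol_def head_scheme_graph tail_scheme_graph)
  also have "\<dots> = (\<Sum>x\<leftarrow>subst_tiles \<sigma> i. F (subst_vol \<sigma> x) (snd x))"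
    by (rule sum_out_arcs_scheme_graph)
  also have "\<dots> = (\<Sum>(\<alpha>, j)\<leftarrow>subst_tiles \<sigma> i. F (\<alpha> ^ DIM('a)) j)"
  proof (intro arg_cong[of _ _ sum_list] map_cong refl)
    fix x assume "x \<in> set (subst_tiles \<sigma> i)"
    then have "fst x > 0" using subst_tiles_scale[of "fst x" "snd x" i] by simp
    then show "F (subst_vol \<sigma> x) (snd x) = (case x of (\<alpha>, j) \<Rightarrow> F (\<alpha> ^ DIM('a)) j)"
      by (simp add: subst_vol_eq case_prod_unfold)
  qed
  finally show ?thesis .
qed

lemma sum_arc_vol: "(\<Sum>e\<in>out_arcs (scheme_graph \<sigma>) i. arc_vol e) = 1"
  using sum_arcs_from[of "\<lambda>x j. x" i] sum_ratios[of i] by simp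

lemma finite_arcs_scheme_graph: "finite (arcs (scheme_graph \<sigma>))"
proof -
  have "arcs (scheme_graph \<sigma>) \<subseteq> (\<Union>i. {i} \<times> {..<length (subst_tiles \<sigma> i)})"
    by (auto simp: scheme_graph_def)
  then show ?thesis by (rule finite_subset) auto
qed

lemma type_matrix_nth:
  "type_matrix F \<sigma> $ i $ j
    = (\<Sum>e\<in>out_arcs (scheme_graph \<sigma>) i. if head (scheme_graph \<sigma>) e = j then F (arc_vol e) else 0)"
proof -
  have "type_matrix F \<sigma> $ i $ j = (\<Sum>x\<leftarrow>subst_tiles \<sigma> i. if snd x = j then F (subst_vol \<sigma> x) else 0)"
    by (simp add: type_matrix_def sum_list_map_filter')
  also have "\<dots> = (\<Sum>e\<in>out_arcs (scheme_graph \<sigma>) i. (\<lambda>x. if snd x = j then F (subst_vol \<sigma> x) else 0) (subst_tiles \<sigma> i ! snd e))"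
    by (rule sum_out_arcs_scheme_graph[symmetric])
  also have "\<dots> = (\<Sum>e\<in>out_arcs (scheme_graph \<sigma>) i. if head (scheme_graph \<sigma>) e = j then F (arc_vol e) else 0)"
    by (intro sum.cong refl) (simp add: arc_vol_def head_scheme_graph tail_scheme_graph)
  finally show ?thesis .
qed

end

locale irreducible_normalized_scheme = normalized_scheme \<sigma>
  for \<sigma> :: "('a::euclidean_space, 'n::finite) scheme" +
  assumes irreducible: "irreducible_scheme \<sigma>"
begin

text \<open>Normalization makes the volume of a substitution tile a transition probability, and
  \<open>graph.len\<close> becomes the arc length of the scheme.\<close>

sublocale graph: renewal_graph "scheme_graph \<sigma>" arc_vol
proof
  show "strongly_connected (scheme_graph \<sigma>)" using irreducible by (simp add: irreducible_scheme_def)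
qed (use arc_vol_bounds sum_arc_vol finite_arcs_scheme_graph in \<open>auto simp: scheme_graph_def\<close>)

lemma arc_length_eq: "e \<in> arcs (scheme_graph \<sigma>) \<Longrightarrow> arc_length \<sigma> e = graph.len e"
  using arc_vol_bounds[of e] by (simp add: arc_length_def graph.len_def arc_vol_def case_prod_unfold ln_div)

lemma vector_type_matrix:
  "(v v* type_matrix F \<sigma>) $ j = (\<Sum>e\<in>in_arcs (scheme_graph \<sigma>) j. v $ tail (scheme_graph \<sigma>) e * F (arc_vol e))"
proof -
  let ?G = "scheme_graph \<sigma>"
  have "(v v* type_matrix F \<sigma>) $ j
      = (\<Sum>i\<in>UNIV. \<Sum>e\<in>out_arcs ?G i. if head ?G e = j then v $ tail ?G e * F (arc_vol e) else 0)"
    by (simp add: vector_matrix_mult_def type_matrix_nth sum_distrib_left sum_distrib_right if_distrib mult.commute cong: if_cong)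
  also have "\<dots> = (\<Sum>e\<in>arcs ?G. if head ?G e = j then v $ tail ?G e * F (arc_vol e) else 0)"
    by (rule graph.sum_arcs_tail[symmetric])
  also have "\<dots> = (\<Sum>e\<in>in_arcs ?G j. v $ tail ?G e * F (arc_vol e))"
    unfolding in_arcs_def using finite_arcs_scheme_graph by (subst sum.inter_filter) auto
  finally show ?thesis .
qed

lemma inner_type_matrix:
  "v \<bullet> (type_matrix F \<sigma> *v 1) = (\<Sum>e\<in>arcs (scheme_graph \<sigma>). v $ tail (scheme_graph \<sigma>) e * F (arc_vol e))"
proof -
  have "v \<bullet> (type_matrix F \<sigma> *v 1) = (v v* type_matrix F \<sigma>) \<bullet> 1"
    by (rule dot_lmul_matrix[symmetric])
  also have "\<dots> = (\<Sum>j\<in>UNIV. (v v* type_matrix F \<sigma>) $ j)" by (simp add: inner_vec_def)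
  also have "\<dots> = (\<Sum>e\<in>arcs (scheme_graph \<sigma>). v $ tail (scheme_graph \<sigma>) e * F (arc_vol e))"
    unfolding vector_type_matrix by (rule graph.sum_arcs_head[symmetric])
  finally show ?thesis .
qed

lemma V_matrix_nonneg: "V_matrix \<sigma> $ i $ j \<ge> 0"
  unfolding V_matrix_def type_matrix_nth using arc_vol_bounds by (intro sum_nonneg) (auto intro: less_imp_le)

lemma V_matrix_row_sum: "(\<Sum>j\<in>UNIV. V_matrix \<sigma> $ i $ j) = 1"
  unfolding V_matrix_def type_matrix_nth
  by (subst sum.swap) (simp add: sum_arc_vol)

text \<open>\<open>V_matrix\<close> has row sums 1, so the all-ones vector is an eigenvector for 1.
  For any eigenvector, the equation at its entry of largest modulus bounds the modulus of the
  eigenvalue by 1.\<close>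

lemma PF_eigenvalue_V_matrix: "PF_eigenvalue (V_matrix \<sigma>) = 1"
  unfolding PF_eigenvalue_def
proof (rule cSup_eq_maximum)
  let ?M = "\<chi> i j. complex_of_real (V_matrix \<sigma> $ i $ j)"
  have "?M *v 1 = 1 *s 1"
  proof (rule vec_eq_iff[THEN iffD2], rule allI)
    fix i
    have "(?M *v 1) $ i = complex_of_real (\<Sum>j\<in>UNIV. V_matrix \<sigma> $ i $ j)"
      by (simp add: matrix_vector_mult_def)
    then show "(?M *v 1) $ i = (1 *s 1) $ i" by (simp add: V_matrix_row_sum)
  qed
  moreover have "(1 :: complex ^ 'n) \<noteq> 0" by (simp add: vec_eq_iff)
  ultimately show "1 \<in> {cmod \<mu> |\<mu>. \<exists>w. w \<noteq> 0 \<and> ?M *v w = \<mu> *s w}"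
    by (intro CollectI exI[of _ "1::complex"] conjI exI[of _ "1::complex ^ 'n"]) auto
  fix x assume "x \<in> {cmod \<mu> |\<mu>. \<exists>w. w \<noteq> 0 \<and> ?M *v w = \<mu> *s w}"
  then obtain \<mu> w where w: "x = cmod \<mu>" "w \<noteq> 0" "?M *v w = \<mu> *s w" by blast
  obtain i where i: "\<And>j. cmod (w $ j) \<le> cmod (w $ i)"
  proof -
    let ?S = "range (\<lambda>i. cmod (w $ i))"
    have "Max ?S \<in> ?S" by (intro Max_in) auto
    then obtain i where i: "Max ?S = cmod (w $ i)" by (rule imageE)
    have "cmod (w $ j) \<le> cmod (w $ i)" for j unfolding i[symmetric] by (rule Max_ge) auto
    then show ?thesis using that by blast
  qed
  obtain j where "w $ j \<noteq> 0" using w(2) by (auto simp: vec_eq_iff)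
  then have pos: "cmod (w $ i) > 0" using i[of j] by (meson less_le_trans zero_less_norm_iff)
  have "cmod \<mu> * cmod (w $ i) = cmod (\<Sum>j\<in>UNIV. complex_of_real (V_matrix \<sigma> $ i $ j) * w $ j)"
    using arg_cong[OF w(3), of "\<lambda>u. cmod (u $ i)"] by (simp add: matrix_vector_mult_def norm_mult)
  also have "\<dots> \<le> (\<Sum>j\<in>UNIV. V_matrix \<sigma> $ i $ j * cmod (w $ i))"
    using V_matrix_nonneg i
    by (intro sum_norm_le) (auto simp: norm_mult intro!: mult_mono)
  also have "\<dots> = cmod (w $ i)" by (simp add: sum_distrib_right[symmetric] V_matrix_row_sum)
  finally show "x \<le> 1" using pos w(1) by simp
qed

text \<open>Reads the matrix data on the graph: \<open>v\<close> is an invariant vector of the chain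
  and the denominator is the associated weighted sum of arc lengths.\<close>

lemma left_PF_eigenvector:
  assumes "left_PF_eigenvector (V_matrix \<sigma>) v"
  shows "(\<Sum>e\<in>in_arcs (scheme_graph \<sigma>) j. v $ tail (scheme_graph \<sigma>) e * arc_vol e) = v $ j"
    and "v \<bullet> (H_matrix \<sigma> *v 1) = (\<Sum>e\<in>arcs (scheme_graph \<sigma>). v $ tail (scheme_graph \<sigma>) e * arc_vol e * graph.len e)"
    and "v \<bullet> (H_matrix \<sigma> *v 1) \<noteq> 0"
proof -
  have v: "v \<noteq> 0" "v v* V_matrix \<sigma> = v"
    using assms PF_eigenvalue_V_matrix by (auto simp: left_PF_eigenvector_def)
  show inv: "(\<Sum>e\<in>in_arcs (scheme_graph \<sigma>) j. v $ tail (scheme_graph \<sigma>) e * arc_vol e) = v $ j" for j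
    using vector_type_matrix[of v "\<lambda>u. u" j] v(2) by (simp add: V_matrix_def)
  show H: "v \<bullet> (H_matrix \<sigma> *v 1) = (\<Sum>e\<in>arcs (scheme_graph \<sigma>). v $ tail (scheme_graph \<sigma>) e * arc_vol e * graph.len e)"
    by (simp add: H_matrix_def inner_type_matrix graph.len_def mult.assoc)
  obtain i where "v $ i \<noteq> 0" using v(1) by (auto simp: vec_eq_iff)
  then show "v \<bullet> (H_matrix \<sigma> *v 1) \<noteq> 0"
    unfolding H using graph.invariant_mean_len_nonzero[of "($) v" i] inv by simp
qed

section \<open>The limit law\<close>

text \<open>The value \<open>flux v 0 / h\<close> of the renewal theorem, written in the volume
  \<open>x = exp z\<close> instead of its logarithm; \<open>1 / x\<close> is the Jacobian.\<close>

definition mean :: "real ^ 'n \<Rightarrow> ('n \<Rightarrow> real \<Rightarrow> real) \<Rightarrow> real" where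
  "mean v f = (\<Sum>e\<in>arcs (scheme_graph \<sigma>). v $ tail (scheme_graph \<sigma>) e * arc_vol e *
      integral {arc_vol e..1} (\<lambda>x. f (head (scheme_graph \<sigma>) e) x / x)) / (v \<bullet> (H_matrix \<sigma> *v 1))"

text \<open>The constant 1 is not admissible, so its mean is computed directly: the integral of
  \<open>1 / x\<close> over \<open>{arc_vol e..1}\<close> is the arc length, and the numerator
  becomes the denominator.\<close>

lemma mean_one:
  assumes "left_PF_eigenvector (V_matrix \<sigma>) v"
  shows "mean v (\<lambda>_ _. 1) = 1"
proof -
  have "integral {arc_vol e..1} (\<lambda>x. 1 / x) = graph.len e" if "e \<in> arcs (scheme_graph \<sigma>)" for e
  proof -
    have "((\<lambda>x. 1 / x) has_integral ln 1 - ln (arc_vol e)) {arc_vol e..1}"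
      using arc_vol_bounds[OF that]
      by (intro fundamental_theorem_of_calculus)
        (auto simp: has_real_derivative_iff_has_vector_derivative[symmetric] intro!: derivative_eq_intros)
    then show ?thesis by (simp add: graph.len_def integral_unique)
  qed
  then show ?thesis
    using left_PF_eigenvector(2,3)[OF assms] by (simp add: mean_def cong: sum.cong_simp)
qed

text \<open>Vanishing at \<open>1\<close> and at the volumes of the substitution tiles makes the renewal equation hold
  at the origin as well, so that the profile is continuous.\<close>

definition admissible :: "real \<Rightarrow> real \<Rightarrow> ('n \<Rightarrow> real \<Rightarrow> real) \<Rightarrow> bool" where
  "admissible K B f \<longleftrightarrow> (\<forall>j. K-lipschitz_on UNIV (f j) \<and> (\<forall>x. \<bar>f j x\<bar> \<le> B) \<and>
      (\<forall>x\<in>insert 1 (arc_vol ` arcs (scheme_graph \<sigma>)). f j x = 0))"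

lemma exp_lipschitz: "1-lipschitz_on {..0} (exp :: real \<Rightarrow> real)"
proof (rule lipschitz_on_leI)
  fix x y :: real assume "x \<in> {..0}" "y \<in> {..0}" "x \<le> y"
  have "1 - exp (x - y) \<le> y - x" using exp_ge_add_one_self[of "x - y"] by linarith
  moreover have "exp y - exp x = exp y * (1 - exp (x - y))" by (simp add: right_diff_distrib exp_diff)
  moreover have "exp y * (1 - exp (x - y)) \<le> 1 * (1 - exp (x - y))"
    using \<open>y \<in> {..0}\<close> \<open>x \<le> y\<close> by (intro mult_right_mono) auto
  ultimately show "dist (exp x) (exp y) \<le> 1 * dist x y" using \<open>x \<le> y\<close> by (simp add: dist_real_def)
qed simp

lemma renewal_profile:
  assumes f: "admissible K B f"
  shows "renewal_solution (scheme_graph \<sigma>) arc_vol (profile f) K B"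
proof
  have lip: "K-lipschitz_on UNIV (f j)" and bd: "\<bar>f j x\<bar> \<le> B" for j x
    using f by (auto simp: admissible_def)
  fix i and y :: real
  show "\<bar>profile f i y\<bar> \<le> B" by (rule profile_bound[OF bd])
  have "(K * 1)-lipschitz_on {..0} (\<lambda>y. f i (exp y))"
    by (rule lipschitz_on_compose2[OF exp_lipschitz lipschitz_on_subset[OF lip]]) auto
  then show "K-lipschitz_on {..0} (profile f i)"
    unfolding lipschitz_on_def by (simp add: profile_le_0)
  assume "y \<ge> 0"
  show "profile f i y = (\<Sum>e\<in>out_arcs (scheme_graph \<sigma>) i. arc_vol e * profile f (head (scheme_graph \<sigma>) e) (y - graph.len e))"
  proof (cases "y = 0")
    case True
    \<comment> \<open>At the origin both sides vanish: the left one is a value at volume 1, the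
      right one involves only the volumes of substitution tiles.\<close>
    have "profile f (head (scheme_graph \<sigma>) e) (y - graph.len e) = 0" if "e \<in> out_arcs (scheme_graph \<sigma>) i" for e
      using that arc_vol_bounds[of e] f True by (simp add: profile_le_0 graph.len_def admissible_def)
    then show ?thesis using f True by (simp add: profile_le_0 admissible_def)
  next
    case False
    then have "y > 0" using \<open>y \<ge> 0\<close> by simp
    then show ?thesis
      using sum_arcs_from[of "\<lambda>x j. x * profile f j (y + ln x)" i]
      by (simp add: profile_gt_0 graph.len_def)
  qed
qed

lemma profile_tendsto:
  assumes inc: "incommensurable \<sigma>" and v: "left_PF_eigenvector (V_matrix \<sigma>) v" and f: "admissible K B f"
  shows "(profile f i \<longlongrightarrow> mean v f) at_top"
proof -
  let ?G = "scheme_graph \<sigma>"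
  interpret sol: renewal_solution ?G arc_vol "profile f" K B by (rule renewal_profile[OF f])
  obtain w w' where w: "graph.closed_w w" "graph.closed_w w'"
      "sum_list (map (arc_length \<sigma>) w) \<notin> (\<lambda>s. sum_list (map (arc_length \<sigma>) w') * s) ` \<rat>"
    using inc by (auto simp: incommensurable_def)
  have len: "map (arc_length \<sigma>) u = map graph.len u" if "graph.closed_w u" for u
    using that arc_length_eq by (intro map_cong refl) (auto simp: graph.closed_w_def graph.awalk_def)
  have flux: "sol.flux (($) v) 0 = mean v f * (v \<bullet> (H_matrix \<sigma> *v 1))"
  proof -
    \<comment> \<open>Up to 0 the profile is the test function at \<open>exp z\<close>, so the
      substitution \<open>x = exp z\<close> produces the integral in \<open>mean\<close>.\<close>
    have "integral {0 - graph.len e..0} (profile f (head ?G e)) = integral {arc_vol e..1} (\<lambda>x. f (head ?G e) x / x)"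
      if e: "e \<in> arcs ?G" for e
    proof -
      let ?F = "\<lambda>x. f (head ?G e) x / x"
      have b: "0 < arc_vol e" "arc_vol e < 1" using arc_vol_bounds[OF e] by auto
      have le: "arc_vol e \<le> exp z" if "ln (arc_vol e) \<le> z" for z
        using that b by (metis exp_le_cancel_iff exp_ln)
      have cont: "continuous_on S (f (head ?G e))" for S
        using f lipschitz_on_continuous_on continuous_on_subset unfolding admissible_def by blast
      have "((\<lambda>z. exp z *\<^sub>R ?F (exp z)) has_integral integral {exp (ln (arc_vol e))..exp 0} ?F) {ln (arc_vol e)..0}"
        using b
        by (intro has_integral_substitution[where c = "arc_vol e" and d = 1])
          (auto intro!: continuous_intros cont derivative_eq_intros le)
      then have "((\<lambda>z. f (head ?G e) (exp z)) has_integral integral {arc_vol e..1} ?F) {ln (arc_vol e)..0}"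
        using b by simp
      then have "(profile f (head ?G e) has_integral integral {arc_vol e..1} ?F) {ln (arc_vol e)..0}"
        by (rule has_integral_eq[rotated]) (simp add: profile_le_0)
      then show ?thesis by (simp add: graph.len_def integral_unique)
    qed
    then show ?thesis
      using left_PF_eigenvector(3)[OF v] by (simp add: sol.flux_def mean_def cong: sum.cong_simp)
  qed
  have "(profile f i \<longlongrightarrow> sol.flux (($) v) 0 / (v \<bullet> (H_matrix \<sigma> *v 1))) at_top"
    using w len left_PF_eigenvector[OF v] by (intro sol.renewal_limit[of w w']) auto
  then show ?thesis using flux left_PF_eigenvector(3)[OF v] by simp
qed

end

section \<open>Uniform frequencies\<close>

definition cutoff :: "real set \<Rightarrow> nat \<Rightarrow> real \<Rightarrow> real" where
  "cutoff E n x = min 1 (real n * infdist x E)"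

lemma cutoff_bounds: "0 \<le> cutoff E n x" "cutoff E n x \<le> 1"
  by (simp_all add: cutoff_def infdist_nonneg)

lemma cutoff_zero: "x \<in> E \<Longrightarrow> cutoff E n x = 0"
  by (simp add: cutoff_def)

lemma cutoff_lipschitz: "\<bar>cutoff E n x - cutoff E n y\<bar> \<le> real n * \<bar>x - y\<bar>"
proof -
  have "\<bar>min 1 s - min 1 t\<bar> \<le> \<bar>s - t\<bar>" for s t :: real by linarith
  then have "\<bar>cutoff E n x - cutoff E n y\<bar> \<le> \<bar>real n * infdist x E - real n * infdist y E\<bar>"
    unfolding cutoff_def .
  also have "\<dots> = real n * \<bar>infdist x E - infdist y E\<bar>"
    by (simp add: abs_mult right_diff_distrib[symmetric])
  also have "\<dots> \<le> real n * \<bar>x - y\<bar>"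
    using infdist_triangle_abs[of x E y] by (intro mult_left_mono) (auto simp: dist_real_def)
  finally show ?thesis .
qed

lemma cutoff_tendsto:
  assumes "finite E" "E \<noteq> {}" "x \<notin> E"
  shows "(\<lambda>n. cutoff E n x) \<longlonglongrightarrow> 1"
proof (rule tendsto_eventually)
  have "infdist x E > 0"
    using assms finite_imp_closed[OF assms(1)] in_closed_iff_infdist_zero[of E x] infdist_nonneg[of x E] by fastforce
  then obtain N :: nat where N: "1 < real N * infdist x E" using ex_less_of_nat_mult by blast
  have "cutoff E n x = 1" if "n \<ge> N" for n
  proof -
    have "real N * infdist x E \<le> real n * infdist x E" using that by (intro mult_right_mono infdist_nonneg) auto
    then show ?thesis using N by (simp add: cutoff_def)
  qed
  then show "\<forall>\<^sub>F n in sequentially. cutoff E n x = 1" by (auto simp: eventually_sequentially)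
qed

text \<open>The jumps at \<open>a\<close> and \<open>b\<close> disappear because the cutoff vanishes
  there and grows with slope at most \<open>n\<close>; this accounts for the summand
  \<open>C * real n\<close>.\<close>

lemma lipschitz_interval_cutoff:
  assumes \<phi>: "K-lipschitz_on UNIV \<phi>" "\<And>x. \<bar>\<phi> x\<bar> \<le> C" and E: "a \<in> E" "b \<in> E"
  shows "(K + C * real n)-lipschitz_on UNIV (\<lambda>x. (if a \<le> x \<and> x \<le> b then \<phi> x else 0) * cutoff E n x)"
proof -
  define F where "F x = (if a \<le> x \<and> x \<le> b then \<phi> x else 0) * cutoff E n x" for x
  have K: "K \<ge> 0" using \<phi>(1) lipschitz_on_nonneg by blast
  have C: "C \<ge> 0" using \<phi>(2)[of 0] by linarith
  have *: "\<bar>F x - F y\<bar> \<le> (K + C * real n) * (y - x)" if xy: "x \<le> y" for x y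
  proof -
    \<comment> \<open>If just one of \<open>x\<close> and \<open>y\<close> lies in the interval, an
      endpoint lies between them, so the possibly non-zero value is taken within
      \<open>y - x\<close> of a zero of the cutoff.\<close>
    have edge: "\<bar>F z\<bar> \<le> C * real n * (y - x)" if "e \<in> E" "\<bar>z - e\<bar> \<le> y - x" for z e
    proof -
      have "\<bar>F z\<bar> \<le> C * cutoff E n z"
        unfolding F_def abs_mult using \<phi>(2) C cutoff_bounds[of E n z] by (intro mult_mono) auto
      also have "cutoff E n z \<le> real n * (y - x)"
      proof -
        have "cutoff E n z \<le> real n * \<bar>z - e\<bar>"
          using cutoff_lipschitz[of E n z e] cutoff_zero[OF that(1)] cutoff_bounds[of E n z] by simp
        also have "\<dots> \<le> real n * (y - x)" using that(2) by (intro mult_left_mono) auto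
        finally show ?thesis .
      qed
      finally show ?thesis using C by (simp add: mult_left_mono mult.assoc)
    qed
    have zero: "F z = 0" if "\<not> (a \<le> z \<and> z \<le> b)" for z using that by (auto simp: F_def)
    have Kpos: "C * real n * (y - x) \<le> (K + C * real n) * (y - x)"
      using K xy by (intro mult_right_mono) auto
    consider "a \<le> x \<and> x \<le> b" "a \<le> y \<and> y \<le> b" | "a \<le> x \<and> x \<le> b" "\<not> (a \<le> y \<and> y \<le> b)"
      | "\<not> (a \<le> x \<and> x \<le> b)" "a \<le> y \<and> y \<le> b" | "\<not> (a \<le> x \<and> x \<le> b)" "\<not> (a \<le> y \<and> y \<le> b)" by blast
    then show ?thesis
    proof cases
      case 1
      have "F x - F y = (\<phi> x - \<phi> y) * cutoff E n x + \<phi> y * (cutoff E n x - cutoff E n y)"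
        using 1 by (simp add: F_def algebra_simps)
      also have "\<bar>\<dots>\<bar> \<le> \<bar>\<phi> x - \<phi> y\<bar> * cutoff E n x + \<bar>\<phi> y\<bar> * \<bar>cutoff E n x - cutoff E n y\<bar>"
        using cutoff_bounds[of E n x] by (intro abs_triangle_ineq[THEN order_trans]) (simp add: abs_mult)
      also have "\<dots> \<le> (K * (y - x)) * 1 + C * (real n * (y - x))"
      proof (intro add_mono mult_mono)
        show "\<bar>\<phi> x - \<phi> y\<bar> \<le> K * (y - x)"
          using lipschitz_onD[OF \<phi>(1), of x y] xy by (simp add: dist_real_def abs_minus_commute)
        show "\<bar>cutoff E n x - cutoff E n y\<bar> \<le> real n * (y - x)" using cutoff_lipschitz[of E n x y] xy by simp
      qed (use \<phi>(2) C K xy cutoff_bounds[of E n x] in auto)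
      finally show ?thesis by (simp add: algebra_simps)
    next
      case 2
      then have "\<bar>F x\<bar> \<le> C * real n * (y - x)" "F y = 0" using edge[OF E(2), of x] zero[of y] xy by auto
      then show ?thesis using Kpos by linarith
    next
      case 3
      then have "\<bar>F y\<bar> \<le> C * real n * (y - x)" "F x = 0" using edge[OF E(1), of y] zero[of x] xy by auto
      then show ?thesis using Kpos by linarith
    next
      case 4
      then show ?thesis using zero K C xy by simp
    qed
  qed
  have "(K + C * real n)-lipschitz_on UNIV F"
  proof (rule lipschitz_on_leI)
    fix x y :: real assume "x \<le> y"
    then show "dist (F x) (F y) \<le> (K + C * real n) * dist x y"
      using *[of x y] by (simp add: dist_real_def)
  qed (use K C in simp)
  then show ?thesis by (simp add: F_def)
qed

text \<open>Both sides integrate \<open>\<psi>\<close> over the intersection of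
  \<open>{p..1}\<close> and \<open>{a..b}\<close>; the strict bound \<open>p < x\<close>, which
  comes from the matrices, changes a single point.\<close>

lemma integral_interval_swap:
  fixes \<psi> :: "real \<Rightarrow> real"
  assumes "continuous_on {p..1} \<psi>"
  shows "(\<lambda>x. if p < x \<and> x \<le> 1 then \<psi> x else 0) integrable_on {a..b}"
    "integral {a..b} (\<lambda>x. if p < x \<and> x \<le> 1 then \<psi> x else 0) = integral {p..1} (\<lambda>x. if a \<le> x \<and> x \<le> b then \<psi> x else 0)"
proof -
  have J: "{p..1} \<inter> {a..b} = {max p a..min 1 b}" by auto
  have "\<psi> integrable_on {max p a..min 1 b}"
    by (intro integrable_continuous_real continuous_on_subset[OF assms]) auto
  then have "(\<psi> has_integral integral ({p..1} \<inter> {a..b}) \<psi>) ({p..1} \<inter> {a..b})"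
    unfolding J by (rule integrable_integral)
  then have "((\<lambda>x. if x \<in> {p..1} then \<psi> x else 0) has_integral integral ({p..1} \<inter> {a..b}) \<psi>) {a..b}"
    by (simp only: has_integral_restrict_Int)
  then have *: "((\<lambda>x. if p < x \<and> x \<le> 1 then \<psi> x else 0) has_integral integral ({p..1} \<inter> {a..b}) \<psi>) {a..b}"
    by (rule has_integral_spike_finite[of "{p}", rotated 2]) auto
  then show "(\<lambda>x. if p < x \<and> x \<le> 1 then \<psi> x else 0) integrable_on {a..b}" by blast
  have "integral {p..1} (\<lambda>x. if a \<le> x \<and> x \<le> b then \<psi> x else 0) = integral ({a..b} \<inter> {p..1}) \<psi>"
    using integral_restrict_Int[of "{p..1}" "{a..b}" \<psi>] by simp
  then show "integral {a..b} (\<lambda>x. if p < x \<and> x \<le> 1 then \<psi> x else 0) = integral {p..1} (\<lambda>x. if a \<le> x \<and> x \<le> b then \<psi> x else 0)"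
    using integral_unique[OF *] by (simp add: Int_commute)
qed

lemma abs_divide_diff:
  fixes V :: real
  assumes "V > 0"
  shows "\<bar>w / V - L\<bar> = \<bar>w - L * V\<bar> / V"
proof -
  have "w / V - L = (w - L * V) / V" using assms by (simp add: diff_divide_distrib)
  then show ?thesis using assms by (simp add: abs_divide)
qed

section \<open>Van Hove sequences\<close>

lemma frontier_nbhd_translate: "frontier_nbhd \<rho> ((+) h ` A) = (+) h ` frontier_nbhd \<rho> A"
proof -
  have "(\<Union>x\<in>frontier A. ball (h + x) \<rho>) = (\<Union>x\<in>frontier A. (+) h ` ball x \<rho>)"
    by (simp only: ball_translation)
  then show ?thesis by (simp only: frontier_nbhd_def frontier_translation image_UN SUP_image o_def)
qed

lemma van_Hove_nbhd:
  assumes "van_Hove A" "\<rho> > 0"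
  shows "(\<lambda>q. vol (frontier_nbhd \<rho> (A q)) / vol (A q)) \<longlonglongrightarrow> 0"
  using assms by (simp add: van_Hove_def frontier_nbhd_def)

text \<open>A bounded set of positive volume has a frontier point, so its 1-neighborhood of the
  frontier contains a unit ball. The quotient can tend to 0 only if the volumes tend to
  infinity.\<close>

lemma van_Hove_vol_large:
  fixes A :: "nat \<Rightarrow> 'a::euclidean_space set"
  assumes "van_Hove A"
  shows "\<forall>\<^sub>F q in sequentially. vol (A q) \<ge> M"
proof -
  define c where "c = vol (ball (0::'a) 1)"
  have c: "c > 0" unfolding c_def by (simp add: content_ball_pos)
  have "c / (\<bar>M\<bar> + 1) > 0" using c by simp
  then have "\<forall>\<^sub>F q in sequentially. vol (frontier_nbhd 1 (A q)) / vol (A q) < c / (\<bar>M\<bar> + 1)"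
    using van_Hove_nbhd[OF assms, of 1] by (simp add: order_tendsto_iff)
  with eventually_ge_at_top[of 1] show ?thesis
  proof eventually_elim
    case (elim q)
    have A: "bounded (A q)" "vol (A q) > 0" using assms elim(1) by (auto simp: van_Hove_def)
    have "A q \<noteq> {}" "A q \<noteq> UNIV" using A not_bounded_UNIV by auto
    then obtain x where x: "x \<in> frontier (A q)" using frontier_eq_empty by blast
    have "c = vol ((+) x ` ball 0 1)" unfolding c_def by (rule measure_translation[symmetric])
    also have "\<dots> = vol (ball x 1)" by (simp only: ball_translation[of x 0 1, symmetric] add_0_right)
    also have "\<dots> \<le> vol (frontier_nbhd 1 (A q))"
      using x lmeasurable_frontier_nbhd[OF A(1)]
      by (intro measure_mono_fmeasurable) (auto simp: frontier_nbhd_def)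
    also have "\<dots> < c / (\<bar>M\<bar> + 1) * vol (A q)" using elim(2) A(2) by (simp add: pos_divide_less_eq)
    finally have "c * (\<bar>M\<bar> + 1) < c * vol (A q)" by (simp add: field_simps)
    then have "\<bar>M\<bar> + 1 < vol (A q)" using c by (rule mult_less_cancel_left_pos[THEN iffD1, rotated])
    then show ?case by linarith
  qed
qed

section \<open>Uniform limits of tile weights\<close>

context normalized_scheme
begin

text \<open>The constant 1 does not vanish at volume 1 and escapes the renewal theorem; the covering
  property of the tiling handles it. The bounds are translation invariant, hence uniform in
  \<open>h\<close>.\<close>

lemma uniform_tile_weight_one:
  assumes tiling: "generated_tiling \<sigma> \<T>" and A: "van_Hove A"
  shows "uniform_limit UNIV (\<lambda>q h. tile_weight \<sigma> (\<lambda>_ _. 1) {T \<in> \<T>. tile_set \<sigma> T \<subseteq> (+) h ` A q} / vol (A q))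
      (\<lambda>_. 1) sequentially"
proof (rule uniform_limitI)
  fix e :: real assume e: "e > 0"
  obtain D where D: "D > 0"
    "\<And>T x y. tile_scale T > 0 \<Longrightarrow> tile_vol \<sigma> T \<le> 1 \<Longrightarrow> x \<in> tile_set \<sigma> T \<Longrightarrow> y \<in> tile_set \<sigma> T \<Longrightarrow> dist x y \<le> D"
    using tile_diameter[of 1] by blast
  define \<rho> where "\<rho> = D + 1"
  have \<rho>: "D < \<rho>" "\<rho> > 0" using D(1) by (simp_all add: \<rho>_def)
  have "\<forall>\<^sub>F q in sequentially. vol (frontier_nbhd \<rho> (A q)) / vol (A q) < e"
    using van_Hove_nbhd[OF A \<rho>(2)] e by (simp add: order_tendsto_iff)
  with eventually_ge_at_top[of 1]
  show "\<forall>\<^sub>F q in sequentially. \<forall>h\<in>UNIV. dist (tile_weight \<sigma> (\<lambda>_ _. 1) {T \<in> \<T>. tile_set \<sigma> T \<subseteq> (+) h ` A q} / vol (A q)) 1 < e"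
  proof eventually_elim
    case (elim q)
    have Aq: "bounded (A q)" "A q \<in> sets lebesgue" "vol (A q) > 0"
      using A elim(1) by (auto simp: van_Hove_def)
    show ?case
    proof
      fix h
      have "bounded ((+) h ` A q)" "(+) h ` A q \<in> sets lebesgue"
        using Aq bounded_translation lebesgue_sets_translation by blast+
      note W = tile_weight_within_one[OF tiling this _ \<rho>(1)]
      let ?W = "tile_weight \<sigma> (\<lambda>_ _. 1) {T \<in> \<T>. tile_set \<sigma> T \<subseteq> (+) h ` A q}"
      have "?W \<le> vol ((+) h ` A q)" by (rule W(1)) (rule D(2))
      moreover have "vol ((+) h ` A q) \<le> ?W + vol (frontier_nbhd \<rho> ((+) h ` A q))" by (rule W(2)) (rule D(2))
      ultimately have "\<bar>?W - vol (A q)\<bar> \<le> vol (frontier_nbhd \<rho> (A q))"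
        by (simp add: measure_translation frontier_nbhd_translate)
      then have "\<bar>?W - vol (A q)\<bar> / vol (A q) < e"
        using elim(2) Aq(3) by (simp add: pos_divide_less_eq)
      then show "dist (?W / vol (A q)) 1 < e"
        using abs_divide_diff[OF Aq(3), of ?W 1] by (simp add: dist_real_def)
    qed
  qed
qed

lemma tile_weight_tiles_in:
  assumes tiling: "generated_tiling \<sigma> \<T>" and A: "bounded A"
  shows "tile_weight \<sigma> (\<lambda>j x. if j = r \<and> a \<le> x \<and> x \<le> b then \<phi> x else 0) {T \<in> \<T>. tile_set \<sigma> T \<subseteq> A}
    = (\<Sum>T\<in>tiles_in \<sigma> \<T> r a b A. tile_vol \<sigma> T * \<phi> (tile_vol \<sigma> T))"
proof -
  have "tiles_in \<sigma> \<T> r a b A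
      = {T \<in> {T \<in> \<T>. tile_set \<sigma> T \<subseteq> A}. tile_label T = r \<and> a \<le> tile_vol \<sigma> T \<and> tile_vol \<sigma> T \<le> b}"
    by (auto simp: tiles_in_def)
  then show ?thesis
    unfolding tile_weight_def
    by (simp only: sum.inter_filter[OF finite_tiles_within[OF tiling A]]) (intro sum.cong refl, simp)
qed

lemma finite_tiles_in:
  assumes "generated_tiling \<sigma> \<T>" "bounded A"
  shows "finite (tiles_in \<sigma> \<T> r a b A)"
  using finite_tiles_within[OF assms] by (rule finite_subset[rotated]) (auto simp: tiles_in_def)

text \<open>Volume times \<open>1 / x\<close> counts a tile once. The truncation by
  \<open>min_ratio\<close> makes the density bounded and Lipschitz and leaves its values at the
  volumes of tiles unchanged.\<close>

lemma card_tiles_in: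
  assumes tiling: "generated_tiling \<sigma> \<T>" and A: "bounded A"
  shows "real (card (tiles_in \<sigma> \<T> r a b A))
    = tile_weight \<sigma> (\<lambda>j x. if j = r \<and> a \<le> x \<and> x \<le> b then 1 / max x min_ratio else 0) {T \<in> \<T>. tile_set \<sigma> T \<subseteq> A}"
proof -
  have "tile_vol \<sigma> T * (1 / max (tile_vol \<sigma> T) min_ratio) = 1" if "T \<in> tiles_in \<sigma> \<T> r a b A" for T
    using generated_tiling_vol(2)[OF tiling, of T] min_ratio(1) that by (simp add: tiles_in_def)
  then have "(\<Sum>T\<in>tiles_in \<sigma> \<T> r a b A. tile_vol \<sigma> T * (1 / max (tile_vol \<sigma> T) min_ratio))
      = (\<Sum>T\<in>tiles_in \<sigma> \<T> r a b A. 1)" by (rule sum.cong[OF refl])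
  then show ?thesis unfolding tile_weight_tiles_in[OF assms] by simp
qed

lemma vol_tiles_in:
  assumes tiling: "generated_tiling \<sigma> \<T>" and A: "bounded A"
  shows "vol (\<Union>T\<in>tiles_in \<sigma> \<T> r a b A. tile_set \<sigma> T)
    = tile_weight \<sigma> (\<lambda>j x. if j = r \<and> a \<le> x \<and> x \<le> b then 1 else 0) {T \<in> \<T>. tile_set \<sigma> T \<subseteq> A}"
proof -
  have sub: "tiles_in \<sigma> \<T> r a b A \<subseteq> \<T>" by (auto simp: tiles_in_def)
  then have "vol (\<Union>T\<in>tiles_in \<sigma> \<T> r a b A. tile_set \<sigma> T) = (\<Sum>T\<in>tiles_in \<sigma> \<T> r a b A. tile_vol \<sigma> T)"
    unfolding tile_vol_def
    using finite_tiles_in[OF assms] tiling_pairwise[OF tiling sub] generated_tiling_vol(1)[OF tiling] lmeasurable_tile_set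
    by (intro measure_negligible_finite_Union_image) auto
  then show ?thesis unfolding tile_weight_tiles_in[OF assms] by simp
qed

end

context irreducible_normalized_scheme
begin

text \<open>Dominated convergence on each \<open>{arc_vol e..1}\<close>, where \<open>1 / x\<close>
  is bounded; the finite set \<open>E\<close>, where convergence to \<open>g\<close> may fail, is
  null.\<close>

lemma mean_tendsto:
  assumes E: "finite E" and F: "\<And>n j. continuous_on UNIV (F n j)" "\<And>n j x. \<bar>F n j x\<bar> \<le> C"
    "\<And>n j x. x \<in> E \<Longrightarrow> F n j x = 0" "\<And>j x. x \<notin> E \<Longrightarrow> (\<lambda>n. F n j x) \<longlonglongrightarrow> g j x"
    and h: "v \<bullet> (H_matrix \<sigma> *v 1) \<noteq> 0"
  shows "(\<lambda>n. mean v (F n)) \<longlonglongrightarrow> mean v g"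
  unfolding mean_def
proof (intro tendsto_divide tendsto_sum tendsto_mult tendsto_const h)
  fix e assume "e \<in> arcs (scheme_graph \<sigma>)"
  define u where "u = arc_vol e"
  define j where "j = head (scheme_graph \<sigma>) e"
  have u: "0 < u" "u < 1" using arc_vol_bounds \<open>e \<in> _\<close> by (auto simp: u_def)
  have "(\<lambda>n. integral {u..1} (\<lambda>x. F n j x / x)) \<longlonglongrightarrow> integral {u..1} (\<lambda>x. if x \<in> E then 0 else g j x / x)"
  proof (rule dominated_convergence(2)[where h = "\<lambda>_. C / u"])
    show "(\<lambda>x. F n j x / x) integrable_on {u..1}" for n
      using u by (intro integrable_continuous_real continuous_intros continuous_on_subset[OF F(1)]) auto
    have C: "C \<ge> 0" using F(2)[of 0 j 0] by linarith
    show "norm (F n j x / x) \<le> C / u" if "x \<in> {u..1}" for n x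
      using that u F(2)[of n j x] C by (auto simp: intro!: frac_le)
    show "(\<lambda>n. F n j x / x) \<longlonglongrightarrow> (if x \<in> E then 0 else g j x / x)" if "x \<in> {u..1}" for x
      using that u F(3,4) by (auto intro!: tendsto_intros)
  qed auto
  also have "integral {u..1} (\<lambda>x. if x \<in> E then 0 else g j x / x) = integral {u..1} (\<lambda>x. g j x / x)"
    by (rule integral_spike[OF negligible_finite[OF E]]) auto
  finally show "(\<lambda>n. integral {arc_vol e..1} (\<lambda>x. F n (head (scheme_graph \<sigma>) e) x / x))
      \<longlonglongrightarrow> integral {arc_vol e..1} (\<lambda>x. g (head (scheme_graph \<sigma>) e) x / x)"
    unfolding u_def j_def .
qed

text \<open>The precision fixes \<open>Y\<close>, this fixes the supertile volume
  \<open>\<Lambda>\<close>, then come \<open>D\<close>, \<open>\<rho>\<close> and finally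
  \<open>q\<close>. No choice involves \<open>h\<close>, which enters only through translation
  invariant volumes.\<close>

lemma uniform_tile_weight_admissible:
  assumes inc: "incommensurable \<sigma>" and tiling: "generated_tiling \<sigma> \<T>"
    and v: "left_PF_eigenvector (V_matrix \<sigma>) v" and A: "van_Hove A" and f: "admissible K B f"
  shows "uniform_limit UNIV (\<lambda>q h. tile_weight \<sigma> f {T \<in> \<T>. tile_set \<sigma> T \<subseteq> (+) h ` A q} / vol (A q))
      (\<lambda>_. mean v f) sequentially"
proof (rule uniform_limitI)
  fix e :: real assume e: "e > 0"
  define L where "L = mean v f"
  have "\<forall>i\<in>UNIV. \<forall>\<^sub>F y in at_top. dist (profile f i y) L < e / 2"
    unfolding L_def using e by (intro ballI tendstoD[OF profile_tendsto[OF inc v f]]) simp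
  then have "\<forall>\<^sub>F y in at_top. \<forall>i\<in>UNIV. dist (profile f i y) L < e / 2"
    by (intro eventually_ball_finite) auto
  then obtain Y where Y: "\<And>i y. y \<ge> Y \<Longrightarrow> \<bar>profile f i y - L\<bar> \<le> e / 2"
    by (auto simp: eventually_at_top_linorder dist_real_def intro: less_imp_le)
  \<comment> \<open>Supertiles have volume at least \<open>\<Lambda> * min_ratio\<close>, hence at
    least \<open>exp Y\<close>, where the profile is already close to its limit.\<close>
  define \<Lambda> where "\<Lambda> = max 1 (exp Y / min_ratio)"
  have \<Lambda>: "\<Lambda> \<ge> 1" "exp Y \<le> \<Lambda> * min_ratio"
    using min_ratio(1) by (simp_all add: \<Lambda>_def pos_divide_le_eq[symmetric])
  have conv: "\<bar>profile f j y - L\<bar> \<le> e / 2" if "y \<ge> ln (\<Lambda> * min_ratio)" for j y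
  proof -
    have "Y \<le> ln (\<Lambda> * min_ratio)" using \<Lambda> by (metis exp_gt_zero less_le_trans ln_exp ln_le_cancel_iff)
    then show ?thesis using Y that by simp
  qed
  obtain D where D: "D > 0"
    "\<And>T x y. tile_scale T > 0 \<Longrightarrow> tile_vol \<sigma> T \<le> \<Lambda> \<Longrightarrow> x \<in> tile_set \<sigma> T \<Longrightarrow> y \<in> tile_set \<sigma> T \<Longrightarrow> dist x y \<le> D"
    using tile_diameter[of \<Lambda>] by blast
  define \<rho> where "\<rho> = 3 * D + 1"
  have \<rho>: "3 * D < \<rho>" "\<rho> > 0" using D(1) by (simp_all add: \<rho>_def)
  have lip: "K-lipschitz_on UNIV (f j)" and bd: "\<bar>f j x\<bar> \<le> B" for j x
    using f by (auto simp: admissible_def)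
  have cont: "isCont (f j) x" for j x
    using lipschitz_on_continuous_on[OF lip] by (simp add: continuous_on_eq_continuous_at)
  define C where "C = B + 2 * \<bar>L\<bar> + 1"
  have C: "C > 0" using bd[of undefined 0] by (simp add: C_def)
  \<comment> \<open>The bound \<open>1/2\<close> together with \<open>V \<ge> 2 * \<Lambda>\<close>
    gives the size hypothesis of \<open>patch_estimate\<close>; the other bound keeps the boundary
    error below \<open>e / 2\<close>.\<close>
  have "min (1/2) (e / (2 * C)) > 0" using e C by simp
  then have "\<forall>\<^sub>F q in sequentially. vol (frontier_nbhd \<rho> (A q)) / vol (A q) < min (1/2) (e / (2 * C))"
    using order_tendstoD(2)[OF van_Hove_nbhd[OF A \<rho>(2)]] by blast
  with eventually_ge_at_top[of 1] van_Hove_vol_large[OF A, of "2 * \<Lambda>"]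
  show "\<forall>\<^sub>F q in sequentially. \<forall>h\<in>UNIV. dist (tile_weight \<sigma> f {T \<in> \<T>. tile_set \<sigma> T \<subseteq> (+) h ` A q} / vol (A q)) (mean v f) < e"
  proof eventually_elim
    case (elim q)
    have Aq: "bounded (A q)" "A q \<in> sets lebesgue" "vol (A q) > 0"
      using A elim(1) by (auto simp: van_Hove_def)
    define V where "V = vol (A q)"
    define N where "N = vol (frontier_nbhd \<rho> (A q))"
    have V: "V > 0" "V \<ge> 2 * \<Lambda>" using Aq elim by (simp_all add: V_def)
    have N: "N < V / 2" "N < e / (2 * C) * V" "N \<ge> 0"
      using elim(3) V(1) unfolding V_def N_def by (auto simp: pos_divide_less_eq)
    show ?case
    proof
      fix h
      let ?W = "tile_weight \<sigma> f {T \<in> \<T>. tile_set \<sigma> T \<subseteq> (+) h ` A q}"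
      have A': "bounded ((+) h ` A q)" "(+) h ` A q \<in> sets lebesgue"
        using Aq bounded_translation lebesgue_sets_translation by blast+
      have eqs: "vol ((+) h ` A q) = V" "vol (frontier_nbhd \<rho> ((+) h ` A q)) = N"
        by (simp_all add: V_def N_def measure_translation frontier_nbhd_translate)
      have "\<bar>?W - L * vol ((+) h ` A q)\<bar>
          \<le> e / 2 * vol ((+) h ` A q) + (B + 2 * \<bar>L\<bar>) * vol (frontier_nbhd \<rho> ((+) h ` A q))"
        by (rule patch_estimate[OF tiling \<Lambda>(1) cont bd conv D(1) _ \<rho>(1) A'])
          (use D(2) N(1) V(2) eqs in auto)
      also have "\<dots> \<le> e / 2 * V + C * N" unfolding eqs C_def using N(3) by (simp add: algebra_simps)
      also have "\<dots> < e / 2 * V + C * (e / (2 * C) * V)" using N(2) C by (intro add_strict_left_mono mult_strict_left_mono)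
      also have "\<dots> = e * V" using C by (simp add: field_simps)
      finally have "\<bar>?W - L * V\<bar> / V < e" unfolding eqs using V by (simp add: pos_divide_less_eq)
      then have "\<bar>?W / V - L\<bar> < e" by (simp only: abs_divide_diff[OF V(1)])
      then show "dist (?W / vol (A q)) (mean v f) < e" unfolding V_def L_def by (simp add: dist_real_def)
    qed
  qed
qed

text \<open>The error \<open>\<bar>g - F n\<bar>\<close> is at most \<open>C * (1 - cutoff E n)\<close>, whose total weight is controlled because the
  total weights of both \<open>1\<close> and the admissible function \<open>cutoff E n\<close> converge.\<close>

lemma uniform_tile_weight_interval:
  fixes a b :: real and r :: 'n and \<phi> :: "real \<Rightarrow> real"
  assumes inc: "incommensurable \<sigma>" and tiling: "generated_tiling \<sigma> \<T>"
    and v: "left_PF_eigenvector (V_matrix \<sigma>) v" and A: "van_Hove A"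
    and \<phi>: "K-lipschitz_on UNIV \<phi>" "\<And>x. \<bar>\<phi> x\<bar> \<le> C"
  defines "g \<equiv> \<lambda>j x. if j = r \<and> a \<le> x \<and> x \<le> b then \<phi> x else 0"
  shows "uniform_limit UNIV (\<lambda>q h. tile_weight \<sigma> g {T \<in> \<T>. tile_set \<sigma> T \<subseteq> (+) h ` A q} / vol (A q))
      (\<lambda>_. mean v g) sequentially"
proof (rule uniform_limitI)
  fix e :: real assume e: "e > 0"
  have C: "C \<ge> 0" using \<phi>(2)[of 0] by linarith
  have K: "K \<ge> 0" using \<phi>(1) lipschitz_on_nonneg by blast
  \<comment> \<open>The ends \<open>a\<close> and \<open>b\<close> make the product of
    \<open>g\<close> and the cutoff continuous; the remaining points make it and the cutoff itself
    admissible.\<close>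
  define E where "E = insert a (insert b (insert 1 (arc_vol ` arcs (scheme_graph \<sigma>))))"
  have E: "finite E" "E \<noteq> {}" "a \<in> E" "b \<in> E" using finite_arcs_scheme_graph by (auto simp: E_def)
  define F where "F n j x = g j x * cutoff E n x" for n j x
  define X where "X n j x = cutoff E n x" for n x and j :: 'n
  have gb: "\<bar>g j x\<bar> \<le> C" for j x using \<phi>(2) C by (simp add: g_def)
  have Fb: "\<bar>F n j x\<bar> \<le> C" for n j x
  proof -
    have "\<bar>g j x\<bar> * \<bar>cutoff E n x\<bar> \<le> C * 1" using gb C cutoff_bounds[of E n x] by (intro mult_mono) auto
    then show ?thesis by (simp add: F_def abs_mult)
  qed
  have Xl: "(real n)-lipschitz_on UNIV (X n j)" for n j
    by (rule lipschitz_onI) (simp_all add: X_def dist_real_def cutoff_lipschitz)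
  have Fl: "(K + C * real n)-lipschitz_on UNIV (F n j)" for n j
  proof (cases "j = r")
    case True
    then show ?thesis
      using lipschitz_interval_cutoff[OF \<phi> E(3,4), of n] by (simp add: F_def[abs_def] g_def)
  next
    case False
    then show ?thesis using K C by (simp add: F_def[abs_def] g_def lipschitz_on_def)
  qed
  have admF: "admissible (K + C * real n) C (F n)" for n
    using Fl Fb by (auto simp: admissible_def F_def E_def cutoff_zero)
  have admX: "admissible (real n) 1 (X n)" for n
    using Xl cutoff_bounds by (auto simp: admissible_def X_def E_def cutoff_zero abs_le_iff intro: order_trans[of _ 0])
  note h = left_PF_eigenvector(3)[OF v]
  have mF: "(\<lambda>n. mean v (F n)) \<longlonglongrightarrow> mean v g"
  proof (rule mean_tendsto[OF E(1) _ Fb _ _ h])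
    show "continuous_on UNIV (F n j)" for n j using Fl lipschitz_on_continuous_on by blast
    show "(\<lambda>n. F n j x) \<longlonglongrightarrow> g j x" if "x \<notin> E" for j x
      using tendsto_mult[OF tendsto_const[of "g j x"] cutoff_tendsto[OF E(1,2) that]] by (simp add: F_def)
  qed (simp add: F_def cutoff_zero)
  have mX: "(\<lambda>n. mean v (X n)) \<longlonglongrightarrow> mean v (\<lambda>_ _. 1)"
  proof (rule mean_tendsto[OF E(1) _ _ _ _ h])
    show "continuous_on UNIV (X n j)" for n j using Xl lipschitz_on_continuous_on by blast
    show "\<bar>X n j x\<bar> \<le> 1" for n j x using cutoff_bounds[of E n x] by (simp add: X_def)
    show "(\<lambda>n. X n j x) \<longlonglongrightarrow> 1" if "x \<notin> E" for j x
      using cutoff_tendsto[OF E(1,2) that] by (simp add: X_def)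
  qed (simp add: X_def cutoff_zero)
  \<comment> \<open>Three errors of size \<open>\<delta>\<close> add up: the limits of the weights
    of \<open>1\<close> and of \<open>X n\<close>, and the distance of \<open>mean v (X n)\<close>
    from 1. Multiplied by \<open>C\<close> they use one of the quarters of \<open>e\<close>.\<close>
  define \<delta> where "\<delta> = e / (12 * (C + 1))"
  have \<delta>: "\<delta> > 0" "C * (3 * \<delta>) \<le> e / 4" using e C by (simp_all add: \<delta>_def field_simps)
  have "\<forall>\<^sub>F n in sequentially. \<bar>mean v (F n) - mean v g\<bar> < e / 4 \<and> \<bar>mean v (X n) - 1\<bar> < \<delta>"
    using tendstoD[OF mF, of "e / 4"] tendstoD[OF mX, of \<delta>] e \<delta>(1)
    by (simp add: mean_one[OF v] dist_real_def eventually_conj_iff)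
  then obtain n where n: "\<bar>mean v (F n) - mean v g\<bar> < e / 4" "\<bar>mean v (X n) - 1\<bar> < \<delta>"
    by (auto dest!: eventually_happens)
  have "e / 4 > 0" using e by simp
  note ev = uniform_limitD[OF uniform_tile_weight_admissible[OF inc tiling v A admF[of n]] this]
    uniform_limitD[OF uniform_tile_weight_admissible[OF inc tiling v A admX[of n]] \<delta>(1)]
    uniform_limitD[OF uniform_tile_weight_one[OF tiling A] \<delta>(1)]
  from ev eventually_ge_at_top[of 1]
  show "\<forall>\<^sub>F q in sequentially. \<forall>h\<in>UNIV. dist (tile_weight \<sigma> g {T \<in> \<T>. tile_set \<sigma> T \<subseteq> (+) h ` A q} / vol (A q)) (mean v g) < e"
  proof eventually_elim
    case (elim q)
    have Aq: "bounded (A q)" "vol (A q) > 0" using A elim(4) by (auto simp: van_Hove_def)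
    show ?case
    proof
      fix h
      define P where "P = {T \<in> \<T>. tile_set \<sigma> T \<subseteq> (+) h ` A q}"
      define V where "V = vol (A q)"
      have V: "V > 0" using Aq by (simp add: V_def)
      have "\<bar>tile_weight \<sigma> g P - tile_weight \<sigma> (F n) P\<bar>
          = \<bar>\<Sum>T\<in>P. tile_vol \<sigma> T * g (tile_label T) (tile_vol \<sigma> T) * (1 - cutoff E n (tile_vol \<sigma> T))\<bar>"
        by (simp add: tile_weight_def F_def sum_subtractf[symmetric] algebra_simps)
      also have "\<dots> \<le> (\<Sum>T\<in>P. C * (tile_vol \<sigma> T * (1 - cutoff E n (tile_vol \<sigma> T))))"
      proof (intro sum_abs[THEN order_trans] sum_mono)
        fix T assume "T \<in> P"
        then have "tile_vol \<sigma> T > 0" using generated_tiling_vol(1)[OF tiling] tile_vol_pos by (auto simp: P_def)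
        moreover have "1 - cutoff E n (tile_vol \<sigma> T) \<ge> 0" using cutoff_bounds[of E n "tile_vol \<sigma> T"] by simp
        ultimately have "0 \<le> tile_vol \<sigma> T * (1 - cutoff E n (tile_vol \<sigma> T))" by simp
        from mult_right_mono[OF gb[of "tile_label T" "tile_vol \<sigma> T"] this]
        show "\<bar>tile_vol \<sigma> T * g (tile_label T) (tile_vol \<sigma> T) * (1 - cutoff E n (tile_vol \<sigma> T))\<bar>
            \<le> C * (tile_vol \<sigma> T * (1 - cutoff E n (tile_vol \<sigma> T)))"
          using \<open>tile_vol \<sigma> T > 0\<close> \<open>1 - cutoff E n (tile_vol \<sigma> T) \<ge> 0\<close> by (simp add: abs_mult mult_ac)
      qed
      also have "\<dots> = C * (tile_weight \<sigma> (\<lambda>_ _. 1) P - tile_weight \<sigma> (X n) P)"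
        by (simp add: tile_weight_def X_def sum_distrib_left sum_subtractf right_diff_distrib)
      finally have "\<bar>tile_weight \<sigma> g P - tile_weight \<sigma> (F n) P\<bar> / V
          \<le> C * (tile_weight \<sigma> (\<lambda>_ _. 1) P - tile_weight \<sigma> (X n) P) / V"
        using V by (intro divide_right_mono) auto
      then have "\<bar>tile_weight \<sigma> g P / V - tile_weight \<sigma> (F n) P / V\<bar>
          \<le> C * (tile_weight \<sigma> (\<lambda>_ _. 1) P / V - tile_weight \<sigma> (X n) P / V)"
        using V by (simp add: abs_divide diff_divide_distrib[symmetric])
      also have "\<dots> \<le> C * (3 * \<delta>)"
      proof (intro mult_left_mono C)
        have "\<bar>tile_weight \<sigma> (\<lambda>_ _. 1) P / V - 1\<bar> < \<delta>" "\<bar>tile_weight \<sigma> (X n) P / V - mean v (X n)\<bar> < \<delta>"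
          using elim(2,3) by (simp_all add: P_def V_def dist_real_def)
        then show "tile_weight \<sigma> (\<lambda>_ _. 1) P / V - tile_weight \<sigma> (X n) P / V \<le> 3 * \<delta>"
          using n(2) by linarith
      qed
      finally have "\<bar>tile_weight \<sigma> g P / V - tile_weight \<sigma> (F n) P / V\<bar> \<le> e / 4" using \<delta>(2) by linarith
      moreover have "\<bar>tile_weight \<sigma> (F n) P / V - mean v (F n)\<bar> < e / 4"
        using elim(1) by (simp add: P_def V_def dist_real_def)
      ultimately have "\<bar>tile_weight \<sigma> g P / V - mean v g\<bar> < e" using n(1) e by linarith
      then show "dist (tile_weight \<sigma> g {T \<in> \<T>. tile_set \<sigma> T \<subseteq> (+) h ` A q} / vol (A q)) (mean v g) < e"
        by (simp add: P_def V_def dist_real_def)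
    qed
  qed
qed

text \<open>Turns the integrals over \<open>{arc_vol e..1}\<close> into one integral over
  \<open>{a..b}\<close>. Only arcs into \<open>r\<close> survive, which leaves entry
  \<open>r\<close> of a vector-matrix product.\<close>

lemma mean_interval:
  assumes "continuous_on UNIV \<phi>"
  shows "mean v (\<lambda>j x. if j = r \<and> a \<le> x \<and> x \<le> b then \<phi> x else 0)
    = integral {a..b} (\<lambda>x. (\<Sum>e\<in>in_arcs (scheme_graph \<sigma>) r. v $ tail (scheme_graph \<sigma>) e *
        (if arc_vol e < x \<and> x \<le> 1 then arc_vol e * (\<phi> x / x) else 0)) / (v \<bullet> (H_matrix \<sigma> *v 1)))"
proof -
  let ?G = "scheme_graph \<sigma>"
  let ?I = "\<lambda>e x. if arc_vol e < x \<and> x \<le> 1 then \<phi> x / x else 0"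
  have cont: "continuous_on {arc_vol e..1} (\<lambda>x. \<phi> x / x)" if "e \<in> arcs ?G" for e
    using arc_vol_bounds[OF that] by (intro continuous_intros continuous_on_subset[OF assms]) auto
  have fin: "finite (in_arcs ?G r)" using finite_arcs_scheme_graph by (simp add: in_arcs_def)
  have "(\<Sum>e\<in>arcs ?G. v $ tail ?G e * arc_vol e *
      integral {arc_vol e..1} (\<lambda>x. (if head ?G e = r \<and> a \<le> x \<and> x \<le> b then \<phi> x else 0) / x))
    = (\<Sum>e\<in>arcs ?G. if head ?G e = r then v $ tail ?G e * arc_vol e * integral {a..b} (?I e) else 0)"
  proof (intro sum.cong refl)
    fix e assume e: "e \<in> arcs ?G"
    show "v $ tail ?G e * arc_vol e * integral {arc_vol e..1} (\<lambda>x. (if head ?G e = r \<and> a \<le> x \<and> x \<le> b then \<phi> x else 0) / x)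
      = (if head ?G e = r then v $ tail ?G e * arc_vol e * integral {a..b} (?I e) else 0)"
    proof (cases "head ?G e = r")
      case True
      have "integral {arc_vol e..1} (\<lambda>x. (if head ?G e = r \<and> a \<le> x \<and> x \<le> b then \<phi> x else 0) / x)
          = integral {arc_vol e..1} (\<lambda>x. if a \<le> x \<and> x \<le> b then \<phi> x / x else 0)"
        using True by (intro integral_cong) simp
      then show ?thesis using True integral_interval_swap(2)[OF cont[OF e], of a b] by simp
    qed simp
  qed
  also have "\<dots> = (\<Sum>e\<in>in_arcs ?G r. v $ tail ?G e * arc_vol e * integral {a..b} (?I e))"
    unfolding in_arcs_def using finite_arcs_scheme_graph by (subst sum.inter_filter) auto
  also have "\<dots> = (\<Sum>e\<in>in_arcs ?G r. integral {a..b} (\<lambda>x. v $ tail ?G e * arc_vol e * ?I e x))"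
    by simp
  also have "\<dots> = integral {a..b} (\<lambda>x. \<Sum>e\<in>in_arcs ?G r. v $ tail ?G e * arc_vol e * ?I e x)"
    using integral_interval_swap(1)[OF cont] fin
    by (intro integral_sum[symmetric] integrable_on_mult_right) auto
  finally show ?thesis
    unfolding mean_def by (simp add: if_distrib mult.assoc cong: if_cong)
qed

end

theorem corollary2p5:
  fixes \<sigma> :: "(real ^ 'd, 'n::finite) scheme"
    and \<T> :: "(real ^ 'd, 'n) tile set"
    and r :: 'n and a b :: real and v :: "real ^ 'n"
    and A :: "nat \<Rightarrow> (real ^ 'd) set"
  assumes "multiscale_scheme \<sigma>" and "normalized \<sigma>"
    and "irreducible_scheme \<sigma>" and "incommensurable \<sigma>"
    and "generated_tiling \<sigma> \<T>"
    and "0 \<le> a" and "a < b" and "b \<le> 1"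
    and "left_PF_eigenvector (V_matrix \<sigma>) v"
    and "van_Hove A"
  shows "uniform_limit UNIV
           (\<lambda>q h. real (card (tiles_in \<sigma> \<T> r a b ((+) h ` A q))) / vol (A q))
           (\<lambda>h. integral {a..b} (\<lambda>x. (v v* C_matrix \<sigma> x) $ r / (v \<bullet> (H_matrix \<sigma> *v 1))))
           sequentially
       \<and> uniform_limit UNIV
           (\<lambda>q h. vol (\<Union>T\<in>tiles_in \<sigma> \<T> r a b ((+) h ` A q). tile_set \<sigma> T) / vol (A q))
           (\<lambda>h. integral {a..b} (\<lambda>x. (v v* D_matrix \<sigma> x) $ r / (v \<bullet> (H_matrix \<sigma> *v 1))))
           sequentially"
proof -
  interpret irreducible_normalized_scheme \<sigma> using assms by unfold_locales
  note tiling = \<open>generated_tiling \<sigma> \<T>\<close>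
  let ?G = "scheme_graph \<sigma>"
  let ?c = "\<lambda>x. 1 / max x min_ratio"
  have bdd: "bounded ((+) h ` A q)" if "q \<ge> 1" for h q
    using \<open>van_Hove A\<close> that by (auto simp: van_Hove_def intro: bounded_translation)
  note lim = uniform_tile_weight_interval[OF \<open>incommensurable \<sigma>\<close> tiling assms(9) \<open>van_Hove A\<close>, where r = r and a = a and b = b]
  have c: "(1 / min_ratio\<^sup>2)-lipschitz_on UNIV ?c" "\<And>x. \<bar>?c x\<bar> \<le> 1 / min_ratio"
  proof -
    show "\<bar>?c x\<bar> \<le> 1 / min_ratio" for x using min_ratio(1) by (simp add: frac_le)
    show "(1 / min_ratio\<^sup>2)-lipschitz_on UNIV ?c"
    proof (rule lipschitz_onI)
      fix x y
      have m: "max x min_ratio > 0" "max y min_ratio > 0" using min_ratio(1) by auto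
      have "dist (?c x) (?c y) = \<bar>max y min_ratio - max x min_ratio\<bar> / (max x min_ratio * max y min_ratio)"
        using m by (simp add: dist_real_def diff_frac_eq abs_divide abs_mult)
      also have "\<dots> \<le> \<bar>x - y\<bar> / (min_ratio * min_ratio)"
        using min_ratio(1) by (intro frac_le mult_mono mult_pos_pos) auto
      finally show "dist (?c x) (?c y) \<le> 1 / min_ratio\<^sup>2 * dist x y"
        by (simp add: dist_real_def power2_eq_square)
    qed simp
  qed
  \<comment> \<open>Where the indicator is non-zero, \<open>x\<close> exceeds
    \<open>arc_vol e\<close> and so \<open>min_ratio\<close>; the truncation in \<open>?c\<close> is
    inactive there and \<open>?c x / x\<close> is the factor \<open>1 / x\<^sup>2\<close> of
    \<open>C_matrix\<close>.\<close>
  have C: "(v v* C_matrix \<sigma> x) $ r = (\<Sum>e\<in>in_arcs ?G r. v $ tail ?G e * (if arc_vol e < x \<and> x \<le> 1 then arc_vol e * (?c x / x) else 0))" for x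
    unfolding C_matrix_def vector_type_matrix
  proof (intro sum.cong refl)
    fix e assume "e \<in> in_arcs ?G r"
    then have "min_ratio \<le> arc_vol e" using arc_vol_bounds[of e] by auto
    then show "v $ tail ?G e * (if arc_vol e < x \<and> x \<le> 1 then arc_vol e / x\<^sup>2 else 0)
      = v $ tail ?G e * (if arc_vol e < x \<and> x \<le> 1 then arc_vol e * (?c x / x) else 0)"
      by (simp add: power2_eq_square)
  qed
  have D: "(v v* D_matrix \<sigma> x) $ r = (\<Sum>e\<in>in_arcs ?G r. v $ tail ?G e * (if arc_vol e < x \<and> x \<le> 1 then arc_vol e * (1 / x) else 0))" for x
    unfolding D_matrix_def vector_type_matrix by (simp cong: if_cong)
  have count: "uniform_limit UNIV (\<lambda>q h. real (card (tiles_in \<sigma> \<T> r a b ((+) h ` A q))) / vol (A q))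
      (\<lambda>h. integral {a..b} (\<lambda>x. (v v* C_matrix \<sigma> x) $ r / (v \<bullet> (H_matrix \<sigma> *v 1)))) sequentially"
    unfolding C mean_interval[OF lipschitz_on_continuous_on[OF c(1)], symmetric]
    \<comment> \<open>The two sequences are identified from \<open>q = 1\<close> on only, since
      \<open>A 0\<close> is arbitrary.\<close>
    by (rule uniform_limit_cong[THEN iffD1, OF _ _ lim[OF c]])
      (auto simp: eventually_sequentially card_tiles_in[OF tiling bdd] intro!: exI[of _ 1])
  have one: "0-lipschitz_on UNIV (\<lambda>_::real. 1::real)" "\<And>x::real. \<bar>1::real\<bar> \<le> 1" by (simp_all add: lipschitz_intros)
  have volume: "uniform_limit UNIV (\<lambda>q h. vol (\<Union>T\<in>tiles_in \<sigma> \<T> r a b ((+) h ` A q). tile_set \<sigma> T) / vol (A q))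
      (\<lambda>h. integral {a..b} (\<lambda>x. (v v* D_matrix \<sigma> x) $ r / (v \<bullet> (H_matrix \<sigma> *v 1)))) sequentially"
    unfolding D mean_interval[OF continuous_on_const, symmetric]
    by (rule uniform_limit_cong[THEN iffD1, OF _ _ lim[OF one]])
      (auto simp: eventually_sequentially vol_tiles_in[OF tiling bdd] intro!: exI[of _ 1])
  show ?thesis using count volume by blast
qed

end
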